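(* Fix an integer $d\ge1$, $s>0$, $L>0$, $\alpha\in(0,e^{-1})$, $\beta\in(0,1-\alpha)$, and suppose $3\le n_1\le n_2$ with $n_1\asymp n_2$ (i.e. $n_2\le c_0n_1$ for a fixed constant $c_0$). There is a sufficiently large constant $C(s,d,L,\alpha,\beta)>0$ (possibly depending also on the implicit constant $c_0$, but not on $n_1,n_2$) such that whenever $$\epsilon_{n_1,n_2}\ \ge\ C(s,d,L,\alpha,\beta)\left(\frac{\log\log n_1}{n_1}\right)^{\frac{2s}{4s+d}},$$ for testing $\mathcal{P}_0=\{(P_Y,P_Z)\in\mathcal{P}^{(d,s)}_{\text{Hölder}}:f_Y=f_Z\}$ against $\mathcal{P}_1=\{(P_Y,P_Z)\in\mathcal{P}^{(d,s)}_{\text{Hölder}}:\|f_Y-f_Z\|_{L_2}\ge\epsilon_{n_1,n_2}\}$, the adaptive test $\phi_{\rm adapt}$ defined in the context (which does not depend on $s$) satisfies $$\sup_{P\in\mathcal{P}_0}\mathbb{P}_P(\phi_{\rm adapt}=1)\le\alpha\quad\text{and}\quad\sup_{P\in\mathcal{P}_1}\mathbb{P}_P(\phi_{\rm adapt}=0)\le\beta .$$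
   Context: Hölder class: $\mathcal{H}^d_s(L)$ is the class of functions $f:[0,1]^d\to\mathbb{R}$ with (1) $|f^{(\lfloor s\rfloor)}(x)-f^{(\lfloor s\rfloor)}(x')|\le L\|x-x'\|^{s-\lfloor s\rfloor}$ for all $x,x'\in[0,1]^d$, and (2) $\|f^{(s')}\|_\infty\le L$ for each $s'\in\{1,\dots,\lfloor s\rfloor\}$, where $f^{(k)}$ denotes the $k$-th order derivative (the array of all order-$k$ partial derivatives). $\mathcal{P}^{(d,s)}_{\text{Hölder}}$ is the set of pairs $(P_Y,P_Z)$ of distributions on $[0,1]^d$ whose Lebesgue densities $f_Y,f_Z$ both belong to $\mathcal{H}^d_s(L)$. $\|f\|_{L_2}^2=\int f^2(x)\,dx$. Data: $Y_1,\dots,Y_{n_1}$ i.i.d. from $P_Y$ and, independently, $Z_1,\dots,Z_{n_2}$ i.i.d. from $P_Z$. Single test: for an integer $\kappa\geq 1$ and level $a\in(0,1)$, partition $[0,1]^d$ into $\kappa^d$ hypercubes of side length $\kappa^{-1}$ and let $g(x,y)=1$ if $x,y$ lie in the same hypercube and $0$ otherwise. Let $h_{\rm ts}(y_1,y_2;z_1,z_2):=g(y_1,y_2)+g(z_1,z_2)-g(y_1,z_2)-g(y_2,z_1)$ and let $U_{n_1,n_2}$ be the average of $h_{\rm ts}(Y_{i_1},Y_{i_2};Z_{j_1},Z_{j_2})$ over all $i_1\ne i_2$ in $\{1,\dots,n_1\}$ and $j_1\ne j_2$ in $\{1,\dots,n_2\}$. With $n=n_1+n_2$ and $(X_1,\dots,X_n)=(Y_1,\dots,Y_{n_1},Z_1,\dots,Z_{n_2})$,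 let $U^\pi_{n_1,n_2}$ be the statistic recomputed with $(X_{\pi_1},\dots,X_{\pi_{n_1}})$ as first and $(X_{\pi_{n_1+1}},\dots,X_{\pi_n})$ as second sample, and $c_{1-a,n}:=\inf\{t:\frac1{n!}\sum_\pi\mathbb{1}(U^\pi_{n_1,n_2}\le t)\ge1-a\}$. Put $\phi_{\kappa,a}:=\mathbb{1}(U_{n_1,n_2}>c_{1-a,n})$. Adaptive test: $\gamma_{\max}:=\left\lceil\frac2d\log_2\left(\frac{n_1}{\log\log n_1}\right)\right\rceil$, $\mathsf{K}:=\{2^j:j=1,\dots,\gamma_{\max}\}$ and $\phi_{\rm adapt}:=\max_{\kappa\in\mathsf{K}}\phi_{\kappa,\alpha/\gamma_{\max}}$. *)

theory Defs
  imports "HOL-Probability.Probability" "HOL-Combinatorics.Permutations"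
begin

section \<open>Hoelder densities on the unit cube\<close>

abbreviation unit_cube :: "(real ^ 'd) set" where
  "unit_cube \<equiv> cbox 0 1"

definition coord_upd :: "real ^ 'd \<Rightarrow> 'd \<Rightarrow> real \<Rightarrow> real ^ 'd" where
  "coord_upd x i t = (\<chi> j. if j = i then t else x $ j)"

text \<open>Partial derivatives are taken within the cube, hence one-sided on its faces, so that only
  the values of the function on the cube matter.\<close>

definition has_partial :: "'d \<Rightarrow> (real ^ 'd \<Rightarrow> real) \<Rightarrow> real ^ 'd \<Rightarrow> bool" where
  "has_partial i f x \<longleftrightarrow> (\<lambda>t. f (coord_upd x i t)) differentiable (at (x $ i) within {0..1})"

definition partial :: "'d \<Rightarrow> (real ^ 'd \<Rightarrow> real) \<Rightarrow> real ^ 'd \<Rightarrow> real" where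
  "partial i f x = vector_derivative (\<lambda>t. f (coord_upd x i t)) (at (x $ i) within {0..1})"

text \<open>The entries of the array of order-\<open>k\<close> partial derivatives are
  \<open>iter_partial is f\<close> for the lists \<open>is\<close> of length \<open>k\<close>.\<close>

fun iter_partial :: "'d list \<Rightarrow> (real ^ 'd \<Rightarrow> real) \<Rightarrow> real ^ 'd \<Rightarrow> real" where
  "iter_partial [] f = f"
| "iter_partial (i # is) f = partial i (iter_partial is f)"

definition has_partials_upto :: "nat \<Rightarrow> (real ^ 'd \<Rightarrow> real) \<Rightarrow> bool" where
  "has_partials_upto k f \<longleftrightarrow>
     (\<forall>is i. length is < k \<longrightarrow> (\<forall>x\<in>unit_cube. has_partial i (iter_partial is f) x))"

text \<open>The array of derivatives is measured by its largest entry. Any larger norm (Euclidean,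
  operator) gives a smaller class for the same \<open>L\<close>. If \<open>s\<close> is an integer then the exponent in the
  Hoelder condition is zero; the convention \<open>0 powr 0 = 0\<close> only affects the trivial case
  \<open>x = x'\<close>.\<close>

definition holder_class :: "real \<Rightarrow> real \<Rightarrow> (real ^ 'd \<Rightarrow> real) set" where
  "holder_class s L = {f.
     has_partials_upto (nat \<lfloor>s\<rfloor>) f \<and>
     (\<forall>is. length is = nat \<lfloor>s\<rfloor> \<longrightarrow> (\<forall>x\<in>unit_cube. \<forall>x'\<in>unit_cube.
        \<bar>iter_partial is f x - iter_partial is f x'\<bar>
          \<le> L * norm (x - x') powr (s - of_int \<lfloor>s\<rfloor>))) \<and>
     (\<forall>is. length is \<in> {1..nat \<lfloor>s\<rfloor>} \<longrightarrow> (\<forall>x\<in>unit_cube. \<bar>iter_partial is f x\<bar> \<le> L))}"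

definition has_cube_density :: "(real ^ 'd) measure \<Rightarrow> (real ^ 'd \<Rightarrow> real) \<Rightarrow> bool" where
  "has_cube_density P f \<longleftrightarrow>
     prob_space P \<and> (\<forall>x\<in>unit_cube. 0 \<le> f x) \<and>
     P = density lborel (\<lambda>x. ennreal (indicator unit_cube x * f x))"

definition L2_norm_cube :: "(real ^ 'd \<Rightarrow> real) \<Rightarrow> real" where
  "L2_norm_cube f = sqrt (LINT x:unit_cube|lborel. (f x)\<^sup>2)"

definition holder_null ::
    "real \<Rightarrow> real \<Rightarrow> ((real ^ 'd) measure \<times> (real ^ 'd) measure) set" where
  "holder_null s L = {(P, Q). \<exists>f\<in>holder_class s L. \<exists>g\<in>holder_class s L.
     has_cube_density P f \<and> has_cube_density Q g \<and> (\<forall>x\<in>unit_cube. f x = g x)}"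

definition holder_alt ::
    "real \<Rightarrow> real \<Rightarrow> real \<Rightarrow> ((real ^ 'd) measure \<times> (real ^ 'd) measure) set" where
  "holder_alt s L \<epsilon> = {(P, Q). \<exists>f\<in>holder_class s L. \<exists>g\<in>holder_class s L.
     has_cube_density P f \<and> has_cube_density Q g \<and> L2_norm_cube (\<lambda>x. f x - g x) \<ge> \<epsilon>}"

section \<open>The permutation test\<close>

text \<open>The pooled sample \<open>(Y\<^sub>1, \<dots>, Y\<^sub>m, Z\<^sub>1, \<dots>, Z\<^sub>n)\<close> is a point of the product space, with
  indices counted from zero: \<open>{..<m}\<close> is the first sample, \<open>{m..<m + n}\<close> the second.\<close>

definition pooled_sample ::
    "nat \<Rightarrow> nat \<Rightarrow> (real ^ 'd) measure \<Rightarrow> (real ^ 'd) measure \<Rightarrow> (nat \<Rightarrow> real ^ 'd) measure" where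
  "pooled_sample m n P Q = PiM {..<m + n} (\<lambda>i. if i < m then P else Q)"

text \<open>The hypercubes are half-open, products of intervals \<open>[j/\<kappa>, (j + 1)/\<kappa>)\<close>, except that the
  last interval in each direction is closed.\<close>

definition cube_index :: "nat \<Rightarrow> real ^ 'd \<Rightarrow> int ^ 'd" where
  "cube_index \<kappa> x = (\<chi> i. min \<lfloor>real \<kappa> * x $ i\<rfloor> (int \<kappa> - 1))"

definition same_cube :: "nat \<Rightarrow> real ^ 'd \<Rightarrow> real ^ 'd \<Rightarrow> real" where
  "same_cube \<kappa> x y = of_bool (cube_index \<kappa> x = cube_index \<kappa> y)"

definition h_ts :: "nat \<Rightarrow> real ^ 'd \<Rightarrow> real ^ 'd \<Rightarrow> real ^ 'd \<Rightarrow> real ^ 'd \<Rightarrow> real" where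
  "h_ts \<kappa> y1 y2 z1 z2 =
     same_cube \<kappa> y1 y2 + same_cube \<kappa> z1 z2 - same_cube \<kappa> y1 z2 - same_cube \<kappa> y2 z1"

definition U_stat :: "nat \<Rightarrow> nat \<Rightarrow> nat \<Rightarrow> (nat \<Rightarrow> real ^ 'd) \<Rightarrow> real" where
  "U_stat m n \<kappa> x =
     (\<Sum>i1\<in>{..<m}. \<Sum>i2\<in>{..<m} - {i1}. \<Sum>j1\<in>{m..<m + n}. \<Sum>j2\<in>{m..<m + n} - {j1}.
        h_ts \<kappa> (x i1) (x i2) (x j1) (x j2))
     / (real m * (real m - 1) * real n * (real n - 1))"

definition perm_quantile :: "nat \<Rightarrow> nat \<Rightarrow> nat \<Rightarrow> real \<Rightarrow> (nat \<Rightarrow> real ^ 'd) \<Rightarrow> real" where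
  "perm_quantile m n \<kappa> a x =
     Inf {t. (\<Sum>p | p permutes {..<m + n}. of_bool (U_stat m n \<kappa> (x \<circ> p) \<le> t)) / fact (m + n)
             \<ge> 1 - a}"

definition perm_test :: "nat \<Rightarrow> nat \<Rightarrow> nat \<Rightarrow> real \<Rightarrow> (nat \<Rightarrow> real ^ 'd) \<Rightarrow> nat" where
  "perm_test m n \<kappa> a x = of_bool (U_stat m n \<kappa> x > perm_quantile m n \<kappa> a x)"

definition gamma_max :: "nat \<Rightarrow> nat \<Rightarrow> nat" where
  "gamma_max d m = nat \<lceil>2 / real d * log 2 (real m / ln (ln (real m)))\<rceil>"

definition adaptive_test :: "nat \<Rightarrow> nat \<Rightarrow> real \<Rightarrow> (nat \<Rightarrow> real ^ 'd) \<Rightarrow> nat" where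
  "adaptive_test m n \<alpha> x =
     (let \<gamma> = gamma_max CARD('d) m
      in Max ((\<lambda>\<kappa>. perm_test m n \<kappa> (\<alpha> / real \<gamma>) x) ` {2 ^ j | j. j \<in> {1..\<gamma>}}))"

end

theory Submission
  imports Defs
begin

text \<open>Level: the pooled sample is exchangeable under the null, so each permutation test has its nominal
  size, and the sizes add up to \<open>\<alpha>\<close> over the at most \<open>\<gamma>\<close> scales.

  Power: conditionally on the sample, the permuted statistic is compared by Jensen's inequality with a
  statistic in which the two samples are matched in pairs. Random swaps inside the pairs turn it into
  a Rademacher chaos, whose exponential moments are controlled by the number \<open>G\<close> of pairs of
  observations sharing a cell. Hence the critical value is of order \<open>m\<^sup>-\<^sup>2 sqrt G log (1 / a)\<close>: the factor
  \<open>log (1 / a)\<close>, instead of a power of \<open>1 / a\<close>, is what makes the price of adaptation an iterated logarithm.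
  The statistic itself concentrates around the sum \<open>D\<close> of the squared differences of the cell
  probabilities (Hoeffding decomposition, Chebyshev).

  Bias: on a block of \<open>r > \<lfloor>s\<rfloor>\<close> consecutive cells in each direction a polynomial of degree less than \<open>r\<close> in one
  variable is determined by its cell averages. Applying this in one coordinate after the other bounds a Hoelder
  function pointwise by its averages over the cells of its block, up to \<open>O(\<kappa> powr -s)\<close>; no
  multivariate Taylor expansion is needed. Hence \<open>D\<close> is at least a multiple of \<open>\<kappa>\<^sup>-\<^sup>d \<epsilon>\<^sup>2\<close> at the scale
  \<open>\<kappa> \<approx> (n / log log n) powr (2 / (4 s + d))\<close>. For small \<open>n\<close> the alternative is empty,
  because the densities in the class are uniformly bounded.\<close>

section \<open>Rademacher chaos\<close>

text \<open>The exponents come from one balance. Cells of a bounded density have probability of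
  order \<kappa>^-d, so \<open>G\<close> has mean of order m^2 \<kappa>^-d and the critical value is
  of order \<kappa>^(-d/2) log (1 / a) / m, against a signal of order \<kappa>^-d \<epsilon>^2. With
  a = \<alpha> / \<gamma> the logarithm is of order log log m. Hence \<epsilon>^2 has to exceed both
  \<kappa>^(d/2) log log m / m and \<kappa>^(-2 s), and the two bounds meet at the stated scale. Two
  obstacles shape the proof. Draws without replacement carry no independent signs; matching the
  samples creates them, and exponential moments, unlike variances, lose only a logarithm when the
  level shrinks to \<alpha> / \<gamma>. For s > 1 a density is in general not within \<kappa> powr
  -s of its own cell averages; but only a lower bound on \<open>D\<close> by the L2 distance is
  needed, and for that the averages over a few neighbouring cells may be combined. The block length
  is a power of two, so that blocks tile the cube at every dyadic scale not smaller than the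
  block.\<close>

definition offdiag :: "'a set \<Rightarrow> ('a \<Rightarrow> 'a \<Rightarrow> real) \<Rightarrow> real" where
  "offdiag I B = (\<Sum>i\<in>I. \<Sum>j\<in>I. of_bool (i \<noteq> j) * B i j)"

lemma offdiag_altdef:
  assumes "finite I"
  shows "offdiag I B = (\<Sum>i\<in>I. \<Sum>j\<in>I - {i}. B i j)"
  unfolding offdiag_def
proof (rule sum.cong[OF refl])
  fix i assume "i \<in> I"
  then show "(\<Sum>j\<in>I. of_bool (i \<noteq> j) * B i j) = (\<Sum>j\<in>I - {i}. B i j)"
    using assms by (subst sum.remove[of I i]) (auto intro!: sum.cong)
qed

lemma offdiag_cong:
  assumes "I = J" and "\<And>i j. i \<in> J \<Longrightarrow> j \<in> J \<Longrightarrow> i \<noteq> j \<Longrightarrow> B i j = C i j"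
  shows "offdiag I B = offdiag J C"
  unfolding offdiag_def assms(1) using assms(2) by (intro sum.cong refl) auto

lemma offdiag_mono:
  assumes "\<And>i j. i \<in> I \<Longrightarrow> j \<in> I \<Longrightarrow> i \<noteq> j \<Longrightarrow> B i j \<le> C i j"
  shows "offdiag I B \<le> offdiag I C"
  unfolding offdiag_def using assms by (intro sum_mono) auto

lemma offdiag_nonneg:
  assumes "\<And>i j. i \<in> I \<Longrightarrow> j \<in> I \<Longrightarrow> i \<noteq> j \<Longrightarrow> 0 \<le> B i j"
  shows "0 \<le> offdiag I B"
  unfolding offdiag_def using assms by (intro sum_nonneg) auto

lemma offdiag_add: "offdiag I (\<lambda>i j. B i j + C i j) = offdiag I B + offdiag I C"
  by (simp add: offdiag_def sum.distrib distrib_left)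

lemma offdiag_cmult: "offdiag I (\<lambda>i j. c * B i j) = c * offdiag I B"
  by (simp add: offdiag_def sum_distrib_left mult_ac)

lemma offdiag_sum: "offdiag I (\<lambda>i j. \<Sum>t\<in>T. B t i j) = (\<Sum>t\<in>T. offdiag I (B t))"
proof -
  have "offdiag I (\<lambda>i j. \<Sum>t\<in>T. B t i j)
      = (\<Sum>i\<in>I. \<Sum>j\<in>I. \<Sum>t\<in>T. of_bool (i \<noteq> j) * B t i j)"
    by (simp only: offdiag_def sum_distrib_left)
  also have "\<dots> = (\<Sum>i\<in>I. \<Sum>t\<in>T. \<Sum>j\<in>I. of_bool (i \<noteq> j) * B t i j)"
    by (intro sum.cong refl sum.swap)
  also have "\<dots> = (\<Sum>t\<in>T. \<Sum>i\<in>I. \<Sum>j\<in>I. of_bool (i \<noteq> j) * B t i j)"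
    by (rule sum.swap)
  finally show ?thesis by (simp only: offdiag_def)
qed

lemma offdiag_swap: "offdiag I (\<lambda>i j. B j i) = offdiag I B"
  unfolding offdiag_def by (subst sum.swap) (simp add: eq_commute)

lemma offdiag_subset:
  assumes "finite J" "I \<subseteq> J" and "\<And>i j. 0 \<le> B i j"
  shows "offdiag I B \<le> offdiag J B"
proof -
  have "offdiag I B \<le> (\<Sum>i\<in>I. \<Sum>j\<in>J. of_bool (i \<noteq> j) * B i j)"
    unfolding offdiag_def using assms by (intro sum_mono sum_mono2) auto
  also have "\<dots> \<le> offdiag J B"
    unfolding offdiag_def using assms by (intro sum_mono2 sum_nonneg) auto
  finally show ?thesis .
qed

lemma offdiag_image:
  assumes "inj_on f I"
  shows "offdiag (f ` I) B = offdiag I (\<lambda>i j. B (f i) (f j))"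
  unfolding offdiag_def sum.reindex[OF assms] o_def
  using assms by (intro sum.cong refl) (auto dest: inj_onD)

lemma offdiag_union:
  assumes "finite I" "finite J" "I \<inter> J = {}"
  shows "offdiag (I \<union> J) B
    = offdiag I B + offdiag J B + (\<Sum>i\<in>I. \<Sum>j\<in>J. B i j) + (\<Sum>i\<in>I. \<Sum>j\<in>J. B j i)"
proof -
  have "(\<Sum>i\<in>I. \<Sum>j\<in>J. of_bool (i \<noteq> j) * B i j) = (\<Sum>i\<in>I. \<Sum>j\<in>J. B i j)"
    "(\<Sum>i\<in>J. \<Sum>j\<in>I. of_bool (i \<noteq> j) * B i j) = (\<Sum>i\<in>J. \<Sum>j\<in>I. B i j)"
    using assms by (auto intro!: sum.cong)
  moreover have "(\<Sum>i\<in>J. \<Sum>j\<in>I. B i j) = (\<Sum>i\<in>I. \<Sum>j\<in>J. B j i)"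
    by (rule sum.swap)
  ultimately show ?thesis
    unfolding offdiag_def sum.union_disjoint[OF assms] sum.distrib by linarith
qed

lemma offdiag_insert:
  assumes "finite I" "k \<notin> I"
  shows "offdiag (insert k I) B = offdiag I B + (\<Sum>i\<in>I. B i k) + (\<Sum>i\<in>I. B k i)"
  using offdiag_union[of I "{k}" B] assms by (simp add: offdiag_def)

lemma sum_square_offdiag:
  assumes "finite I"
  shows "(\<Sum>i\<in>I. f i)\<^sup>2 = (\<Sum>i\<in>I. (f i)\<^sup>2) + offdiag I (\<lambda>i j. f i * f j)"
proof -
  have "(\<Sum>i\<in>I. f i)\<^sup>2 = (\<Sum>i\<in>I. \<Sum>j\<in>I. f i * f j)"
    by (simp add: power2_eq_square sum_product)
  also have "\<dots> = (\<Sum>i\<in>I. (f i)\<^sup>2 + (\<Sum>j\<in>I - {i}. f i * f j))"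
    using assms by (intro sum.cong refl) (simp add: sum.remove power2_eq_square)
  finally show ?thesis
    using assms by (simp add: sum.distrib offdiag_altdef)
qed

section \<open>Exponential moments of a quadratic form in random signs\<close>

lemma cosh_le_exp_half_square: "cosh x \<le> exp (x\<^sup>2 / 2)" for x :: real
proof -
  have D: "(\<lambda>n. if even n then x ^ n /\<^sub>R fact n else 0) sums cosh x"
    by (rule cosh_converges)
  have "(\<lambda>n. if even (2 * n) then x ^ (2 * n) /\<^sub>R fact (2 * n) else 0) sums cosh x"
  proof (subst sums_mono_reindex)
    show "strict_mono (\<lambda>n. 2 * n :: nat)" by (simp add: strict_mono_def)
    show "(if even n then x ^ n /\<^sub>R fact n else 0) = 0" if "n \<notin> range (\<lambda>n. 2 * n)" for n
      using that by (auto simp: image_iff dvd_def)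
  qed (rule D)
  then have 1: "(\<lambda>n. x ^ (2 * n) /\<^sub>R fact (2 * n)) sums cosh x"
    by simp
  have 2: "(\<lambda>n. (x\<^sup>2 / 2) ^ n /\<^sub>R fact n) sums exp (x\<^sup>2 / 2)"
    by (rule exp_converges)
  \<comment> \<open>Termwise comparison of the two power series; it amounts to
    \<open>2 ^ n * fact n \<le> fact (2 * n)\<close>.\<close>
  have 3: "x ^ (2 * n) /\<^sub>R fact (2 * n) \<le> (x\<^sup>2 / 2) ^ n /\<^sub>R fact n" for n
  proof -
    have "2 ^ n * fact n \<le> (fact (2 * n) :: real)"
    proof (induction n)
      case (Suc n)
      have "2 ^ Suc n * fact (Suc n) = (2 * (real n + 1)) * (2 ^ n * fact n :: real)"
        by (simp add: algebra_simps)
      also have "\<dots> \<le> (2 * (real n + 1)) * fact (2 * n)"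
        using Suc by (intro mult_left_mono) auto
      also have "\<dots> \<le> (2 * real n + 1) * ((2 * (real n + 1)) * fact (2 * n))"
        by simp
      also have "\<dots> = fact (2 * Suc n)"
        by (simp add: algebra_simps)
      finally show ?case .
    qed simp
    then have "x ^ (2 * n) / fact (2 * n) \<le> x ^ (2 * n) / (2 ^ n * fact n)"
      by (intro divide_left_mono) (auto simp: zero_le_even_power)
    moreover have "(x\<^sup>2 / 2) ^ n = x ^ (2 * n) / 2 ^ n"
      by (simp add: power_mult power_divide)
    ultimately have "x ^ (2 * n) / fact (2 * n) \<le> (x\<^sup>2 / 2) ^ n / fact n"
      by simp
    then show ?thesis
      unfolding real_scaleR_def by (simp only: divide_inverse mult.commute)
  qed
  show ?thesis
    by (rule sums_le[OF 3 1 2])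
qed

text \<open>A vector of Rademacher signs is encoded by the set \<open>T\<close> of its negative
  coordinates, so that an expectation over signs becomes a sum over \<open>Pow I\<close> divided by
  \<open>2 ^ card I\<close>.\<close>

definition flip_sign :: "'a set \<Rightarrow> 'a \<Rightarrow> real" where
  "flip_sign T i = (if i \<in> T then -1 else 1)"

lemma flip_sign_square [simp]: "flip_sign T i * flip_sign T i = 1"
  by (simp add: flip_sign_def)

text \<open>Induction on the index set: averaging over the sign of \<open>k\<close> replaces the linear term in it by
  \<open>2 (\<Sum>\<^sub>i \<epsilon>\<^sub>i A\<^sub>i\<^sub>k)\<^sup>2\<close>, which is again a constant plus an off-diagonal quadratic form.\<close>

lemma rademacher_chaos_mgf:
  assumes "finite I" and "\<And>i j. A i j = A j i" and "offdiag I (\<lambda>i j. (A i j)\<^sup>2) \<le> 1 / 64"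
  shows "(\<Sum>T\<in>Pow I. exp (offdiag I (\<lambda>i j. flip_sign T i * flip_sign T j * A i j)))
    \<le> 2 ^ card I * exp (2 * offdiag I (\<lambda>i j. (A i j)\<^sup>2))"
  using assms
proof (induction I arbitrary: A rule: finite_induct)
  case empty
  then show ?case by (simp add: offdiag_def)
next
  case (insert k I)
  define a where "a i = A i k" for i
  define v where "v = (\<Sum>i\<in>I. (a i)\<^sup>2)"
  define F where "F = offdiag I (\<lambda>i j. (A i j)\<^sup>2)"
  define A' where "A' i j = A i j + 2 * (a i * a j)" for i j
  have ak: "A k i = a i" for i using insert.prems(1) by (simp add: a_def)
  have v0: "v \<ge> 0" by (simp add: v_def sum_nonneg)
  have F0: "F \<ge> 0" by (simp add: F_def offdiag_nonneg)
  have tot: "offdiag (insert k I) (\<lambda>i j. (A i j)\<^sup>2) = F + 2 * v"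
    using insert.hyps by (simp add: offdiag_insert F_def v_def ak a_def)
  then have small: "F + 2 * v \<le> 1 / 64" using insert.prems(2) by simp
  \<comment> \<open>The induction closes because the energy grows by at most \<open>v\<close>: the
    constant \<open>2 * v\<close> split off for the index \<open>k\<close> and the bound
    \<open>2 * (F + v)\<close> for the rest add up to \<open>2 * (F + 2 * v)\<close>, twice the old
    energy.\<close>
  have F': "offdiag I (\<lambda>i j. (A' i j)\<^sup>2) \<le> F + v"
  proof (cases "v = 0")
    case True
    then have "a i = 0" if "i \<in> I" for i
      using insert.hyps(1) that by (simp add: v_def sum_nonneg_eq_0_iff)
    then have "offdiag I (\<lambda>i j. (A' i j)\<^sup>2) = F"
      unfolding F_def by (intro offdiag_cong) (auto simp: A'_def)
    then show ?thesis using v0 by simp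
  next
    case False
    then have v: "v > 0" using v0 by simp
    have pt: "(A' i j)\<^sup>2 \<le> (1 + 16 * v) * (A i j)\<^sup>2 + (4 + 1 / (4 * v)) * ((a i)\<^sup>2 * (a j)\<^sup>2)" for i j
    proof -
      let ?x = "A i j" and ?y = "a i * a j"
      \<comment> \<open>Young's inequality with a weight proportional to \<open>v\<close>: the cross
        term then costs \<open>16 * v\<close> times the energy of \<open>A\<close>, and its other
        half \<open>1 / (4 * v)\<close> meets a sum bounded by \<open>v\<^sup>2\<close>, which
        leaves only \<open>v / 4\<close>.\<close>
      have "0 \<le> (8 * v * ?x - ?y)\<^sup>2 / (4 * v)" using v by simp
      also have "\<dots> = 16 * v * ?x\<^sup>2 - 4 * ?x * ?y + ?y\<^sup>2 / (4 * v)"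
        using v by (simp add: field_simps power2_eq_square)
      finally have "4 * ?x * ?y \<le> 16 * v * ?x\<^sup>2 + ?y\<^sup>2 / (4 * v)" by simp
      then show ?thesis
        unfolding A'_def by (simp add: power2_eq_square algebra_simps)
    qed
    have vv: "offdiag I (\<lambda>i j. (a i)\<^sup>2 * (a j)\<^sup>2) \<le> v\<^sup>2"
      unfolding v_def using insert.hyps by (subst sum_square_offdiag) (auto intro!: sum_nonneg)
    have "offdiag I (\<lambda>i j. (A' i j)\<^sup>2)
        \<le> offdiag I (\<lambda>i j. (1 + 16 * v) * (A i j)\<^sup>2 + (4 + 1 / (4 * v)) * ((a i)\<^sup>2 * (a j)\<^sup>2))"
      by (intro offdiag_mono pt)
    also have "\<dots> = (1 + 16 * v) * F + (4 + 1 / (4 * v)) * offdiag I (\<lambda>i j. (a i)\<^sup>2 * (a j)\<^sup>2)"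
      by (simp add: offdiag_add offdiag_cmult F_def)
    also have "\<dots> \<le> (1 + 16 * v) * F + (4 + 1 / (4 * v)) * v\<^sup>2"
      using v vv by (intro add_left_mono mult_left_mono) auto
    also have "\<dots> = F + v * (16 * F + 4 * v + 1 / 4)"
      using v by (simp add: field_simps power2_eq_square)
    \<comment> \<open>The threshold 1/64 enters here: it keeps \<open>16 * F + 4 * v + 1 / 4\<close>
      below 1.\<close>
    also have "\<dots> \<le> F + v * 1"
      using v small F0 by (intro add_left_mono mult_left_mono) auto
    finally show ?thesis by simp
  qed
  have step: "exp (offdiag (insert k I) (\<lambda>i j. flip_sign T i * flip_sign T j * A i j))
      + exp (offdiag (insert k I) (\<lambda>i j. flip_sign (insert k T) i * flip_sign (insert k T) j * A i j))
      \<le> 2 * exp (2 * v) * exp (offdiag I (\<lambda>i j. flip_sign T i * flip_sign T j * A' i j))"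
    if T: "T \<subseteq> I" for T
  proof -
    define q where "q = offdiag I (\<lambda>i j. flip_sign T i * flip_sign T j * A i j)"
    define S where "S = (\<Sum>i\<in>I. flip_sign T i * a i)"
    have kT: "k \<notin> T" using T insert.hyps by auto
    have fk: "flip_sign T k = 1" "flip_sign (insert k T) k = -1"
      using kT by (auto simp: flip_sign_def)
    have fi: "flip_sign (insert k T) i = flip_sign T i" if "i \<in> I" for i
      using that insert.hyps by (auto simp: flip_sign_def)
    have 1: "offdiag (insert k I) (\<lambda>i j. flip_sign T i * flip_sign T j * A i j) = q + 2 * S"
      using insert.hyps by (simp add: offdiag_insert fk ak q_def S_def a_def)
    have "offdiag I (\<lambda>i j. flip_sign (insert k T) i * flip_sign (insert k T) j * A i j) = q"
      unfolding q_def by (intro offdiag_cong) (auto simp: fi)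
    moreover have "(\<Sum>i\<in>I. flip_sign (insert k T) i * a i) = S"
      unfolding S_def by (intro sum.cong) (auto simp: fi)
    ultimately have 2: "offdiag (insert k I)
        (\<lambda>i j. flip_sign (insert k T) i * flip_sign (insert k T) j * A i j) = q - 2 * S"
      using insert.hyps by (simp add: offdiag_insert fk ak a_def[symmetric] sum_negf)
    have "exp (q + 2 * S) + exp (q - 2 * S) = 2 * exp q * cosh (2 * S)"
      by (simp add: cosh_def exp_add exp_diff exp_minus field_simps)
    also have "\<dots> \<le> 2 * exp q * exp (2 * S\<^sup>2)"
      using cosh_le_exp_half_square[of "2 * S"] by simp
    also have "2 * S\<^sup>2 = 2 * v + offdiag I (\<lambda>i j. 2 * (flip_sign T i * a i * (flip_sign T j * a j)))"
      unfolding S_def v_def using insert.hyps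
      by (subst sum_square_offdiag)
        (simp_all add: offdiag_cmult power_mult_distrib power2_eq_square[of "flip_sign _ _"])
    also have "2 * exp q * exp \<dots>
        = 2 * exp (2 * v) * exp (q + offdiag I (\<lambda>i j. 2 * (flip_sign T i * a i * (flip_sign T j * a j))))"
      by (simp add: exp_add)
    also have "q + offdiag I (\<lambda>i j. 2 * (flip_sign T i * a i * (flip_sign T j * a j)))
        = offdiag I (\<lambda>i j. flip_sign T i * flip_sign T j * A' i j)"
      unfolding q_def offdiag_add[symmetric]
      by (intro offdiag_cong) (auto simp: A'_def algebra_simps)
    finally show ?thesis using 1 2 by simp
  qed
  have disj: "Pow I \<inter> insert k ` Pow I = {}" using insert.hyps by auto
  have inj: "inj_on (insert k) (Pow I)" using insert.hyps by (auto simp: inj_on_def)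
  have "(\<Sum>T\<in>Pow (insert k I). exp (offdiag (insert k I) (\<lambda>i j. flip_sign T i * flip_sign T j * A i j)))
      = (\<Sum>T\<in>Pow I. exp (offdiag (insert k I) (\<lambda>i j. flip_sign T i * flip_sign T j * A i j))
        + exp (offdiag (insert k I) (\<lambda>i j. flip_sign (insert k T) i * flip_sign (insert k T) j * A i j)))"
    using insert.hyps disj inj
    by (simp add: Pow_insert sum.union_disjoint sum.reindex sum.distrib)
  also have "\<dots> \<le> (\<Sum>T\<in>Pow I. 2 * exp (2 * v)
      * exp (offdiag I (\<lambda>i j. flip_sign T i * flip_sign T j * A' i j)))"
    using step by (intro sum_mono) auto
  also have "\<dots> = 2 * exp (2 * v)
      * (\<Sum>T\<in>Pow I. exp (offdiag I (\<lambda>i j. flip_sign T i * flip_sign T j * A' i j)))"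
    by (simp add: sum_distrib_left)
  also have "\<dots> \<le> 2 * exp (2 * v) * (2 ^ card I * exp (2 * offdiag I (\<lambda>i j. (A' i j)\<^sup>2)))"
  proof (intro mult_left_mono insert.IH)
    show "A' i j = A' j i" for i j
      using insert.prems(1)[of i j] by (simp add: A'_def mult_ac)
    show "offdiag I (\<lambda>i j. (A' i j)\<^sup>2) \<le> 1 / 64" using F' small v0 by linarith
  qed auto
  also have "\<dots> = 2 ^ card (insert k I) * exp (2 * v + 2 * offdiag I (\<lambda>i j. (A' i j)\<^sup>2))"
    using insert.hyps by (simp add: exp_add mult_ac)
  also have "\<dots> \<le> 2 ^ card (insert k I) * exp (2 * (F + 2 * v))"
    using F' by (intro mult_left_mono) auto
  finally show ?case unfolding tot .
qed

section \<open>Averages over permutations\<close>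

lemma ex_permutes_two_points:
  assumes "a \<in> A" "b \<in> A" "a \<noteq> b" "c \<in> A" "d \<in> A" "c \<noteq> d"
  shows "\<exists>p. p permutes A \<and> p a = c \<and> p b = d"
proof -
  \<comment> \<open>The first swap may move \<open>b\<close>, so the second one starts from the
    place where \<open>b\<close> has landed.\<close>
  define b' where "b' = Transposition.transpose a c b"
  have "Transposition.transpose b' d \<circ> Transposition.transpose a c permutes A"
    using assms by (intro permutes_compose permutes_swap_id) (auto simp: b'_def Transposition.transpose_def)
  moreover have "(Transposition.transpose b' d \<circ> Transposition.transpose a c) a = c" "(Transposition.transpose b' d \<circ> Transposition.transpose a c) b = d"
    using assms by (auto simp: b'_def Transposition.transpose_def)
  ultimately show ?thesis by blast
qed

text \<open>By symmetry the sum does not depend on which two distinct points are observed. It may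
  therefore be summed over all ordered pairs, and for each fixed permutation that sum is a
  rearrangement of \<open>offdiag A F\<close>.\<close>

lemma sum_permutes_two_points:
  fixes F :: "'a \<Rightarrow> 'a \<Rightarrow> real"
  assumes A: "finite A" and ab: "a \<in> A" "b \<in> A" "a \<noteq> b"
  shows "real (card A) * (real (card A) - 1) * (\<Sum>p | p permutes A. F (p a) (p b))
    = fact (card A) * offdiag A F"
proof -
  define \<Phi> where "\<Phi> a b = (\<Sum>p | p permutes A. F (p a) (p b))" for a b
  have eq: "\<Phi> c d = \<Phi> a b" if cd: "c \<in> A" "d \<in> A" "c \<noteq> d" for c d
  proof -
    obtain q where q: "q permutes A" "q a = c" "q b = d"
      using ex_permutes_two_points[OF ab cd] by blast
    show ?thesis
      unfolding \<Phi>_def by (subst (2) sum_permutations_compose_right[OF q(1)]) (simp add: q)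
  qed
  have "offdiag A \<Phi> = offdiag A (\<lambda>_ _. \<Phi> a b)"
    by (rule offdiag_cong[OF refl]) (rule eq)
  also have "\<dots> = real (card A) * (real (card A) - 1) * \<Phi> a b"
  proof -
    have "card A > 0" using A ab card_gt_0_iff by blast
    then have "real (card A - Suc 0) = real (card A) - 1" by simp
    then show ?thesis using A by (simp add: offdiag_altdef)
  qed
  finally have 1: "offdiag A \<Phi> = real (card A) * (real (card A) - 1) * \<Phi> a b" .
  have "offdiag A \<Phi> = (\<Sum>p | p permutes A. offdiag A (\<lambda>i j. F (p i) (p j)))"
    unfolding \<Phi>_def by (rule offdiag_sum)
  also have "\<dots> = (\<Sum>p | p permutes A. offdiag A F)"
  proof (intro sum.cong refl)
    fix p assume "p \<in> {p. p permutes A}"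
    then have "p permutes A" by simp
    then show "offdiag A (\<lambda>i j. F (p i) (p j)) = offdiag A F"
      using offdiag_image[OF permutes_inj_on, of p A A F] by (simp only: permutes_image)
  qed
  also have "\<dots> = fact (card A) * offdiag A F"
    using A by (subst sum_constant, subst card_permutations[OF refl A]) simp
  finally show ?thesis unfolding 1 \<Phi>_def .
qed

section \<open>The permutation distribution of the U-statistic\<close>

lemma same_cube_sym: "same_cube \<kappa> x y = same_cube \<kappa> y x"
  by (simp add: same_cube_def eq_commute)

lemma same_cube_bounds: "0 \<le> same_cube \<kappa> x y" "same_cube \<kappa> x y \<le> 1"
  by (auto simp: same_cube_def)

lemma same_cube_square: "(same_cube \<kappa> x y)\<^sup>2 = same_cube \<kappa> x y"
  by (simp add: same_cube_def power2_eq_square)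

lemma U_stat_offdiag:
  "U_stat m n \<kappa> x = offdiag {..<m} (\<lambda>i1 i2. offdiag {m..<m + n}
     (\<lambda>j1 j2. h_ts \<kappa> (x i1) (x i2) (x j1) (x j2)))
     / (real m * (real m - 1) * real n * (real n - 1))"
  by (simp only: U_stat_def offdiag_altdef finite_lessThan finite_atLeastLessThan)

text \<open>The U-statistic with the two samples matched through \<open>i \<leftrightarrow> m + i\<close>; swapping the members of
  a pair only changes signs.\<close>

definition paired_stat :: "nat \<Rightarrow> nat \<Rightarrow> (nat \<Rightarrow> real ^ 'd) \<Rightarrow> real" where
  "paired_stat m \<kappa> x = offdiag {..<m} (\<lambda>i j. h_ts \<kappa> (x i) (x j) (x (m + i)) (x (m + j)))
     / (real m * (real m - 1))"

text \<open>Under a uniformly random permutation of the second sample the partners of two distinct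
  indices form a uniformly distributed ordered pair of distinct elements, so averaging over
  matchings restores the sum over \<open>j1\<close> and \<open>j2\<close>. The condition
  \<open>m \<le> n\<close> gives each observation of the first sample a partner.\<close>

lemma U_stat_average_paired:
  fixes x :: "nat \<Rightarrow> real ^ 'd"
  assumes "2 \<le> m" "m \<le> n"
  shows "U_stat m n \<kappa> x
    = (\<Sum>q | q permutes {m..<m + n}. inverse (fact n) * paired_stat m \<kappa> (x \<circ> q))"
proof -
  let ?S = "{m..<m + n}"
  define h where "h i j k l = h_ts \<kappa> (x i) (x j) (x k) (x l)" for i j k l
  have "(\<Sum>q | q permutes ?S. paired_stat m \<kappa> (x \<circ> q))
      = (\<Sum>q | q permutes ?S. offdiag {..<m} (\<lambda>i j. h i j (q (m + i)) (q (m + j))))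
        / (real m * (real m - 1))"
    unfolding sum_divide_distrib
  proof (rule sum.cong[OF refl])
    fix q assume "q \<in> {q. q permutes ?S}"
    then have "q i = i" if "i < m" for i using that by (auto intro: permutes_not_in)
    then show "paired_stat m \<kappa> (x \<circ> q)
        = offdiag {..<m} (\<lambda>i j. h i j (q (m + i)) (q (m + j))) / (real m * (real m - 1))"
      unfolding paired_stat_def h_def
      by (intro arg_cong2[of _ _ _ _ "(/)"] offdiag_cong refl) (auto simp: lessThan_iff)
  qed
  also have "(\<Sum>q | q permutes ?S. offdiag {..<m} (\<lambda>i j. h i j (q (m + i)) (q (m + j))))
      = offdiag {..<m} (\<lambda>i j. \<Sum>q | q permutes ?S. h i j (q (m + i)) (q (m + j)))"
    by (simp add: offdiag_sum)
  also have "\<dots> = offdiag {..<m} (\<lambda>i j. (fact n / (real n * (real n - 1))) * offdiag ?S (h i j))"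
  proof (rule offdiag_cong[OF refl])
    fix i j assume ij: "i \<in> {..<m}" "j \<in> {..<m}" "i \<noteq> j"
    have "real n * (real n - 1) * (\<Sum>q | q permutes ?S. h i j (q (m + i)) (q (m + j)))
        = fact n * offdiag ?S (h i j)"
      using sum_permutes_two_points[of ?S "m + i" "m + j" "h i j"] ij assms by simp
    moreover have "real n * (real n - 1) \<noteq> 0" using assms by simp
    ultimately show "(\<Sum>q | q permutes ?S. h i j (q (m + i)) (q (m + j)))
        = (fact n / (real n * (real n - 1))) * offdiag ?S (h i j)"
      by (simp add: field_simps)
  qed
  also have "\<dots> / (real m * (real m - 1)) = fact n * U_stat m n \<kappa> x"
    unfolding offdiag_cmult U_stat_offdiag h_def by (simp add: mult_ac)
  finally show ?thesis
    by (simp add: sum_distrib_left[symmetric] o_def)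
qed

text \<open>Jensen's inequality for \<open>exp\<close> handles the average over matchings. The
  random matching then disappears: right composition with a fixed \<open>q\<close> only reorders the
  outer sum over all permutations.\<close>

lemma exp_U_stat_permutation_le_paired:
  fixes x :: "nat \<Rightarrow> real ^ 'd"
  assumes "2 \<le> m" "m \<le> n"
  shows "(\<Sum>p | p permutes {..<m + n}. exp (l * U_stat m n \<kappa> (x \<circ> p)))
    \<le> (\<Sum>p | p permutes {..<m + n}. exp (l * paired_stat m \<kappa> (x \<circ> p)))"
proof -
  let ?S = "{m..<m + n}" and ?N = "{..<m + n}"
  have fin: "finite {q. q permutes ?S}" by (intro finite_permutations) simp
  have ne: "{q. q permutes ?S} \<noteq> {}" using permutes_id by blast
  have card: "(\<Sum>q | q permutes ?S. inverse (fact n) :: real) = 1"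
    by (simp add: card_permutations[of ?S n])
  have "exp (l * U_stat m n \<kappa> (x \<circ> p))
      \<le> (\<Sum>q | q permutes ?S. inverse (fact n) * exp (l * paired_stat m \<kappa> (x \<circ> p \<circ> q)))" for p
  proof -
    have "exp (\<Sum>q | q permutes ?S. inverse (fact n) *\<^sub>R (l * paired_stat m \<kappa> (x \<circ> p \<circ> q)))
        \<le> (\<Sum>q | q permutes ?S. inverse (fact n) * exp (l * paired_stat m \<kappa> (x \<circ> p \<circ> q)))"
      by (rule convex_on_sum[OF fin ne exp_convex card]) auto
    also have "(\<Sum>q | q permutes ?S. inverse (fact n) *\<^sub>R (l * paired_stat m \<kappa> (x \<circ> p \<circ> q)))
        = l * U_stat m n \<kappa> (x \<circ> p)"
      by (simp add: U_stat_average_paired[OF assms] sum_distrib_left mult_ac)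
    finally show ?thesis .
  qed
  then have "(\<Sum>p | p permutes ?N. exp (l * U_stat m n \<kappa> (x \<circ> p)))
      \<le> (\<Sum>p | p permutes ?N. \<Sum>q | q permutes ?S.
            inverse (fact n) * exp (l * paired_stat m \<kappa> (x \<circ> p \<circ> q)))"
    by (intro sum_mono)
  also have "\<dots> = (\<Sum>q | q permutes ?S. \<Sum>p | p permutes ?N.
            inverse (fact n) * exp (l * paired_stat m \<kappa> (x \<circ> (p \<circ> q))))"
    by (subst sum.swap) (simp add: o_assoc)
  also have "\<dots> = (\<Sum>q | q permutes ?S. inverse (fact n) *
      (\<Sum>p | p permutes ?N. exp (l * paired_stat m \<kappa> (x \<circ> p))))"
  proof (rule sum.cong[OF refl])
    fix q assume "q \<in> {q. q permutes ?S}"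
    then have "q permutes ?N" by (auto intro: permutes_subset)
    from sum_permutations_compose_right[OF this, of "\<lambda>p. exp (l * paired_stat m \<kappa> (x \<circ> p))"]
    show "(\<Sum>p | p permutes ?N. inverse (fact n) * exp (l * paired_stat m \<kappa> (x \<circ> (p \<circ> q))))
        = inverse (fact n) * (\<Sum>p | p permutes ?N. exp (l * paired_stat m \<kappa> (x \<circ> p)))"
      by (simp add: sum_distrib_left)
  qed
  also have "\<dots> = (\<Sum>p | p permutes ?N. exp (l * paired_stat m \<kappa> (x \<circ> p)))"
    using card by (simp add: sum_distrib_right[symmetric] del: sum_constant)
  finally show ?thesis .
qed

definition swap_pairs :: "nat \<Rightarrow> nat set \<Rightarrow> nat \<Rightarrow> nat" where
  "swap_pairs m T i = (if i \<in> T then m + i else if m \<le> i \<and> i - m \<in> T then i - m else i)"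

lemma swap_pairs_permutes:
  assumes "T \<subseteq> {..<m}" "m \<le> n"
  shows "swap_pairs m T permutes {..<m + n}"
proof -
  have T: "i < m" if "i \<in> T" for i using assms that by auto
  have inv: "swap_pairs m T (swap_pairs m T i) = i" for i
  proof -
    consider "i \<in> T" | "i \<notin> T" "m \<le> i" "i - m \<in> T" | "i \<notin> T" "\<not> (m \<le> i \<and> i - m \<in> T)" by blast
    then show ?thesis
      by cases (auto simp: swap_pairs_def dest: T)
  qed
  moreover have "swap_pairs m T i = i" if "i \<notin> {..<m + n}" for i
    using that assms T[of i] T[of "i - m"] by (auto simp: swap_pairs_def)
  ultimately show ?thesis
    unfolding permutes_def by metis
qed

text \<open>Let \<phi> map a point to the indicator vector of its cell. Then \<open>h_ts\<close> is
  the inner product of \<phi>(y1) - \<phi>(z1) with \<phi>(y2) - \<phi>(z2), and exchanging the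
  members of one pair reverses one factor.\<close>

lemma paired_stat_swap_pairs:
  fixes x :: "nat \<Rightarrow> real ^ 'd"
  assumes "T \<subseteq> {..<m}"
  shows "paired_stat m \<kappa> (x \<circ> swap_pairs m T)
    = offdiag {..<m} (\<lambda>i j. flip_sign T i * flip_sign T j *
        (h_ts \<kappa> (x i) (x j) (x (m + i)) (x (m + j)) / (real m * (real m - 1))))"
proof -
  have T: "i < m" if "i \<in> T" for i using assms that by auto
  have "swap_pairs m T i = (if i \<in> T then m + i else i)"
    "swap_pairs m T (m + i) = (if i \<in> T then i else m + i)" if "i < m" for i
    using that T[of "m + i"] by (auto simp: swap_pairs_def)
  then have "offdiag {..<m} (\<lambda>i j. h_ts \<kappa> ((x \<circ> swap_pairs m T) i) ((x \<circ> swap_pairs m T) j)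
        ((x \<circ> swap_pairs m T) (m + i)) ((x \<circ> swap_pairs m T) (m + j)))
      = offdiag {..<m} (\<lambda>i j. flip_sign T i * flip_sign T j *
          h_ts \<kappa> (x i) (x j) (x (m + i)) (x (m + j)))"
    by (intro offdiag_cong) (auto simp: h_ts_def flip_sign_def same_cube_sym)
  then show ?thesis
    unfolding paired_stat_def
    using offdiag_cmult[of "{..<m}" "1 / (real m * (real m - 1))"] by (simp add: mult_ac)
qed

text \<open>Cauchy-Schwarz for four terms, together with the fact that \<open>same_cube\<close>
  equals its square. The right-hand side ranges over all pooled pairs and hence is invariant under
  relabelling, so that one exponent \<open>l\<close> serves every permutation at once.\<close>

lemma offdiag_h_ts_square_le:
  fixes x :: "nat \<Rightarrow> real ^ 'd"
  assumes "m \<le> n"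
  shows "offdiag {..<m} (\<lambda>i j. (h_ts \<kappa> (x i) (x j) (x (m + i)) (x (m + j)))\<^sup>2)
    \<le> 4 * offdiag {..<m + n} (\<lambda>i j. same_cube \<kappa> (x i) (x j))"
proof -
  define g where "g i j = same_cube \<kappa> (x i) (x j)" for i j
  have g: "0 \<le> g i j" "g i j = g j i" "(g i j)\<^sup>2 = g i j" for i j
    by (simp_all add: g_def same_cube_bounds same_cube_sym same_cube_square)
  have "(h_ts \<kappa> (x i) (x j) (x (m + i)) (x (m + j)))\<^sup>2
      \<le> 4 * (g i j + g (m + i) (m + j) + g i (m + j) + g (m + i) j)" for i j
  proof -
    have "(a + b - c - d)\<^sup>2 \<le> 4 * (a\<^sup>2 + b\<^sup>2 + c\<^sup>2 + d\<^sup>2)" for a b c d :: real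
    proof -
      have "4 * (a\<^sup>2 + b\<^sup>2 + c\<^sup>2 + d\<^sup>2) - (a + b - c - d)\<^sup>2
          = (a - b)\<^sup>2 + (a + c)\<^sup>2 + (a + d)\<^sup>2 + (b + c)\<^sup>2 + (b + d)\<^sup>2 + (c - d)\<^sup>2"
        by (simp add: power2_eq_square algebra_simps)
      also have "\<dots> \<ge> 0" by simp
      finally show ?thesis by simp
    qed
    from this[of "g i j" "g (m + i) (m + j)" "g i (m + j)" "g j (m + i)"]
    show ?thesis unfolding g(3) by (simp add: h_ts_def g_def same_cube_sym[of _ "x j" "x (m + i)"])
  qed
  then have "offdiag {..<m} (\<lambda>i j. (h_ts \<kappa> (x i) (x j) (x (m + i)) (x (m + j)))\<^sup>2)
      \<le> offdiag {..<m} (\<lambda>i j. 4 * (g i j + g (m + i) (m + j) + g i (m + j) + g (m + i) j))"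
    by (rule offdiag_mono)
  also have "\<dots> = 4 * (offdiag {..<m} g + offdiag {..<m} (\<lambda>i j. g (m + i) (m + j))
      + offdiag {..<m} (\<lambda>i j. g i (m + j)) + offdiag {..<m} (\<lambda>i j. g (m + i) j))"
    by (simp only: offdiag_cmult offdiag_add)
  also have "\<dots> \<le> 4 * offdiag ({..<m} \<union> (+) m ` {..<m}) g"
  proof -
    have disj: "{..<m} \<inter> (+) m ` {..<m} = {}" by auto
    have inj: "inj_on ((+) m) {..<m}" by simp
    have le: "offdiag {..<m} F \<le> (\<Sum>i\<in>{..<m}. \<Sum>j\<in>{..<m}. F i j)" if "\<And>i j. 0 \<le> F i j" for F
      unfolding offdiag_def using that by (intro sum_mono) (auto simp: of_bool_def)
    have "offdiag ({..<m} \<union> (+) m ` {..<m}) g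
      = offdiag {..<m} g + offdiag {..<m} (\<lambda>i j. g (m + i) (m + j))
        + (\<Sum>i\<in>{..<m}. \<Sum>j\<in>{..<m}. g i (m + j)) + (\<Sum>i\<in>{..<m}. \<Sum>j\<in>{..<m}. g (m + j) i)"
      by (subst offdiag_union[OF _ _ disj]) (simp_all add: offdiag_image[OF inj] sum.reindex[OF inj])
    moreover have "offdiag {..<m} (\<lambda>i j. g (m + i) j) = offdiag {..<m} (\<lambda>i j. g (m + j) i)"
      by (subst offdiag_swap[symmetric]) simp
    ultimately show ?thesis
      using le[of "\<lambda>i j. g i (m + j)"] le[of "\<lambda>i j. g (m + j) i"] g(1) by simp
  qed
  also have "\<dots> \<le> 4 * offdiag {..<m + n} g"
    using assms g(1) by (intro mult_left_mono offdiag_subset) auto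
  finally show ?thesis by (simp add: g_def[abs_def])
qed

text \<open>Composing with \<open>swap_pairs\<close> leaves the sum over permutations unchanged, so
  one may also average over all swaps; for fixed \<open>p\<close> this inner average is a Rademacher
  chaos. The threshold 1/256 is 1/64 from \<open>rademacher_chaos_mgf\<close> divided by the 4 of
  \<open>offdiag_h_ts_square_le\<close>.\<close>

lemma U_stat_permutation_mgf:
  fixes x :: "nat \<Rightarrow> real ^ 'd"
  assumes "2 \<le> m" "m \<le> n"
    and G: "offdiag {..<m + n} (\<lambda>i j. same_cube \<kappa> (x i) (x j)) \<le> G" and l: "l\<^sup>2 * G \<le> 1 / 256"
  shows "(\<Sum>p | p permutes {..<m + n}. exp (l * (real m * (real m - 1)) * U_stat m n \<kappa> (x \<circ> p)))
    \<le> 2 * fact (m + n)"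
proof -
  let ?N = "{..<m + n}"
  define b where "b = real m * (real m - 1)"
  have b: "b > 0" using assms by (simp add: b_def)
  define f where "f y = exp (l * b * paired_stat m \<kappa> y)" for y :: "nat \<Rightarrow> real ^ 'd"
  have fin: "finite {p. p permutes ?N}" by (intro finite_permutations) simp
  have swapped: "(\<Sum>p | p permutes ?N. f (x \<circ> p)) = (\<Sum>p | p permutes ?N. f (x \<circ> p \<circ> swap_pairs m T))"
    if "T \<in> Pow {..<m}" for T
    using that sum_permutations_compose_right[OF swap_pairs_permutes[of T m n], of "\<lambda>p. f (x \<circ> p)"]
      assms by (simp add: o_assoc)
  have inner: "(\<Sum>T\<in>Pow {..<m}. f (x \<circ> p \<circ> swap_pairs m T)) \<le> 2 ^ m * 2" if p: "p permutes ?N" for p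
  proof -
    define A where "A i j = l * h_ts \<kappa> ((x \<circ> p) i) ((x \<circ> p) j) ((x \<circ> p) (m + i)) ((x \<circ> p) (m + j))"
      for i j
    have "offdiag {..<m} (\<lambda>i j. (A i j)\<^sup>2) \<le> l\<^sup>2 * (4 * offdiag ?N (\<lambda>i j. same_cube \<kappa> ((x \<circ> p) i) ((x \<circ> p) j)))"
      unfolding A_def power_mult_distrib offdiag_cmult
      by (intro mult_left_mono offdiag_h_ts_square_le assms) simp
    also have "offdiag ?N (\<lambda>i j. same_cube \<kappa> ((x \<circ> p) i) ((x \<circ> p) j))
        = offdiag ?N (\<lambda>i j. same_cube \<kappa> (x i) (x j))"
      using offdiag_image[OF permutes_inj_on[OF p, of ?N], of "\<lambda>i j. same_cube \<kappa> (x i) (x j)"]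
      by (simp add: permutes_image[OF p])
    also have "l\<^sup>2 * (4 * \<dots>) \<le> 4 * (l\<^sup>2 * G)"
      using mult_left_mono[OF G, of "4 * l\<^sup>2"] by (simp add: mult_ac)
    also have "\<dots> \<le> 1 / 64" using l by simp
    finally have small: "offdiag {..<m} (\<lambda>i j. (A i j)\<^sup>2) \<le> 1 / 64" .
    have sym: "A i j = A j i" for i j
      unfolding A_def h_ts_def
      by (simp add: same_cube_sym[of _ "x (p i)" "x (p j)"]
          same_cube_sym[of _ "x (p (m + i))" "x (p (m + j))"])
    have "(\<Sum>T\<in>Pow {..<m}. f (x \<circ> p \<circ> swap_pairs m T))
        = (\<Sum>T\<in>Pow {..<m}. exp (offdiag {..<m} (\<lambda>i j. flip_sign T i * flip_sign T j * A i j)))"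
    proof (rule sum.cong[OF refl])
      fix T assume "T \<in> Pow {..<m}"
      then have "f (x \<circ> p \<circ> swap_pairs m T) = exp (offdiag {..<m} (\<lambda>i j. l * b * (flip_sign T i * flip_sign T j *
        (h_ts \<kappa> ((x \<circ> p) i) ((x \<circ> p) j) ((x \<circ> p) (m + i)) ((x \<circ> p) (m + j)) / (real m * (real m - 1))))))"
        unfolding f_def offdiag_cmult by (subst paired_stat_swap_pairs) simp_all
      also have "(\<lambda>i j. l * b * (flip_sign T i * flip_sign T j *
        (h_ts \<kappa> ((x \<circ> p) i) ((x \<circ> p) j) ((x \<circ> p) (m + i)) ((x \<circ> p) (m + j)) / (real m * (real m - 1)))))
        = (\<lambda>i j. flip_sign T i * flip_sign T j * A i j)"
        using b unfolding A_def b_def[symmetric] by (auto simp: fun_eq_iff)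
      finally show "f (x \<circ> p \<circ> swap_pairs m T)
        = exp (offdiag {..<m} (\<lambda>i j. flip_sign T i * flip_sign T j * A i j))" .
    qed
    also have "\<dots> \<le> 2 ^ m * exp (2 * offdiag {..<m} (\<lambda>i j. (A i j)\<^sup>2))"
      using rademacher_chaos_mgf[of "{..<m}" A, OF _ sym small] by simp
    also have "\<dots> \<le> 2 ^ m * 2"
    proof (intro mult_left_mono)
      have "exp (2 * offdiag {..<m} (\<lambda>i j. (A i j)\<^sup>2)) \<le> exp (1 / 2)"
        using small by simp
      also have "\<dots> \<le> 2" using exp_bound_half[of "1/2 :: real"] by simp
      finally show "exp (2 * offdiag {..<m} (\<lambda>i j. (A i j)\<^sup>2)) \<le> 2" .
    qed simp
    finally show ?thesis .
  qed
  have "2 ^ m * (\<Sum>p | p permutes ?N. f (x \<circ> p)) = (\<Sum>T\<in>Pow {..<m}. \<Sum>p | p permutes ?N. f (x \<circ> p))"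
    by (simp add: card_Pow)
  also have "\<dots> = (\<Sum>T\<in>Pow {..<m}. \<Sum>p | p permutes ?N. f (x \<circ> p \<circ> swap_pairs m T))"
    by (rule sum.cong[OF refl swapped])
  also have "\<dots> = (\<Sum>p | p permutes ?N. \<Sum>T\<in>Pow {..<m}. f (x \<circ> p \<circ> swap_pairs m T))"
    by (rule sum.swap)
  also have "\<dots> \<le> (\<Sum>p | p permutes ?N. 2 ^ m * 2)"
    using inner by (intro sum_mono) auto
  also have "\<dots> = 2 ^ m * (2 * fact (m + n))"
    by (simp add: card_permutations[of ?N "m + n"])
  finally have "(\<Sum>p | p permutes ?N. f (x \<circ> p)) \<le> 2 * fact (m + n)"
    by simp
  with exp_U_stat_permutation_le_paired[OF assms(1,2), of "l * b" \<kappa> x] show ?thesis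
    by (simp add: f_def b_def)
qed

section \<open>The critical value\<close>

text \<open>The empirical distribution function is a step function jumping at the values
  \<open>v p\<close>, so an infimum below \<open>u\<close> is witnessed by the largest value below
  \<open>u\<close>. This turns the critical value into a count, from which measurability, level and
  power are read off.\<close>

lemma quantile_less_iff:
  fixes v :: "'a \<Rightarrow> real"
  assumes P: "finite P" "P \<noteq> {}" and c: "c = real (card P)" and a: "0 < a" "a < 1"
  shows "Inf {t. 1 - a \<le> (\<Sum>p\<in>P. of_bool (v p \<le> t)) / c} < u
    \<longleftrightarrow> (1 - a) * c \<le> (\<Sum>p\<in>P. of_bool (v p < u))"
proof -
  define S where "S = {t. 1 - a \<le> (\<Sum>p\<in>P. of_bool (v p \<le> t)) / c}"
  have cpos: "c > 0" using P c by (simp add: card_gt_0_iff)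
  have S: "t \<in> S \<longleftrightarrow> (1 - a) * c \<le> (\<Sum>p\<in>P. of_bool (v p \<le> t))" for t
    using cpos by (simp add: S_def pos_le_divide_eq)
  have "(\<Sum>p\<in>P. of_bool (v p \<le> Max (v ` P))) = (\<Sum>p\<in>P. 1 :: real)"
    using P by (intro sum.cong) auto
  then have "Max (v ` P) \<in> S" using a cpos by (simp add: S c)
  then have ne: "S \<noteq> {}" by auto
  have bd: "bdd_below S"
  proof (rule bdd_belowI)
    fix t assume "t \<in> S"
    then have "(\<Sum>p\<in>P. of_bool (v p \<le> t)) > (0 :: real)"
      unfolding S using a cpos by (smt (verit) mult_pos_pos)
    then obtain p where "p \<in> P" "v p \<le> t"
      by (metis (mono_tags, lifting) less_irrefl of_bool_eq(1) sum.neutral)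
    then show "Min (v ` P) \<le> t"
      using P by (meson Min_le finite_imageI image_eqI order_trans)
  qed
  show ?thesis
    unfolding S_def[symmetric]
  proof
    assume "Inf S < u"
    then obtain t where t: "t \<in> S" "t < u" using cInf_lessD[OF ne] by blast
    have "(1 - a) * c \<le> (\<Sum>p\<in>P. of_bool (v p \<le> t))" using t S by blast
    also have "\<dots> \<le> (\<Sum>p\<in>P. of_bool (v p < u))"
      using t by (intro sum_mono) auto
    finally show "(1 - a) * c \<le> (\<Sum>p\<in>P. of_bool (v p < u))" .
  next
    assume le: "(1 - a) * c \<le> (\<Sum>p\<in>P. of_bool (v p < u))"
    define Q where "Q = {p \<in> P. v p < u}"
    have "(\<Sum>p\<in>P. of_bool (v p < u)) > (0 :: real)"
      using le a cpos by (smt (verit) mult_pos_pos)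
    moreover have "(\<Sum>p\<in>P. of_bool (v p < u)) = (0 :: real)" if "Q = {}"
      using that by (intro sum.neutral) (auto simp: Q_def)
    ultimately have "Q \<noteq> {}" by (metis less_irrefl)
    then have Q: "finite (v ` Q)" "v ` Q \<noteq> {}" using P by (auto simp: Q_def)
    have "(\<Sum>p\<in>P. of_bool (v p < u)) \<le> (\<Sum>p\<in>P. of_bool (v p \<le> Max (v ` Q)) :: real)"
      using Q by (intro sum_mono) (auto simp: Q_def)
    with le have "Max (v ` Q) \<in> S" unfolding S by linarith
    then have "Inf S \<le> Max (v ` Q)" using bd by (rule cInf_lower)
    also have "\<dots> < u" using Max_in[OF Q] by (auto simp: Q_def)
    finally show "Inf S < u" .
  qed
qed

lemma perm_test_eq_1_iff:
  fixes x :: "nat \<Rightarrow> real ^ 'd"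
  assumes "0 < a" "a < 1"
  shows "perm_test m n \<kappa> a x = 1 \<longleftrightarrow> (1 - a) * fact (m + n)
    \<le> (\<Sum>p | p permutes {..<m + n}. of_bool (U_stat m n \<kappa> (x \<circ> p) < U_stat m n \<kappa> x))"
proof -
  have "finite {p. p permutes {..<m + n}}" "{p. p permutes {..<m + n}} \<noteq> {}"
    by (auto intro: finite_permutations exI[of _ id])
  from quantile_less_iff[OF this _ assms, of "fact (m + n)" "\<lambda>p. U_stat m n \<kappa> (x \<circ> p)" "U_stat m n \<kappa> x"]
  show ?thesis
    by (simp add: perm_test_def perm_quantile_def card_permutations[of "{..<m + n}" "m + n"])
qed

text \<open>Take a member of the set with the smallest value. Everything strictly below it lies
  outside the set, and by membership there are at least \<open>(1 - a) * card P\<close> such points.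
  Counting strictly smaller values makes ties harmless.\<close>

lemma card_top_fraction_le:
  fixes v :: "'a \<Rightarrow> real" and a :: real
  assumes P: "finite P" and a: "0 < a"
  shows "real (card {s \<in> P. (1 - a) * card P \<le> (\<Sum>p\<in>P. of_bool (v p < v s))}) \<le> a * card P"
proof -
  define S where "S = {s \<in> P. (1 - a) * card P \<le> (\<Sum>p\<in>P. of_bool (v p < v s))}"
  have fin: "finite S" using P by (simp add: S_def)
  show ?thesis
  proof (cases "S = {}")
    case True
    then show ?thesis using a unfolding S_def[symmetric] by simp
  next
    case False
    then have "Min (v ` S) \<in> v ` S" using fin by (intro Min_in) auto
    then obtain s where s: "s \<in> S" "v s = Min (v ` S)" by (metis imageE)
    then have "v s \<le> v t" if "t \<in> S" for t using that fin by simp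
    then have sub: "{p \<in> P. v p < v s} \<subseteq> P - S" by fastforce
    have "(1 - a) * card P \<le> real (card {p \<in> P. v p < v s})"
      using s(1) P by (simp add: S_def sum_of_bool_eq Int_def)
    also have "\<dots> \<le> real (card (P - S))"
      using card_mono[OF _ sub] P by simp
    also have "\<dots> = real (card P) - real (card S)"
      using P by (subst card_Diff_subset[OF fin]) (auto simp: S_def of_nat_diff card_mono)
    finally show ?thesis unfolding S_def[symmetric] by (simp add: algebra_simps)
  qed
qed

text \<open>Exponential Markov inequality for the permutation distribution: acceptance means that
  more than a fraction \<open>a\<close> of the permuted statistics are at least \<open>U\<close>,
  whereas their mean exponential moment is at most 2, whence
  \<open>a * exp (l * b * U) < 2\<close>.\<close>

lemma perm_test_0_imp_U_stat_le:
  fixes x :: "nat \<Rightarrow> real ^ 'd"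
  assumes mn: "2 \<le> m" "m \<le> n" and a: "0 < a" "a < 1"
    and "perm_test m n \<kappa> a x = 0"
  shows "U_stat m n \<kappa> x * (real m * (real m - 1))
    \<le> 16 * sqrt (offdiag {..<m + n} (\<lambda>i j. same_cube \<kappa> (x i) (x j))) * ln (2 / a)"
proof (rule ccontr)
  let ?P = "{p. p permutes {..<m + n}}"
  define G where "G = offdiag {..<m + n} (\<lambda>i j. same_cube \<kappa> (x i) (x j))"
  define U where "U = U_stat m n \<kappa> x"
  define b where "b = real m * (real m - 1)"
  have b: "b > 0" using mn by (simp add: b_def)
  have G0: "G \<ge> 0" by (simp add: G_def offdiag_nonneg same_cube_bounds)
  have la: "ln (2 / a) > 0" using a by simp
  assume "\<not> ?thesis"
  then have gt: "16 * sqrt G * ln (2 / a) < b * U" by (simp add: G_def U_def b_def mult_ac)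
  have U: "b * U > 0" using gt G0 la by (smt (verit) mult_nonneg_nonneg real_sqrt_ge_zero)
  \<comment> \<open>For positive \<open>G\<close> this is the largest exponent with
    \<open>l\<^sup>2 * G \<le> 1 / 256\<close>, and the source of the factor 16. For
    \<open>G = 0\<close> every exponent is admissible, and the chosen one makes
    \<open>l * b * U\<close> equal to \<open>ln (2 / a)\<close>.\<close>
  define l where "l = (if G = 0 then ln (2 / a) / (b * U) else 1 / (16 * sqrt G))"
  have l: "l\<^sup>2 * G \<le> 1 / 256"
    using G0 by (simp add: l_def power_mult_distrib power_divide)
  have l0: "l > 0" using G0 U la by (simp add: l_def)
  have lU: "ln (2 / a) \<le> l * b * U"
    using gt U G0 b by (auto simp: l_def field_simps)
  have fin: "finite ?P" by (intro finite_permutations) simp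
  have card: "real (card ?P) = fact (m + n)" by (simp add: card_permutations[of "{..<m + n}" "m + n"])
  have "(\<Sum>p\<in>?P. of_bool (U_stat m n \<kappa> (x \<circ> p) < U)) < (1 - a) * fact (m + n)"
    using assms(5) perm_test_eq_1_iff[OF a, of m n \<kappa> x] unfolding U_def by simp
  moreover have "(\<Sum>p\<in>?P. of_bool (U_stat m n \<kappa> (x \<circ> p) < U)) + (\<Sum>p\<in>?P. of_bool (U \<le> U_stat m n \<kappa> (x \<circ> p)))
      = (\<Sum>p\<in>?P. 1 :: real)"
    unfolding sum.distrib[symmetric] by (intro sum.cong) auto
  ultimately have "a * fact (m + n) < (\<Sum>p\<in>?P. of_bool (U \<le> U_stat m n \<kappa> (x \<circ> p)))"
    using card by (simp add: algebra_simps)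
  then have "a * fact (m + n) * exp (l * b * U)
      < (\<Sum>p\<in>?P. of_bool (U \<le> U_stat m n \<kappa> (x \<circ> p))) * exp (l * b * U)"
    by simp
  also have "\<dots> \<le> (\<Sum>p\<in>?P. exp (l * b * U_stat m n \<kappa> (x \<circ> p)))"
    unfolding sum_distrib_right using l0 b by (intro sum_mono) auto
  also have "\<dots> \<le> 2 * fact (m + n)"
    unfolding b_def by (rule U_stat_permutation_mgf[OF mn _ l]) (simp add: G_def)
  finally have "a * exp (l * b * U) < 2" by simp
  moreover have "2 / a \<le> exp (l * b * U)"
    using lU a by (metis divide_pos_pos exp_le_cancel_iff exp_ln zero_less_numeral)
  ultimately show False using a by (simp add: field_simps)
qed

section \<open>Product measures\<close>

text \<open>Overwriting one coordinate by an independent copy preserves a product law. This plays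
  the part of conditioning on the remaining coordinates in all moment computations below.\<close>

lemma integral_PiM_resample:
  fixes f :: "('i \<Rightarrow> 'a) \<Rightarrow> real"
  assumes M: "\<And>i. i \<in> I \<Longrightarrow> prob_space (M i)" and i: "i \<in> I"
    and f: "integrable (PiM I M) f"
  shows "(\<integral>x. f x \<partial>PiM I M) = (\<integral>x. (\<integral>t. f (x(i := t)) \<partial>M i) \<partial>PiM I M)"
proof -
  interpret Mi: prob_space "M i" using M i by blast
  interpret PI: prob_space "PiM I M" by (rule prob_space_PiM) (rule M)
  interpret pair_prob_space "M i" "PiM I M" ..
  have ins: "insert i I = I" using i by auto
  have D: "distr (M i \<Otimes>\<^sub>M PiM I M) (PiM I M) (\<lambda>(t, x). x(i := t)) = PiM I M"
    using distr_pair_PiM_eq_PiM[of I M i] M i unfolding ins by blast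
  have meas: "(\<lambda>(t, x). x(i := t)) \<in> measurable (M i \<Otimes>\<^sub>M PiM I M) (PiM I M)"
  proof -
    have "(\<lambda>p. (snd p)(i := fst p)) \<in> measurable (M i \<Otimes>\<^sub>M PiM I M) (PiM I M)"
      by (rule measurable_fun_upd[of I I i]) (use i in auto)
    then show ?thesis by (simp add: case_prod_beta')
  qed
  have int: "integrable (M i \<Otimes>\<^sub>M PiM I M) (\<lambda>p. f ((\<lambda>(t, x). x(i := t)) p))"
    by (subst integrable_distr_eq[OF meas, symmetric]) (use f D in \<open>auto simp: borel_measurable_integrable\<close>)
  have "(\<integral>x. f x \<partial>PiM I M) = (\<integral>p. f ((\<lambda>(t, x). x(i := t)) p) \<partial>(M i \<Otimes>\<^sub>M PiM I M))"
    by (subst D[symmetric], subst integral_distr[OF meas]) (use f in auto)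
  also have "\<dots> = (\<integral>x. (\<integral>t. f (x(i := t)) \<partial>M i) \<partial>PiM I M)"
    using integral_snd[of "\<lambda>t x. f (x(i := t))"] int by (simp add: case_prod_beta')
  finally show ?thesis .
qed

lemma distr_PiM_permute:
  assumes M: "prob_space M" and p: "p permutes I"
  shows "distr (PiM I (\<lambda>_. M)) (PiM I (\<lambda>_. M)) (\<lambda>x. x \<circ> p) = PiM I (\<lambda>_. M)"
proof -
  have "distr (PiM I (\<lambda>_. M)) (PiM I (\<lambda>_. M)) (\<lambda>x. \<lambda>i\<in>I. x (p i)) = PiM I (\<lambda>_. M)"
    using distr_PiM_reindex[of I "\<lambda>_. M" p I] M p
    by (auto simp: permutes_inj_on permutes_in_image)
  \<comment> \<open>Outside \<open>I\<close> the permutation is the identity and points of the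
    product space take the value \<open>undefined\<close>, so composition and restricted reindexing
    agree.\<close>
  moreover have "(\<lambda>i\<in>I. x (p i)) = x \<circ> p" if "x \<in> space (PiM I (\<lambda>_. M))" for x
    using that p by (auto simp: fun_eq_iff space_PiM PiE_iff extensional_def permutes_not_in)
  then have "distr (PiM I (\<lambda>_. M)) (PiM I (\<lambda>_. M)) (\<lambda>x. \<lambda>i\<in>I. x (p i))
      = distr (PiM I (\<lambda>_. M)) (PiM I (\<lambda>_. M)) (\<lambda>x. x \<circ> p)"
    by (intro distr_cong) auto
  ultimately show ?thesis by simp
qed

section \<open>Second moments of canonical quadratic forms and of centred sums\<close>

lemma offdiag_square: "(offdiag I F)\<^sup>2 = offdiag I (\<lambda>i j. offdiag I (\<lambda>k l. F i j * F k l))"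
proof -
  have "(offdiag I F)\<^sup>2 = offdiag I (\<lambda>i j. offdiag I F * F i j)"
    by (simp only: offdiag_cmult power2_eq_square)
  also have "\<dots> = offdiag I (\<lambda>i j. offdiag I (\<lambda>k l. F i j * F k l))"
    by (simp only: offdiag_cmult mult.commute[of "offdiag I F"])
  finally show ?thesis .
qed

text \<open>Canonical kernels, that is, those with vanishing conditional means, are pairwise orthogonal
  unless they share the same pair of indices.\<close>

lemma canonical_second_moment:
  fixes B :: "'i \<Rightarrow> 'i \<Rightarrow> 'a \<Rightarrow> 'a \<Rightarrow> real"
  assumes I: "finite I" and M: "\<And>i. i \<in> I \<Longrightarrow> prob_space (M i)"
    and meas: "\<And>i j. i \<in> I \<Longrightarrow> j \<in> I \<Longrightarrow> (\<lambda>x. B i j (x i) (x j)) \<in> borel_measurable (PiM I M)"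
    and bdd: "\<And>i j x y. \<bar>B i j x y\<bar> \<le> K"
    and canonical: "\<And>i j x. i \<in> I \<Longrightarrow> j \<in> I \<Longrightarrow> i \<noteq> j \<Longrightarrow> x \<in> space (M i) \<Longrightarrow> (\<integral>y. B i j x y \<partial>M j) = 0"
      "\<And>i j y. i \<in> I \<Longrightarrow> j \<in> I \<Longrightarrow> i \<noteq> j \<Longrightarrow> y \<in> space (M j) \<Longrightarrow> (\<integral>x. B i j x y \<partial>M i) = 0"
  shows "(\<integral>x. (offdiag I (\<lambda>i j. B i j (x i) (x j)))\<^sup>2 \<partial>PiM I M)
    \<le> 2 * offdiag I (\<lambda>i j. \<integral>x. (B i j (x i) (x j))\<^sup>2 \<partial>PiM I M)"
proof -
  interpret PI: prob_space "PiM I M" by (rule prob_space_PiM) (rule M)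
  define b where "b i j x = B i j (x i) (x j)" for i j and x :: "'i \<Rightarrow> 'a"
  have bm: "b i j \<in> borel_measurable (PiM I M)" if "i \<in> I" "j \<in> I" for i j
    using meas[OF that] by (simp add: b_def[abs_def])
  have K0: "K \<ge> 0" using bdd[of undefined undefined undefined undefined] by linarith
  have int: "integrable (PiM I M) (\<lambda>x. b i j x * b k l x)"
    if "i \<in> I" "j \<in> I" "k \<in> I" "l \<in> I" for i j k l
  proof (rule PI.integrable_const_bound[where B = "K * K"])
    show "AE x in PiM I M. norm (b i j x * b k l x) \<le> K * K"
      unfolding b_def using K0 by (auto simp: abs_mult intro!: mult_mono bdd)
  qed (intro borel_measurable_times bm that)
  \<comment> \<open>An index that occurs in only one of the two pairs enters the product through a
    single factor; integrating that coordinate out first gives zero.\<close>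
  have ortho1: "(\<integral>x. b i j x * b k l x \<partial>PiM I M) = 0"
    if "i \<in> I" "j \<in> I" "k \<in> I" "l \<in> I" "i \<noteq> j" "k \<noteq> l" "i \<notin> {k, l} \<or> j \<notin> {k, l}" for i j k l
    using that(7)
  proof
    assume *: "i \<notin> {k, l}"
    have "(\<integral>x. b i j x * b k l x \<partial>PiM I M)
        = (\<integral>x. (\<integral>t. b i j (x(i := t)) * b k l (x(i := t)) \<partial>M i) \<partial>PiM I M)"
      by (rule integral_PiM_resample[OF M \<open>i \<in> I\<close> int]) (use that in auto)
    also have "\<dots> = (\<integral>x. (\<integral>t. B i j t (x j) \<partial>M i) * b k l x \<partial>PiM I M)"
      using that * by (intro Bochner_Integration.integral_cong refl) (auto simp: b_def)
    also have "\<dots> = (\<integral>x. 0 \<partial>PiM I M)"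
      using that by (intro Bochner_Integration.integral_cong refl)
        (auto simp: canonical space_PiM PiE_iff)
    finally show ?thesis by simp
  next
    assume *: "j \<notin> {k, l}"
    have "(\<integral>x. b i j x * b k l x \<partial>PiM I M)
        = (\<integral>x. (\<integral>t. b i j (x(j := t)) * b k l (x(j := t)) \<partial>M j) \<partial>PiM I M)"
      by (rule integral_PiM_resample[OF M \<open>j \<in> I\<close> int]) (use that in auto)
    also have "\<dots> = (\<integral>x. (\<integral>t. B i j (x i) t \<partial>M j) * b k l x \<partial>PiM I M)"
      using that * by (intro Bochner_Integration.integral_cong refl) (auto simp: b_def)
    also have "\<dots> = (\<integral>x. 0 \<partial>PiM I M)"
      using that by (intro Bochner_Integration.integral_cong refl)
        (auto simp: canonical space_PiM PiE_iff)
    finally show ?thesis by simp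
  qed
  define v where "v i j = (\<integral>x. b i j x * b i j x \<partial>PiM I M)" for i j
  \<comment> \<open>Only the pair itself and its reversal survive. Symmetry of the kernel is not
    assumed, so the reversed term is bounded by the mean of the two second moments; after summation
    the two terms give the factor 2.\<close>
  have bound: "(\<integral>x. b i j x * b k l x \<partial>PiM I M)
      \<le> of_bool (k = i) * (of_bool (l = j) * v i j)
        + of_bool (k = j) * (of_bool (l = i) * ((v i j + v j i) / 2))"
    if ij: "i \<in> I" "j \<in> I" "k \<in> I" "l \<in> I" "i \<noteq> j" "k \<noteq> l" for i j k l
  proof -
    consider "k = i" "l = j" | "k = j" "l = i" | "i \<notin> {k, l} \<or> j \<notin> {k, l}" using ij by blast
    then show ?thesis
    proof cases
      case 1
      then show ?thesis using ij by (simp add: v_def)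
    next
      case 2
      have "(\<integral>x. b i j x * b j i x \<partial>PiM I M)
          \<le> (\<integral>x. (b i j x * b i j x + b j i x * b j i x) / 2 \<partial>PiM I M)"
      proof (rule integral_mono)
        show "b i j x * b j i x \<le> (b i j x * b i j x + b j i x * b j i x) / 2" for x
          using sum_squares_bound[of "b i j x" "b j i x"] by (simp add: power2_eq_square)
      qed (use ij in \<open>auto intro!: int\<close>)
      also have "\<dots> = (v i j + v j i) / 2"
        using ij by (simp add: v_def int)
      finally show ?thesis using 2 ij by simp
    next
      case 3
      then show ?thesis using ortho1[OF ij 3] ij by auto
    qed
  qed
  have "(\<integral>x. (offdiag I (\<lambda>i j. b i j x))\<^sup>2 \<partial>PiM I M)
      = (\<integral>x. offdiag I (\<lambda>i j. offdiag I (\<lambda>k l. b i j x * b k l x)) \<partial>PiM I M)"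
    by (simp only: offdiag_square)
  also have "\<dots> = offdiag I (\<lambda>i j. offdiag I (\<lambda>k l. \<integral>x. b i j x * b k l x \<partial>PiM I M))"
    unfolding offdiag_def
    by (simp add: int Bochner_Integration.integral_sum)
  also have "\<dots> \<le> offdiag I (\<lambda>i j. offdiag I (\<lambda>k l. of_bool (k = i) * (of_bool (l = j) * v i j)
        + of_bool (k = j) * (of_bool (l = i) * ((v i j + v j i) / 2))))"
    by (intro offdiag_mono bound)
  also have "\<dots> = offdiag I (\<lambda>i j. v i j + (v i j + v j i) / 2)"
  proof (rule offdiag_cong[OF refl])
    fix i j assume ij: "i \<in> I" "j \<in> I" "i \<noteq> j"
    have pick: "offdiag I (\<lambda>k l. of_bool (k = r) * (of_bool (l = s) * z)) = z"
      if "r \<in> I" "s \<in> I" "r \<noteq> s" for r s and z :: real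
    proof -
      have "offdiag I (\<lambda>k l. of_bool (k = r) * (of_bool (l = s) * z))
          = (\<Sum>k\<in>I. if k = r then (\<Sum>l\<in>I. if l = s then z else 0) else 0)"
        unfolding offdiag_def using that(3) by (intro sum.cong refl) (auto intro!: sum.cong sum.neutral)
      then show ?thesis using I that by simp
    qed
    show "offdiag I (\<lambda>k l. of_bool (k = i) * (of_bool (l = j) * v i j)
        + of_bool (k = j) * (of_bool (l = i) * ((v i j + v j i) / 2))) = v i j + (v i j + v j i) / 2"
      by (simp only: offdiag_add pick[OF ij] pick[OF ij(2,1) ij(3)[symmetric]])
  qed
  also have "\<dots> = 2 * offdiag I v"
  proof -
    have "offdiag I (\<lambda>i j. v i j + (v i j + v j i) / 2)
        = offdiag I (\<lambda>i j. (3 / 2) * v i j + (1 / 2) * v j i)"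
      by (intro offdiag_cong refl) (simp add: field_simps)
    also have "\<dots> = (3 / 2) * offdiag I v + (1 / 2) * offdiag I v"
      by (simp only: offdiag_add offdiag_cmult offdiag_swap[of I v])
    finally show ?thesis by simp
  qed
  finally show ?thesis
    by (simp add: b_def v_def[abs_def] power2_eq_square)
qed

lemma centered_second_moment:
  fixes c :: "'i \<Rightarrow> 'a \<Rightarrow> real"
  assumes I: "finite I" and M: "\<And>i. i \<in> I \<Longrightarrow> prob_space (M i)"
    and meas: "\<And>i. i \<in> I \<Longrightarrow> c i \<in> borel_measurable (M i)"
    and bdd: "\<And>i x. \<bar>c i x\<bar> \<le> K"
    and centered: "\<And>i. i \<in> I \<Longrightarrow> (\<integral>x. c i x \<partial>M i) = 0"
  shows "(\<integral>x. (\<Sum>i\<in>I. c i (x i))\<^sup>2 \<partial>PiM I M) = (\<Sum>i\<in>I. \<integral>x. (c i x)\<^sup>2 \<partial>M i)"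
proof -
  interpret PI: prob_space "PiM I M" by (rule prob_space_PiM) (rule M)
  have K0: "K \<ge> 0" using bdd[of undefined undefined] by linarith
  have cm: "(\<lambda>x. c i (x i)) \<in> borel_measurable (PiM I M)" if "i \<in> I" for i
    by (rule measurable_compose[where f = "\<lambda>x. x i" and g = "c i"])
      (use that in \<open>auto intro: meas\<close>)
  have int: "integrable (PiM I M) (\<lambda>x. c i (x i) * c j (x j))" if "i \<in> I" "j \<in> I" for i j
  proof (rule PI.integrable_const_bound[where B = "K * K"])
    show "AE x in PiM I M. norm (c i (x i) * c j (x j)) \<le> K * K"
      using K0 by (auto simp: abs_mult intro!: mult_mono bdd)
  qed (intro borel_measurable_times cm that)
  have cov: "(\<integral>x. c i (x i) * c j (x j) \<partial>PiM I M) = (if j = i then \<integral>x. (c i x)\<^sup>2 \<partial>M i else 0)"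
    if "i \<in> I" "j \<in> I" for i j
  proof -
    interpret Mi: prob_space "M i" using M that by blast
    have "(\<integral>x. c i (x i) * c j (x j) \<partial>PiM I M)
        = (\<integral>x. (\<integral>t. c i ((x(i := t)) i) * c j ((x(i := t)) j) \<partial>M i) \<partial>PiM I M)"
      by (rule integral_PiM_resample[OF M \<open>i \<in> I\<close> int[OF that]])
    also have "\<dots> = (if j = i then \<integral>x. (c i x)\<^sup>2 \<partial>M i else 0)"
      using centered[OF that(1)] PI.prob_space by (auto simp: power2_eq_square)
    finally show ?thesis .
  qed
  have "(\<integral>x. (\<Sum>i\<in>I. c i (x i))\<^sup>2 \<partial>PiM I M) = (\<Sum>i\<in>I. \<Sum>j\<in>I. \<integral>x. c i (x i) * c j (x j) \<partial>PiM I M)"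
    unfolding power2_eq_square sum_product by (simp add: int Bochner_Integration.integral_sum)
  also have "\<dots> = (\<Sum>i\<in>I. \<integral>x. (c i x)\<^sup>2 \<partial>M i)"
    using I by (simp add: cov)
  finally show ?thesis .
qed

section \<open>Size of the tests\<close>

lemma cube_index_measurable [measurable]:
  "cube_index \<kappa> \<in> measurable borel (count_space (UNIV :: (int ^ 'd) set))"
proof -
  have "cube_index \<kappa> -` {a} \<inter> space borel \<in> sets borel" for a :: "int ^ 'd"
  proof -
    have "cube_index \<kappa> -` {a} \<inter> space borel
        = {x \<in> space borel. \<forall>i. min \<lfloor>real \<kappa> * x $ i\<rfloor> (int \<kappa> - 1) = a $ i}"
      by (auto simp: cube_index_def vec_eq_iff)
    also have "\<dots> \<in> sets borel" by measurable
    finally show ?thesis .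
  qed
  then show ?thesis
    by (subst measurable_count_space_eq2_countable) auto
qed

lemma same_cube_measurable [measurable (raw)]:
  assumes [measurable]: "f \<in> measurable N borel" "h \<in> measurable N borel"
  shows "(\<lambda>x. same_cube \<kappa> (f x) (h x)) \<in> borel_measurable N"
proof -
  have 1: "(\<lambda>x. cube_index \<kappa> (f x)) \<in> measurable N (count_space UNIV)"
    "(\<lambda>x. cube_index \<kappa> (h x)) \<in> measurable N (count_space UNIV)"
    by measurable
  have "(\<lambda>x. (cube_index \<kappa> (f x), cube_index \<kappa> (h x))) \<in> measurable N (count_space UNIV)"
    using measurable_Pair[OF 1] by (simp add: pair_measure_countable)
  from measurable_compose[OF this, of "\<lambda>(a, b). of_bool (a = b) :: real" borel] show ?thesis
    by (simp add: same_cube_def)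
qed

lemma U_stat_measurable:
  assumes "\<And>i. i < m + n \<Longrightarrow> sets (M i) = sets borel" "p permutes {..<m + n}"
  shows "(\<lambda>x. U_stat m n \<kappa> (x \<circ> p)) \<in> borel_measurable (PiM {..<m + n} M)"
proof -
  have [measurable]: "(\<lambda>x. x (p i)) \<in> borel_measurable (PiM {..<m + n} M)" if "i < m + n" for i
  proof -
    have "p i < m + n" using assms(2) that permutes_in_image[of p "{..<m + n}" i] by simp
    then show ?thesis
      using measurable_component_singleton[of "p i" "{..<m + n}" M] assms(1)[of "p i"]
      by (simp cong: measurable_cong_sets)
  qed
  show ?thesis
    unfolding U_stat_def h_ts_def o_def
    by (intro borel_measurable_divide borel_measurable_sum borel_measurable_add borel_measurable_diff
        same_cube_measurable) auto
qed

lemma perm_test_0_or_1: "perm_test m n \<kappa> a x = 0 \<or> perm_test m n \<kappa> a x = 1"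
  by (simp add: perm_test_def)

lemma perm_test_sets:
  assumes "\<And>i. i < m + n \<Longrightarrow> sets (M i) = sets borel" "0 < a" "a < 1"
  shows "{x \<in> space (PiM {..<m + n} M). perm_test m n \<kappa> a x = 1} \<in> sets (PiM {..<m + n} M)"
    "{x \<in> space (PiM {..<m + n} M). perm_test m n \<kappa> a x = 0} \<in> sets (PiM {..<m + n} M)"
proof -
  have [measurable]: "(\<lambda>x. U_stat m n \<kappa> (x \<circ> p)) \<in> borel_measurable (PiM {..<m + n} M)"
    if "p \<in> {p. p permutes {..<m + n}}" for p
    using U_stat_measurable[where M = M and m = m and n = n and p = p] assms(1) that by blast
  have [measurable]: "U_stat m n \<kappa> \<in> borel_measurable (PiM {..<m + n} M)"
    using U_stat_measurable[where M = M and m = m and n = n and p = id] assms(1) permutes_id by simp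
  show 1: "{x \<in> space (PiM {..<m + n} M). perm_test m n \<kappa> a x = 1} \<in> sets (PiM {..<m + n} M)"
    unfolding perm_test_eq_1_iff[OF assms(2,3)] by measurable
  have "{x \<in> space (PiM {..<m + n} M). perm_test m n \<kappa> a x = 0}
      = space (PiM {..<m + n} M) - {x \<in> space (PiM {..<m + n} M). perm_test m n \<kappa> a x = 1}"
    using perm_test_0_or_1 by fastforce
  with 1 show "{x \<in> space (PiM {..<m + n} M). perm_test m n \<kappa> a x = 0} \<in> sets (PiM {..<m + n} M)"
    by simp
qed

text \<open>For i.i.d. data each permuted sample is rejected with the same probability. Summed over
  all permutations, the rejection indicators are at most \<open>a * fact (m + n)\<close> for every
  fixed sample by \<open>card_top_fraction_le\<close>, and integrating this bound gives the
  level.\<close>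

lemma perm_test_level:
  fixes P :: "(real ^ 'd) measure"
  assumes "prob_space P" "sets P = sets borel" and a: "0 < a" "a < 1"
  shows "measure (PiM {..<m + n} (\<lambda>_. P))
    {x \<in> space (PiM {..<m + n} (\<lambda>_. P)). perm_test m n \<kappa> a x = 1} \<le> a"
proof -
  let ?N = "{..<m + n}"
  let ?M = "PiM ?N (\<lambda>_. P)"
  let ?\<Pi> = "{p. p permutes ?N}"
  interpret P: prob_space P by fact
  interpret PM: prob_space ?M by (rule prob_space_PiM) (rule assms)
  define A where "A = {x \<in> space ?M. perm_test m n \<kappa> a x = 1}"
  have A: "A \<in> sets ?M"
    unfolding A_def by (rule perm_test_sets) (use assms in auto)
  have fin: "finite ?\<Pi>" by (intro finite_permutations) simp
  have card: "real (card ?\<Pi>) = fact (m + n)" by (simp add: card_permutations[of ?N "m + n"])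
  have shift: "integrable ?M (\<lambda>x. indicator A (x \<circ> p) :: real)
      \<and> (\<integral>x. indicator A (x \<circ> p) \<partial>?M) = measure ?M A" if "p \<in> ?\<Pi>" for p
  proof -
    have D: "distr ?M ?M (\<lambda>x. x \<circ> p) = ?M"
      using distr_PiM_permute[OF assms(1), of p ?N] that by simp
    have meas: "(\<lambda>x. x \<circ> p) \<in> measurable ?M ?M"
    proof (rule measurable_PiM_single')
      fix i assume "i \<in> ?N"
      then have "p i \<in> ?N" using that permutes_in_image[of p ?N i] by simp
      then show "(\<lambda>x. (x \<circ> p) i) \<in> measurable ?M P"
        using measurable_component_singleton[of "p i" ?N "\<lambda>_. P"] by simp
    next
      show "(\<lambda>x. x \<circ> p) \<in> space ?M \<rightarrow> (\<Pi>\<^sub>E i\<in>?N. space P)"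
      proof (intro funcsetI PiE_I)
        fix x i assume x: "x \<in> space ?M"
        show "(x \<circ> p) i \<in> space P" if "i \<in> ?N"
        proof -
          have "p i \<in> ?N" using \<open>p \<in> ?\<Pi>\<close> permutes_in_image[of p ?N i] that by simp
          then show ?thesis using x by (auto simp: space_PiM PiE_iff)
        qed
        show "(x \<circ> p) i = undefined" if "i \<notin> ?N"
        proof -
          have "p i = i" using \<open>p \<in> ?\<Pi>\<close> permutes_not_in[of p ?N i] that by simp
          then show ?thesis using x that by (auto simp: space_PiM PiE_iff extensional_def)
        qed
      qed
    qed
    have int: "integrable ?M (indicator A :: _ \<Rightarrow> real)"
      by (rule PM.integrable_const_bound[where B = 1]) (use A in \<open>auto simp: indicator_def\<close>)
    have "integrable (distr ?M ?M (\<lambda>x. x \<circ> p)) (indicator A :: _ \<Rightarrow> real)"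
      unfolding D by (rule int)
    then have "integrable ?M (\<lambda>x. indicator A (x \<circ> p) :: real)"
      by (subst (asm) integrable_distr_eq[OF meas]) (use A in auto)
    moreover have "(\<integral>x. indicator A (x \<circ> p) \<partial>?M) = measure ?M A"
      using integral_distr[OF meas, of "indicator A :: _ \<Rightarrow> real"] A unfolding D by simp
    ultimately show ?thesis by blast
  qed
  have pt: "(\<Sum>p\<in>?\<Pi>. indicator A (x \<circ> p)) \<le> a * fact (m + n)" if x: "x \<in> space ?M" for x
  proof -
    define v where "v p = U_stat m n \<kappa> (x \<circ> p)" for p
    have "(\<Sum>p\<in>?\<Pi>. indicator A (x \<circ> p))
        \<le> (\<Sum>p\<in>?\<Pi>. of_bool ((1 - a) * card ?\<Pi> \<le> (\<Sum>q\<in>?\<Pi>. of_bool (v q < v p))) :: real)"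
    proof (rule sum_mono)
      fix p assume p: "p \<in> ?\<Pi>"
      \<comment> \<open>A permuted sample has the same collection of permuted statistics as the
        original one, since left composition with \<open>p\<close> only reorders the
        permutations.\<close>
      have "(\<Sum>q\<in>?\<Pi>. of_bool (v q < v p))
          = (\<Sum>q\<in>?\<Pi>. of_bool (U_stat m n \<kappa> (x \<circ> p \<circ> q) < U_stat m n \<kappa> (x \<circ> p)) :: real)"
        using setum_permutations_compose_left[of p ?N "\<lambda>q. of_bool (v q < v p) :: real"] p
        by (simp add: v_def o_assoc del: sum_of_bool_eq)
      then show "indicator A (x \<circ> p)
          \<le> (of_bool ((1 - a) * card ?\<Pi> \<le> (\<Sum>q\<in>?\<Pi>. of_bool (v q < v p))) :: real)"
        unfolding card by (auto simp: A_def perm_test_eq_1_iff[OF a] indicator_def simp del: One_nat_def)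
    qed
    also have "\<dots> = card {p \<in> ?\<Pi>. (1 - a) * card ?\<Pi> \<le> (\<Sum>q\<in>?\<Pi>. of_bool (v q < v p))}"
      using fin by (simp add: Int_def)
    also have "\<dots> \<le> a * card ?\<Pi>"
      by (rule card_top_fraction_le[OF fin a(1)])
    finally show ?thesis unfolding card .
  qed
  have "fact (m + n) * measure ?M A = (\<Sum>p\<in>?\<Pi>. \<integral>x. indicator A (x \<circ> p) \<partial>?M)"
    using shift card by simp
  also have "\<dots> = (\<integral>x. (\<Sum>p\<in>?\<Pi>. indicator A (x \<circ> p)) \<partial>?M)"
    using shift by (subst Bochner_Integration.integral_sum) auto
  also have "\<dots> \<le> (\<integral>x. a * fact (m + n) \<partial>?M)"
    using shift by (intro integral_mono pt Bochner_Integration.integrable_sum) auto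
  also have "\<dots> = fact (m + n) * a" using PM.prob_space by simp
  finally show ?thesis unfolding A_def by simp
qed

section \<open>Mean and variance of the U-statistic\<close>

definition cells :: "nat \<Rightarrow> (int ^ 'd) set" where
  "cells \<kappa> = {k. \<forall>i. 0 \<le> k $ i \<and> k $ i < int \<kappa>}"

lemma finite_cells: "finite (cells \<kappa> :: (int ^ 'd) set)"
proof -
  have "(cells \<kappa> :: (int ^ 'd) set) \<subseteq> vec_lambda ` (PiE UNIV (\<lambda>_. {0..<int \<kappa>}))"
  proof
    fix k :: "int ^ 'd" assume "k \<in> cells \<kappa>"
    then have "vec_nth k \<in> PiE UNIV (\<lambda>_. {0..<int \<kappa>})" by (auto simp: cells_def)
    then show "k \<in> vec_lambda ` (PiE UNIV (\<lambda>_. {0..<int \<kappa>}))"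
      by (metis image_eqI vec_nth_inverse)
  qed
  moreover have "finite (PiE (UNIV :: 'd set) (\<lambda>_. {0..<int \<kappa>}))"
    by (intro finite_PiE) auto
  ultimately show ?thesis by (meson finite_imageI finite_subset)
qed

lemma cube_index_in_cells:
  assumes "1 \<le> \<kappa>" "x \<in> unit_cube"
  shows "cube_index \<kappa> x \<in> cells \<kappa>"
  using assms by (auto simp: cells_def cube_index_def mem_box_cart)

definition cell_prob :: "(real ^ 'd) measure \<Rightarrow> nat \<Rightarrow> int ^ 'd \<Rightarrow> real" where
  "cell_prob R \<kappa> k = measure R {y. cube_index \<kappa> y = k}"

definition cell_dist :: "(real ^ 'd) measure \<Rightarrow> (real ^ 'd) measure \<Rightarrow> nat \<Rightarrow> real" where
  "cell_dist P Q \<kappa> = (\<Sum>k\<in>cells \<kappa>. (cell_prob P \<kappa> k - cell_prob Q \<kappa> k)\<^sup>2)"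

lemma cell_set_sets [measurable]: "{y. cube_index \<kappa> y = k} \<in> sets (borel :: (real ^ 'd) measure)"
proof -
  have "{y \<in> space borel. cube_index \<kappa> y = k} \<in> sets (borel :: (real ^ 'd) measure)" by measurable
  then show ?thesis by simp
qed

lemma offdiag_left:
  assumes "finite J"
  shows "offdiag J (\<lambda>i _. f i) = (real (card J) - 1) * (\<Sum>i\<in>J. f i)"
proof -
  have "offdiag J (\<lambda>i _. f i) = (\<Sum>i\<in>J. (real (card J) - 1) * f i)"
    unfolding offdiag_altdef[OF assms]
  proof (rule sum.cong[OF refl])
    fix i assume i: "i \<in> J"
    then have "card J > 0" using assms card_gt_0_iff by blast
    then have "real (card J - Suc 0) = real (card J) - 1" by simp
    then show "(\<Sum>j\<in>J - {i}. f i) = (real (card J) - 1) * f i" using assms i by simp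
  qed
  then show ?thesis by (simp add: sum_distrib_left)
qed

lemma offdiag_constant: "finite J \<Longrightarrow> offdiag J (\<lambda>_ _. c) = real (card J) * (real (card J) - 1) * c"
  by (simp add: offdiag_left)

lemma ex_bound_sum:
  fixes g :: "'t \<Rightarrow> 's \<Rightarrow> real"
  assumes "f = (\<lambda>x. \<Sum>t\<in>T. g t x)" "\<And>t. \<exists>K. \<forall>x. \<bar>g t x\<bar> \<le> K"
  shows "\<exists>K. \<forall>x. \<bar>f x\<bar> \<le> K"
proof -
  from assms(2) obtain K where K: "\<And>t x. \<bar>g t x\<bar> \<le> K t" by metis
  have "\<bar>f x\<bar> \<le> (\<Sum>t\<in>T. K t)" for x
    unfolding assms(1) by (rule order_trans[OF sum_abs sum_mono]) (rule K)
  then show ?thesis by blast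
qed

locale cube_prob = prob_space R for R :: "(real ^ 'd) measure" +
  assumes sets_R [measurable_cong]: "sets R = sets borel"
    and AE_cube: "AE x in R. x \<in> unit_cube"
begin

lemma space_R [simp]: "space R = UNIV"
  using sets_eq_imp_space_eq[OF sets_R] by simp

lemma integrable_bounded:
  assumes "f \<in> borel_measurable R" "\<And>x. \<bar>f x\<bar> \<le> (K :: real)"
  shows "integrable R f"
  by (rule integrable_const_bound[where B = K]) (use assms in auto)

lemma integral_cells:
  assumes "1 \<le> \<kappa>"
  shows "(\<integral>x. \<psi> (cube_index \<kappa> x) \<partial>R) = (\<Sum>k\<in>cells \<kappa>. \<psi> k * cell_prob R \<kappa> k)"
proof -
  have meas: "(\<lambda>x. \<psi> (cube_index \<kappa> x)) \<in> borel_measurable R"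
    by (rule measurable_compose[of _ R "count_space UNIV"]) (auto simp: measurable_cong_sets[OF sets_R refl])
  have "(\<integral>x. \<psi> (cube_index \<kappa> x) \<partial>R)
      = (\<integral>x. (\<Sum>k\<in>cells \<kappa>. \<psi> k * indicator {y. cube_index \<kappa> y = k} x) \<partial>R)"
  proof (rule integral_cong_AE)
    show "AE x in R. \<psi> (cube_index \<kappa> x) = (\<Sum>k\<in>cells \<kappa>. \<psi> k * indicator {y. cube_index \<kappa> y = k} x)"
      using AE_cube
    proof eventually_elim
      case (elim x)
      have "(\<Sum>k\<in>cells \<kappa>. \<psi> k * indicator {y. cube_index \<kappa> y = k} x)
          = (\<Sum>k\<in>cells \<kappa>. if k = cube_index \<kappa> x then \<psi> k else 0)"
        by (intro sum.cong) (auto simp: indicator_def)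
      then show ?case
        using cube_index_in_cells[OF assms elim] by (simp add: finite_cells)
    qed
  qed (use meas in \<open>auto simp: measurable_cong_sets[OF sets_R refl]\<close>)
  also have "\<dots> = (\<Sum>k\<in>cells \<kappa>. \<integral>x. \<psi> k * indicator {y. cube_index \<kappa> y = k} x \<partial>R)"
    by (intro Bochner_Integration.integral_sum integrable_mult_right integrable_real_indicator)
      (auto simp: sets_R emeasure_eq_measure)
  also have "\<dots> = (\<Sum>k\<in>cells \<kappa>. \<psi> k * cell_prob R \<kappa> k)"
    by (simp add: cell_prob_def)
  finally show ?thesis .
qed

lemma integral_same_cube: "(\<integral>y. same_cube \<kappa> x y \<partial>R) = cell_prob R \<kappa> (cube_index \<kappa> x)"
proof -
  have "(\<lambda>y. same_cube \<kappa> x y) = indicator {y. cube_index \<kappa> y = cube_index \<kappa> x}"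
    by (auto simp: same_cube_def indicator_def fun_eq_iff)
  then show ?thesis by (simp add: cell_prob_def)
qed

lemma cell_prob_bounds: "0 \<le> cell_prob R \<kappa> k" "cell_prob R \<kappa> k \<le> 1"
  by (auto simp: cell_prob_def)

end

text \<open>The moment bounds below are linear in the common bound \<open>\<tau>\<close> on the cell
  probabilities. For bounded densities it is of order \<kappa>^-d, and this is where the dimension
  enters the rate.\<close>

locale two_sample = P: cube_prob P + Q: cube_prob Q for P Q :: "(real ^ 'd) measure" +
  fixes m n \<kappa> :: nat and \<tau> :: real
  assumes mn: "2 \<le> m" "m \<le> n" and \<kappa>: "1 \<le> \<kappa>"
    and \<tau>: "\<And>k. cell_prob P \<kappa> k \<le> \<tau>" "\<And>k. cell_prob Q \<kappa> k \<le> \<tau>"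
begin

abbreviation "I \<equiv> {..<m + n}"
abbreviation M :: "nat \<Rightarrow> (real ^ 'd) measure" where "M i \<equiv> (if i < m then P else Q)"
abbreviation "S \<equiv> PiM I M"

lemma cube_prob_M: "cube_prob (M i)"
  using P.cube_prob_axioms Q.cube_prob_axioms by simp

lemma prob_M: "prob_space (M i)"
  using P.prob_space_axioms Q.prob_space_axioms by simp

sublocale S: prob_space S
  by (rule prob_space_PiM) (rule prob_M)

lemma sets_M: "sets (M i) = sets borel"
  using P.sets_R Q.sets_R by simp

lemma component_measurable [measurable]:
  assumes "i < m + n"
  shows "(\<lambda>x. x i) \<in> borel_measurable S"
proof -
  have "(\<lambda>x. x i) \<in> measurable S (M i)"
    by (rule measurable_component_singleton) (use assms in simp)
  then show ?thesis by (simp only: measurable_cong_sets[OF refl sets_M])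
qed

lemma S_integrable_bounded:
  assumes "f \<in> borel_measurable S" "\<And>x. \<bar>f x\<bar> \<le> (K :: real)"
  shows "integrable S f"
  by (rule S.integrable_const_bound[where B = K]) (use assms in auto)

text \<open>The conditional mean of \<open>same_cube\<close> given one argument, the other being
  drawn from \<open>M i\<close>; see \<open>integral_same_cube_M\<close>.\<close>

definition r :: "nat \<Rightarrow> real ^ 'd \<Rightarrow> real" where
  "r i x = cell_prob (M i) \<kappa> (cube_index \<kappa> x)"

text \<open>Weights that write the four-index statistic as one quadratic form over the pooled
  sample. A mixed pair occurs in both orders, hence its weight carries no factor 2.\<close>

definition a :: "nat \<Rightarrow> nat \<Rightarrow> real" where
  "a i j = (if i < m \<and> j < m then 1 / (real m * (real m - 1))
     else if i \<ge> m \<and> j \<ge> m then 1 / (real n * (real n - 1)) else - 1 / (real m * real n))"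

definition w :: "nat \<Rightarrow> real" where
  "w i = (if i < m then 1 / real m else - 1 / real n)"

definition \<theta> :: "nat \<Rightarrow> nat \<Rightarrow> real" where
  "\<theta> i j = (\<integral>x. r j x \<partial>M i)"

definition e :: "real ^ 'd \<Rightarrow> real" where
  "e x = cell_prob P \<kappa> (cube_index \<kappa> x) - cell_prob Q \<kappa> (cube_index \<kappa> x)"

lemma r_measurable [measurable]: "r i \<in> borel_measurable borel"
  unfolding r_def[abs_def] by measurable

lemma e_measurable [measurable]: "e \<in> borel_measurable borel"
  unfolding e_def[abs_def] by measurable

lemma r_bounds: "0 \<le> r i x" "r i x \<le> 1" "r i x \<le> \<tau>"
  using cube_prob.cell_prob_bounds[OF cube_prob_M[of i]] \<tau> by (auto simp: r_def)

lemma e_bound: "\<bar>e x\<bar> \<le> 1"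
  using P.cell_prob_bounds[of \<kappa> "cube_index \<kappa> x"] Q.cell_prob_bounds[of \<kappa> "cube_index \<kappa> x"]
  by (auto simp: e_def)

lemma \<tau>_nonneg: "0 \<le> \<tau>"
  using \<tau>(1) P.cell_prob_bounds(1) order_trans by blast

lemma M_measurable: "f \<in> borel_measurable borel \<Longrightarrow> f \<in> borel_measurable (M i)"
  by (simp only: measurable_cong_sets[OF sets_M refl])

lemma r_integrable: "integrable (M i) (r j)"
  by (rule cube_prob.integrable_bounded[OF cube_prob_M, where K = 1])
    (use r_bounds in \<open>auto simp: M_measurable abs_le_iff intro: order_trans[of _ 0]\<close>)

lemma e_integrable: "integrable (M i) e"
  by (rule cube_prob.integrable_bounded[OF cube_prob_M, where K = 1])
    (use e_bound in \<open>auto simp: M_measurable\<close>)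

lemma integral_same_cube_M: "(\<integral>y. same_cube \<kappa> x y \<partial>M j) = r j x"
  "(\<integral>y. same_cube \<kappa> y x \<partial>M j) = r j x"
  using cube_prob.integral_same_cube[OF cube_prob_M[of j]] by (simp_all add: r_def same_cube_sym[of \<kappa> _ x])

lemma \<theta>_cells: "\<theta> i j = (\<Sum>k\<in>cells \<kappa>. cell_prob (M j) \<kappa> k * cell_prob (M i) \<kappa> k)"
  unfolding \<theta>_def r_def by (rule cube_prob.integral_cells[OF cube_prob_M \<kappa>])

lemma \<theta>_sym: "\<theta> i j = \<theta> j i"
  by (simp add: \<theta>_cells mult.commute)

lemma \<theta>_bounds: "0 \<le> \<theta> i j" "\<theta> i j \<le> 1" "\<theta> i j \<le> \<tau>"
proof -
  interpret Mi: cube_prob "M i" by (rule cube_prob_M)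
  show "0 \<le> \<theta> i j" unfolding \<theta>_def by (rule integral_nonneg_AE) (simp add: r_bounds)
  have "\<theta> i j \<le> (\<integral>x. 1 \<partial>M i)"
    unfolding \<theta>_def by (intro integral_mono r_integrable) (auto simp: r_bounds)
  then show "\<theta> i j \<le> 1" using Mi.prob_space by simp
  have "\<theta> i j \<le> (\<integral>x. \<tau> \<partial>M i)"
    unfolding \<theta>_def by (intro integral_mono r_integrable) (auto simp: r_bounds)
  then show "\<theta> i j \<le> \<tau>" using Mi.prob_space by simp
qed

lemma integral_e_square_le: "(\<integral>x. (e x)\<^sup>2 \<partial>M i) \<le> \<tau> * cell_dist P Q \<kappa>"
proof -
  have "(\<integral>x. (e x)\<^sup>2 \<partial>M i)
      = (\<Sum>k\<in>cells \<kappa>. (cell_prob P \<kappa> k - cell_prob Q \<kappa> k)\<^sup>2 * cell_prob (M i) \<kappa> k)"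
    unfolding e_def by (rule cube_prob.integral_cells[OF cube_prob_M \<kappa>])
  also have "\<dots> \<le> (\<Sum>k\<in>cells \<kappa>. (cell_prob P \<kappa> k - cell_prob Q \<kappa> k)\<^sup>2 * \<tau>)"
    using \<tau> by (intro sum_mono mult_left_mono) auto
  finally show ?thesis by (simp add: cell_dist_def sum_distrib_left mult.commute)
qed

lemma sum_w_integral_e: "(\<Sum>i\<in>I. w i * (\<integral>x. e x \<partial>M i)) = cell_dist P Q \<kappa>"
proof -
  have split: "I = {..<m} \<union> {m..<m + n}" by auto
  have "(\<Sum>i\<in>I. w i * (\<integral>x. e x \<partial>M i)) = (\<integral>x. e x \<partial>P) - (\<integral>x. e x \<partial>Q)"
    unfolding split using mn by (subst sum.union_disjoint) (auto simp: w_def)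
  also have "\<dots> = cell_dist P Q \<kappa>"
    unfolding e_def P.integral_cells[OF \<kappa>, of "\<lambda>k. cell_prob P \<kappa> k - cell_prob Q \<kappa> k"]
      Q.integral_cells[OF \<kappa>, of "\<lambda>k. cell_prob P \<kappa> k - cell_prob Q \<kappa> k"] cell_dist_def
    by (simp add: sum_subtractf[symmetric] power2_eq_square algebra_simps)
  finally show ?thesis .
qed

text \<open>Leaving out the index \<open>i\<close> is compensated by the factor
  \<open>real m - 1\<close> or \<open>real n - 1\<close> in the weights, so the row reduces to the
  difference of the own and the other cell probability; the sign of \<open>w\<close> makes both
  cases uniform.\<close>

lemma sum_a_r:
  assumes "i \<in> I"
  shows "(\<Sum>j\<in>I. of_bool (i \<noteq> j) * (a i j * r j x)) = w i * e x"
proof -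
  let ?p = "cell_prob P \<kappa> (cube_index \<kappa> x)" and ?q = "cell_prob Q \<kappa> (cube_index \<kappa> x)"
  have split: "I = {..<m} \<union> {m..<m + n}" by auto
  have 1: "(\<Sum>j\<in>I. of_bool (i \<noteq> j) * (a i j * r j x))
      = (\<Sum>j\<in>{..<m} - {i}. a i j * r j x) + (\<Sum>j\<in>{m..<m + n} - {i}. a i j * r j x)"
    unfolding split
    by (subst sum.union_disjoint)
      (auto intro!: arg_cong2[of _ _ _ _ "(+)"] sum.mono_neutral_cong_right)
  show ?thesis
  proof (cases "i < m")
    case True
    have "(\<Sum>j\<in>{..<m} - {i}. a i j * r j x) = (\<Sum>j\<in>{..<m} - {i}. ?p / (real m * (real m - 1)))"
      using True by (intro sum.cong) (auto simp: a_def r_def)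
    also have "\<dots> = ?p / real m"
      using True mn by (simp add: of_nat_diff)
    finally have 2: "(\<Sum>j\<in>{..<m} - {i}. a i j * r j x) = ?p / real m" .
    have "(\<Sum>j\<in>{m..<m + n} - {i}. a i j * r j x) = (\<Sum>j\<in>{m..<m + n}. - ?q / (real m * real n))"
      using True by (intro sum.cong) (auto simp: a_def r_def)
    also have "\<dots> = - ?q / real m" using mn by simp
    finally show ?thesis using 1 2 True by (simp add: w_def e_def diff_divide_distrib)
  next
    case False
    have "(\<Sum>j\<in>{m..<m + n} - {i}. a i j * r j x) = (\<Sum>j\<in>{m..<m + n} - {i}. ?q / (real n * (real n - 1)))"
      using False by (intro sum.cong) (auto simp: a_def r_def)
    also have "\<dots> = ?q / real n"
      using False mn assms by (simp add: of_nat_diff)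
    finally have 2: "(\<Sum>j\<in>{m..<m + n} - {i}. a i j * r j x) = ?q / real n" .
    have "(\<Sum>j\<in>{..<m} - {i}. a i j * r j x) = (\<Sum>j\<in>{..<m}. - ?p / (real m * real n))"
      using False by (intro sum.cong) (auto simp: a_def r_def)
    also have "\<dots> = - ?p / real n" using mn by simp
    finally show ?thesis using 1 2 False by (simp add: w_def e_def diff_divide_distrib)
  qed
qed

lemma a_sym: "a i j = a j i"
  by (simp add: a_def)

text \<open>Each term of the kernel depends on only two of the four indices, so the other two can be
  summed out. This gives the within-sample averages minus twice the average over mixed
  pairs.\<close>

lemma U_stat_eq_offdiag: "U_stat m n \<kappa> x = offdiag I (\<lambda>i j. a i j * same_cube \<kappa> (x i) (x j))"
proof -
  let ?J = "{m..<m + n}"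
  define g where "g i j = same_cube \<kappa> (x i) (x j)" for i j
  define X where "X = (\<Sum>i\<in>{..<m}. \<Sum>j\<in>?J. g i j)"
  have split: "I = {..<m} \<union> ?J" by auto
  have gs: "g i j = g j i" for i j by (simp add: g_def same_cube_sym)
  have pos: "real m > 0" "real m - 1 > 0" "real n > 0" "real n - 1 > 0" using mn by auto
  have inner: "offdiag ?J (\<lambda>j1 j2. g i1 i2 + g j1 j2 - g i1 j2 - g i2 j1)
      = real n * (real n - 1) * g i1 i2 + offdiag ?J g
        - (real n - 1) * (\<Sum>j\<in>?J. g i1 j) - (real n - 1) * (\<Sum>j\<in>?J. g i2 j)" for i1 i2
  proof -
    have "offdiag ?J (\<lambda>j1 j2. g i1 i2 + g j1 j2 - g i1 j2 - g i2 j1)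
        = offdiag ?J (\<lambda>_ _. g i1 i2) + offdiag ?J g + (-1) * offdiag ?J (\<lambda>j1 j2. g i1 j2)
          + (-1) * offdiag ?J (\<lambda>j1 _. g i2 j1)"
      unfolding offdiag_cmult[symmetric] offdiag_add[symmetric] by (rule offdiag_cong) auto
    moreover have "offdiag ?J (\<lambda>j1 j2. g i1 j2) = offdiag ?J (\<lambda>j1 j2. g i1 j1)"
      by (rule offdiag_swap)
    ultimately show ?thesis by (simp add: offdiag_constant offdiag_left)
  qed
  have "offdiag {..<m} (\<lambda>i1 i2. offdiag ?J (\<lambda>j1 j2. h_ts \<kappa> (x i1) (x i2) (x j1) (x j2)))
      = offdiag {..<m} (\<lambda>i1 i2. real n * (real n - 1) * g i1 i2 + offdiag ?J g
        - (real n - 1) * (\<Sum>j\<in>?J. g i1 j) - (real n - 1) * (\<Sum>j\<in>?J. g i2 j))"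
    unfolding inner[symmetric] by (simp only: h_ts_def g_def)
  also have "\<dots> = real n * (real n - 1) * offdiag {..<m} g + offdiag {..<m} (\<lambda>_ _. offdiag ?J g)
      + (- (real n - 1)) * offdiag {..<m} (\<lambda>i1 _. \<Sum>j\<in>?J. g i1 j)
      + (- (real n - 1)) * offdiag {..<m} (\<lambda>_ i2. \<Sum>j\<in>?J. g i2 j)"
    unfolding offdiag_cmult[symmetric] offdiag_add[symmetric]
    by (rule offdiag_cong) (auto simp: algebra_simps)
  also have "offdiag {..<m} (\<lambda>_ i2. \<Sum>j\<in>?J. g i2 j) = offdiag {..<m} (\<lambda>i1 _. \<Sum>j\<in>?J. g i1 j)"
    by (rule offdiag_swap)
  also have "\<dots> = (real m - 1) * X"
    by (simp add: offdiag_left X_def)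
  also have "offdiag {..<m} (\<lambda>_ _. offdiag ?J g) = real m * (real m - 1) * offdiag ?J g"
    by (simp add: offdiag_constant)
  finally have U: "U_stat m n \<kappa> x
      = (real n * (real n - 1) * offdiag {..<m} g + real m * (real m - 1) * offdiag ?J g
        - 2 * (real n - 1) * (real m - 1) * X) / (real m * (real m - 1) * real n * (real n - 1))"
    by (simp add: U_stat_offdiag algebra_simps)
  have "offdiag I (\<lambda>i j. a i j * g i j)
      = offdiag {..<m} (\<lambda>i j. a i j * g i j) + offdiag ?J (\<lambda>i j. a i j * g i j)
        + (\<Sum>i\<in>{..<m}. \<Sum>j\<in>?J. a i j * g i j) + (\<Sum>i\<in>{..<m}. \<Sum>j\<in>?J. a j i * g j i)"
    unfolding split by (rule offdiag_union) auto
  also have "offdiag {..<m} (\<lambda>i j. a i j * g i j) = 1 / (real m * (real m - 1)) * offdiag {..<m} g"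
    unfolding offdiag_cmult[symmetric] by (rule offdiag_cong) (auto simp: a_def)
  also have "offdiag ?J (\<lambda>i j. a i j * g i j) = 1 / (real n * (real n - 1)) * offdiag ?J g"
    unfolding offdiag_cmult[symmetric] by (rule offdiag_cong) (auto simp: a_def)
  also have "(\<Sum>i\<in>{..<m}. \<Sum>j\<in>?J. a j i * g j i) = (\<Sum>i\<in>{..<m}. \<Sum>j\<in>?J. a i j * g i j)"
    using gs a_sym by (intro sum.cong refl) metis
  also have "(\<Sum>i\<in>{..<m}. \<Sum>j\<in>?J. a i j * g i j) = - 1 / (real m * real n) * X"
    unfolding X_def sum_distrib_left by (intro sum.cong refl) (auto simp: a_def)
  also have "1 / (real m * (real m - 1)) * offdiag {..<m} g + 1 / (real n * (real n - 1)) * offdiag ?J g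
      + - 1 / (real m * real n) * X + - 1 / (real m * real n) * X = U_stat m n \<kappa> x"
    unfolding U using pos by (simp add: divide_simps)
  finally show ?thesis by (simp add: g_def)
qed

text \<open>The doubly centred kernel: subtracting both projections and adding the mean back makes
  both conditional means vanish, as \<open>canonical_second_moment\<close> requires.\<close>

definition B :: "nat \<Rightarrow> nat \<Rightarrow> real ^ 'd \<Rightarrow> real ^ 'd \<Rightarrow> real" where
  "B i j x y = a i j * (same_cube \<kappa> x y - r j x - r i y + \<theta> i j)"

definition c :: "nat \<Rightarrow> real ^ 'd \<Rightarrow> real" where
  "c i x = 2 * w i * (e x - (\<integral>y. e y \<partial>M i))"

text \<open>The weights are symmetric, so the two projections contribute the same linear sum, hence
  the factor 2 in \<open>c\<close>. Summing the rows evaluated in \<open>sum_a_r\<close> also shows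
  that the mean of the statistic is \<open>cell_dist P Q \<kappa>\<close>.\<close>

lemma hoeffding_decomposition:
  "U_stat m n \<kappa> x - cell_dist P Q \<kappa> = (\<Sum>i\<in>I. c i (x i)) + offdiag I (\<lambda>i j. B i j (x i) (x j))"
proof -
  have L: "offdiag I (\<lambda>i j. a i j * r j (x i)) = (\<Sum>i\<in>I. w i * e (x i))"
    unfolding offdiag_def by (rule sum.cong[OF refl sum_a_r])
  have R: "offdiag I (\<lambda>i j. a i j * r i (x j)) = (\<Sum>i\<in>I. w i * e (x i))"
    using offdiag_swap[of I "\<lambda>i j. a i j * r j (x i)"] unfolding L by (simp add: a_sym)
  have T: "offdiag I (\<lambda>i j. a i j * \<theta> i j) = cell_dist P Q \<kappa>"
  proof -
    have "offdiag I (\<lambda>i j. a i j * \<theta> i j) = (\<Sum>i\<in>I. w i * (\<integral>x. e x \<partial>M i))"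
      unfolding offdiag_def
    proof (rule sum.cong[OF refl])
      fix i assume i: "i \<in> I"
      have "(\<Sum>j\<in>I. of_bool (i \<noteq> j) * (a i j * \<theta> i j))
          = (\<integral>x. (\<Sum>j\<in>I. of_bool (i \<noteq> j) * (a i j * r j x)) \<partial>M i)"
        unfolding \<theta>_def using r_integrable
        by (subst Bochner_Integration.integral_sum) (auto simp del: sum_mult_of_bool_eq sum_of_bool_mult_eq)
      also have "\<dots> = w i * (\<integral>x. e x \<partial>M i)"
        unfolding sum_a_r[OF i] by simp
      finally show "(\<Sum>j\<in>I. of_bool (i \<noteq> j) * (a i j * \<theta> i j)) = w i * (\<integral>x. e x \<partial>M i)" .
    qed
    then show ?thesis unfolding sum_w_integral_e .
  qed
  have "offdiag I (\<lambda>i j. B i j (x i) (x j))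
      = offdiag I (\<lambda>i j. a i j * same_cube \<kappa> (x i) (x j)) + (-1) * offdiag I (\<lambda>i j. a i j * r j (x i))
        + (-1) * offdiag I (\<lambda>i j. a i j * r i (x j)) + offdiag I (\<lambda>i j. a i j * \<theta> i j)"
    unfolding offdiag_cmult[symmetric] offdiag_add[symmetric]
    by (rule offdiag_cong) (auto simp: B_def algebra_simps)
  then have 1: "offdiag I (\<lambda>i j. B i j (x i) (x j))
      = U_stat m n \<kappa> x - 2 * (\<Sum>i\<in>I. w i * e (x i)) + cell_dist P Q \<kappa>"
    unfolding L R T U_stat_eq_offdiag by simp
  have "(\<Sum>i\<in>I. c i (x i)) = 2 * (\<Sum>i\<in>I. w i * e (x i)) - 2 * (\<Sum>i\<in>I. w i * (\<integral>x. e x \<partial>M i))"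
    by (simp add: c_def sum_distrib_left sum_subtractf[symmetric] algebra_simps)
  then show ?thesis unfolding sum_w_integral_e 1 by simp
qed

section \<open>Second moments of the linear and the quadratic part\<close>

lemma w_bounds: "\<bar>w i\<bar> \<le> 1" "(\<Sum>i\<in>I. (w i)\<^sup>2) \<le> 2 / real m"
proof -
  show "\<bar>w i\<bar> \<le> 1" using mn by (auto simp: w_def)
  have split: "I = {..<m} \<union> {m..<m + n}" by auto
  have "(\<Sum>i\<in>I. (w i)\<^sup>2) = 1 / real m + 1 / real n"
    unfolding split using mn
    by (subst sum.union_disjoint) (auto simp: w_def power2_eq_square)
  also have "\<dots> \<le> 1 / real m + 1 / real m"
    using mn by (intro add_left_mono divide_left_mono) auto
  finally show "(\<Sum>i\<in>I. (w i)\<^sup>2) \<le> 2 / real m" by simp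
qed

text \<open>The variance inherits a factor \<open>cell_dist P Q \<kappa>\<close> from
  \<open>integral_e_square_le\<close>. Because of it, dividing by the squared signal leaves only
  \<open>\<tau> / (real m * D)\<close>, which tends to zero as the signal grows.\<close>

lemma linear_part_second_moment:
  "(\<integral>x. (\<Sum>i\<in>I. c i (x i))\<^sup>2 \<partial>S) \<le> 8 * \<tau> * cell_dist P Q \<kappa> / real m"
proof -
  have Ee: "\<bar>\<integral>y. e y \<partial>M i\<bar> \<le> 1" for i
  proof -
    interpret Mi: cube_prob "M i" by (rule cube_prob_M)
    have "(\<integral>y. e y \<partial>M i) \<le> (\<integral>y. 1 \<partial>M i)"
      by (intro integral_mono e_integrable) (use e_bound in \<open>auto simp: abs_le_iff\<close>)
    moreover have "(\<integral>y. -1 \<partial>M i) \<le> (\<integral>y. e y \<partial>M i)"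
      by (intro integral_mono e_integrable) (use e_bound in \<open>auto simp: abs_le_iff minus_le_iff\<close>)
    ultimately show ?thesis using Mi.prob_space by simp
  qed
  have c_bound: "\<bar>c i x\<bar> \<le> 4" for i x
  proof -
    have "\<bar>c i x\<bar> = 2 * (\<bar>w i\<bar> * \<bar>e x - (\<integral>y. e y \<partial>M i)\<bar>)" by (simp add: c_def abs_mult)
    also have "\<dots> \<le> 2 * (1 * 2)"
      using w_bounds(1)[of i] Ee[of i] e_bound[of x]
      by (intro mult_left_mono mult_mono) auto
    finally show ?thesis by simp
  qed
  have c_var: "(\<integral>x. (c i x)\<^sup>2 \<partial>M i) \<le> 4 * (w i)\<^sup>2 * (\<tau> * cell_dist P Q \<kappa>)"
    and c_mean: "(\<integral>x. c i x \<partial>M i) = 0" for i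
  proof -
    interpret Mi: cube_prob "M i" by (rule cube_prob_M)
    define \<mu> where "\<mu> = (\<integral>y. e y \<partial>M i)"
    note int = e_integrable[of i]
    have int2: "integrable (M i) (\<lambda>x. (e x)\<^sup>2)"
    proof (rule Mi.integrable_bounded[where K = 1])
      show "(\<lambda>x. (e x)\<^sup>2) \<in> borel_measurable (M i)" by (rule M_measurable) measurable
    qed (use e_bound in \<open>auto simp: abs_square_le_1\<close>)
    show "(\<integral>x. c i x \<partial>M i) = 0"
      unfolding c_def using int Mi.prob_space by simp
    have "(\<integral>x. (e x - \<mu>)\<^sup>2 \<partial>M i) = (\<integral>x. (e x)\<^sup>2 - 2 * \<mu> * e x + \<mu>\<^sup>2 \<partial>M i)"
      by (simp add: power2_eq_square algebra_simps)
    also have "\<dots> = (\<integral>x. (e x)\<^sup>2 \<partial>M i) - \<mu>\<^sup>2"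
      using int int2 Mi.prob_space by (simp add: \<mu>_def[symmetric] power2_eq_square)
    also have "\<dots> \<le> \<tau> * cell_dist P Q \<kappa>"
      using integral_e_square_le[of i] zero_le_power2[of \<mu>] by linarith
    finally have var: "(\<integral>x. (e x - \<mu>)\<^sup>2 \<partial>M i) \<le> \<tau> * cell_dist P Q \<kappa>" .
    have "(\<integral>x. (c i x)\<^sup>2 \<partial>M i) = 4 * (w i)\<^sup>2 * (\<integral>x. (e x - \<mu>)\<^sup>2 \<partial>M i)"
      by (simp add: c_def \<mu>_def power_mult_distrib)
    also have "\<dots> \<le> 4 * (w i)\<^sup>2 * (\<tau> * cell_dist P Q \<kappa>)"
      by (intro mult_left_mono var) auto
    finally show "(\<integral>x. (c i x)\<^sup>2 \<partial>M i) \<le> 4 * (w i)\<^sup>2 * (\<tau> * cell_dist P Q \<kappa>)" .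
  qed
  have c_meas: "c i \<in> borel_measurable (M i)" for i
    by (rule M_measurable) (simp add: c_def[abs_def])
  have "(\<integral>x. (\<Sum>i\<in>I. c i (x i))\<^sup>2 \<partial>S) = (\<Sum>i\<in>I. \<integral>x. (c i x)\<^sup>2 \<partial>M i)"
    by (rule centered_second_moment[OF _ prob_M c_meas c_bound c_mean]) simp
  also have "\<dots> \<le> (\<Sum>i\<in>I. 4 * (w i)\<^sup>2 * (\<tau> * cell_dist P Q \<kappa>))"
    by (intro sum_mono c_var)
  also have "\<dots> = 4 * (\<tau> * cell_dist P Q \<kappa>) * (\<Sum>i\<in>I. (w i)\<^sup>2)"
    by (simp add: sum_distrib_left mult_ac)
  also have "\<dots> \<le> 4 * (\<tau> * cell_dist P Q \<kappa>) * (2 / real m)"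
    using \<tau>_nonneg by (intro mult_left_mono w_bounds) (auto simp: cell_dist_def intro!: mult_nonneg_nonneg sum_nonneg)
  finally show ?thesis by simp
qed

lemma r_component_integral:
  assumes "i \<in> I"
  shows "integrable S (\<lambda>x. r j (x i))" "(\<integral>x. r j (x i) \<partial>S) \<le> \<tau>"
proof -
  have [measurable]: "(\<lambda>x. x i) \<in> borel_measurable S" using assms by (intro component_measurable) simp
  show 1: "integrable S (\<lambda>x. r j (x i))"
    by (rule S_integrable_bounded[where K = 1]) (auto simp: r_bounds abs_le_iff intro: order_trans[of _ 0])
  have "(\<integral>x. r j (x i) \<partial>S) \<le> (\<integral>x. \<tau> \<partial>S)"
    by (intro integral_mono 1) (auto simp: r_bounds)
  then show "(\<integral>x. r j (x i) \<partial>S) \<le> \<tau>" using S.prob_space by simp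
qed

lemma same_cube_component_integral:
  assumes "i \<in> I" "j \<in> I" "i \<noteq> j"
  shows "integrable S (\<lambda>x. same_cube \<kappa> (x i) (x j))" "(\<integral>x. same_cube \<kappa> (x i) (x j) \<partial>S) \<le> \<tau>"
proof -
  have [measurable]: "(\<lambda>x. x i) \<in> borel_measurable S" "(\<lambda>x. x j) \<in> borel_measurable S"
    using assms by (auto intro!: component_measurable)
  show 1: "integrable S (\<lambda>x. same_cube \<kappa> (x i) (x j))"
    by (rule S_integrable_bounded[where K = 1])
      (auto simp: same_cube_bounds abs_le_iff intro: order_trans[of _ 0])
  have "(\<integral>x. same_cube \<kappa> (x i) (x j) \<partial>S)
      = (\<integral>x. (\<integral>t. same_cube \<kappa> ((x(j := t)) i) ((x(j := t)) j) \<partial>M j) \<partial>S)"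
    by (rule integral_PiM_resample[OF prob_M assms(2) 1])
  also have "\<dots> = (\<integral>x. r j (x i) \<partial>S)"
    using assms by (simp add: integral_same_cube_M del: split_paired_All)
  also have "\<dots> \<le> \<tau>" by (rule r_component_integral[OF assms(1)])
  finally show "(\<integral>x. same_cube \<kappa> (x i) (x j) \<partial>S) \<le> \<tau>" .
qed

lemma offdiag_a_square_le: "offdiag I (\<lambda>i j. (a i j)\<^sup>2) \<le> 6 / (real m)\<^sup>2"
proof -
  let ?J = "{m..<m + n}"
  have split: "I = {..<m} \<union> ?J" by auto
  have pos: "real m > 0" "real m - 1 > 0" "real n > 0" "real n - 1 > 0" "real m / 2 \<le> real m - 1"
    "real m / 2 \<le> real n - 1" "real m \<le> real n" using mn by auto
  have "offdiag I (\<lambda>i j. (a i j)\<^sup>2) = offdiag {..<m} (\<lambda>i j. (a i j)\<^sup>2) + offdiag ?J (\<lambda>i j. (a i j)\<^sup>2)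
      + (\<Sum>i\<in>{..<m}. \<Sum>j\<in>?J. (a i j)\<^sup>2) + (\<Sum>i\<in>{..<m}. \<Sum>j\<in>?J. (a j i)\<^sup>2)"
    unfolding split by (rule offdiag_union) auto
  also have "offdiag {..<m} (\<lambda>i j. (a i j)\<^sup>2) = offdiag {..<m} (\<lambda>_ _. (1 / (real m * (real m - 1)))\<^sup>2)"
    by (rule offdiag_cong) (auto simp: a_def)
  also have "\<dots> = 1 / (real m * (real m - 1))"
    using pos by (simp add: offdiag_constant power2_eq_square)
  also have "offdiag ?J (\<lambda>i j. (a i j)\<^sup>2) = offdiag ?J (\<lambda>_ _. (1 / (real n * (real n - 1)))\<^sup>2)"
    by (rule offdiag_cong) (auto simp: a_def)
  also have "\<dots> = 1 / (real n * (real n - 1))"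
    using pos by (simp add: offdiag_constant power2_eq_square)
  also have "(\<Sum>i\<in>{..<m}. \<Sum>j\<in>?J. (a j i)\<^sup>2) = (\<Sum>i\<in>{..<m}. \<Sum>j\<in>?J. (a i j)\<^sup>2)"
    using a_sym by (intro sum.cong refl) metis
  also have "(\<Sum>i\<in>{..<m}. \<Sum>j\<in>?J. (a i j)\<^sup>2) = (\<Sum>i\<in>{..<m}. \<Sum>j\<in>?J. (1 / (real m * real n))\<^sup>2)"
    by (intro sum.cong refl) (auto simp: a_def)
  also have "\<dots> = 1 / (real m * real n)"
    using pos by (simp add: power2_eq_square)
  finally have "offdiag I (\<lambda>i j. (a i j)\<^sup>2)
      = 1 / (real m * (real m - 1)) + 1 / (real n * (real n - 1)) + 1 / (real m * real n) + 1 / (real m * real n)" .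
  moreover have "1 / (real m * (real m - 1)) \<le> 1 / (real m * (real m / 2))"
    using pos by (intro divide_left_mono mult_left_mono mult_pos_pos) auto
  moreover have "1 / (real n * (real n - 1)) \<le> 1 / (real m * (real m / 2))"
    using pos by (intro divide_left_mono mult_mono mult_pos_pos) auto
  moreover have "1 / (real m * real n) \<le> 1 / (real m * real m)"
    using pos by (intro divide_left_mono mult_left_mono mult_pos_pos) auto
  ultimately show ?thesis by (simp add: power2_eq_square)
qed

text \<open>All four terms of the centred kernel lie in [0, 1], so their squares are at most the
  terms themselves, whose means are at most \<open>\<tau>\<close>. The constant is the 2 of
  \<open>canonical_second_moment\<close> times 16 times the 6 of
  \<open>offdiag_a_square_le\<close>.\<close>

lemma quadratic_part_second_moment:
  "(\<integral>x. (offdiag I (\<lambda>i j. B i j (x i) (x j)))\<^sup>2 \<partial>S) \<le> 192 * \<tau> / (real m)\<^sup>2"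
proof -
  have a_bound: "\<bar>a i j\<bar> \<le> 1" for i j
  proof -
    have "1 \<le> real m * (real m - 1)" "1 \<le> real n * (real n - 1)" "1 \<le> real m * real n"
      using mn mult_mono[of 1 "real m" 1 "real m - 1"] mult_mono[of 1 "real n" 1 "real n - 1"]
        mult_mono[of 1 "real m" 1 "real n"] by auto
    then show ?thesis by (auto simp: a_def)
  qed
  have B_bound: "\<bar>B i j x y\<bar> \<le> 4" for i j x y
  proof -
    have "\<bar>B i j x y\<bar> = \<bar>a i j\<bar> * \<bar>same_cube \<kappa> x y - r j x - r i y + \<theta> i j\<bar>"
      by (simp add: B_def abs_mult)
    also have "\<dots> \<le> 1 * 4"
      using a_bound[of i j] same_cube_bounds[of \<kappa> x y] r_bounds[of j x] r_bounds[of i y] \<theta>_bounds[of i j]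
      by (intro mult_mono) auto
    finally show ?thesis by simp
  qed
  have B_meas: "(\<lambda>x. B i j (x i) (x j)) \<in> borel_measurable S" if ij: "i \<in> I" "j \<in> I" for i j
  proof -
    have [measurable]: "(\<lambda>x. x i) \<in> borel_measurable S" "(\<lambda>x. x j) \<in> borel_measurable S"
      using ij by (auto intro!: component_measurable)
    show ?thesis unfolding B_def by measurable
  qed
  have sc_int: "integrable (M i) (\<lambda>y. same_cube \<kappa> x y)" "integrable (M i) (\<lambda>y. same_cube \<kappa> y x)" for i x
  proof -
    have "(\<lambda>y. same_cube \<kappa> x y) \<in> borel_measurable borel" "(\<lambda>y. same_cube \<kappa> y x) \<in> borel_measurable borel"
      by (auto intro!: same_cube_measurable)
    moreover have "\<bar>same_cube \<kappa> x y\<bar> \<le> 1" "\<bar>same_cube \<kappa> y x\<bar> \<le> 1" for y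
      using same_cube_bounds[of \<kappa> x y] same_cube_bounds[of \<kappa> y x] by auto
    ultimately show "integrable (M i) (\<lambda>y. same_cube \<kappa> x y)" "integrable (M i) (\<lambda>y. same_cube \<kappa> y x)"
      using cube_prob.integrable_bounded[OF cube_prob_M M_measurable] by blast+
  qed
  have can1: "(\<integral>y. B i j x y \<partial>M j) = 0" for i j x
  proof -
    interpret Mj: cube_prob "M j" by (rule cube_prob_M)
    have "(\<integral>y. B i j x y \<partial>M j) = a i j * (r j x - r j x - \<theta> j i + \<theta> i j)"
      unfolding B_def using sc_int r_integrable Mj.prob_space
      by (simp add: integral_same_cube_M \<theta>_def del: if_split)
    then show ?thesis by (simp add: \<theta>_sym[of j i])
  qed
  have can2: "(\<integral>x. B i j x y \<partial>M i) = 0" for i j y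
  proof -
    interpret Mi: cube_prob "M i" by (rule cube_prob_M)
    have "(\<integral>x. B i j x y \<partial>M i) = a i j * (r i y - \<theta> i j - r i y + \<theta> i j)"
      unfolding B_def using sc_int r_integrable Mi.prob_space
      by (simp add: integral_same_cube_M \<theta>_def del: if_split)
    then show ?thesis by simp
  qed
  have var: "(\<integral>x. (B i j (x i) (x j))\<^sup>2 \<partial>S) \<le> 16 * \<tau> * (a i j)\<^sup>2" if ij: "i \<in> I" "j \<in> I" "i \<noteq> j" for i j
  proof -
    have pt: "(B i j x y)\<^sup>2 \<le> (a i j)\<^sup>2 * (4 * (same_cube \<kappa> x y + r j x + r i y + \<theta> i j))" for x y
    proof -
      have sq: "z\<^sup>2 \<le> z" if "0 \<le> z" "z \<le> 1" for z :: real
        using mult_left_mono[OF that(2,1)] by (simp add: power2_eq_square)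
      have "(p - q - s + t)\<^sup>2 \<le> 4 * (p\<^sup>2 + q\<^sup>2 + s\<^sup>2 + t\<^sup>2)" for p q s t :: real
      proof -
        have "4 * (p\<^sup>2 + q\<^sup>2 + s\<^sup>2 + t\<^sup>2) - (p - q - s + t)\<^sup>2
            = (p + q)\<^sup>2 + (p + s)\<^sup>2 + (p - t)\<^sup>2 + (q - s)\<^sup>2 + (q + t)\<^sup>2 + (s + t)\<^sup>2"
          by (simp add: power2_eq_square algebra_simps)
        also have "\<dots> \<ge> 0" by simp
        finally show ?thesis by simp
      qed
      from this[of "same_cube \<kappa> x y" "r j x" "r i y" "\<theta> i j"]
      have "(same_cube \<kappa> x y - r j x - r i y + \<theta> i j)\<^sup>2 \<le> 4 * (same_cube \<kappa> x y + r j x + r i y + \<theta> i j)"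
        using sq[OF same_cube_bounds, of \<kappa> x y] sq[OF r_bounds(1,2), of j x] sq[OF r_bounds(1,2), of i y]
          sq[OF \<theta>_bounds(1,2), of i j] by argo
      then show ?thesis unfolding B_def power_mult_distrib by (intro mult_left_mono) auto
    qed
    note ints = same_cube_component_integral[OF ij] r_component_integral[OF ij(1), of j]
      r_component_integral[OF ij(2), of i]
    have "(\<integral>x. (B i j (x i) (x j))\<^sup>2 \<partial>S)
        \<le> (\<integral>x. (a i j)\<^sup>2 * (4 * (same_cube \<kappa> (x i) (x j) + r j (x i) + r i (x j) + \<theta> i j)) \<partial>S)"
    proof (rule integral_mono)
      show "integrable S (\<lambda>x. (B i j (x i) (x j))\<^sup>2)"
      proof (rule S_integrable_bounded[where K = 16])
        show "\<bar>(B i j (x i) (x j))\<^sup>2\<bar> \<le> 16" for x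
          using power_mono[OF B_bound[of i j "x i" "x j"], of 2] by simp
      qed (use B_meas[OF ij(1,2)] in measurable)
    qed (use ints pt in auto)
    also have "\<dots> = (a i j)\<^sup>2 * (4 * ((\<integral>x. same_cube \<kappa> (x i) (x j) \<partial>S) + (\<integral>x. r j (x i) \<partial>S)
        + (\<integral>x. r i (x j) \<partial>S) + \<theta> i j))"
      using ints S.prob_space by simp
    also have "\<dots> \<le> (a i j)\<^sup>2 * (4 * (\<tau> + \<tau> + \<tau> + \<tau>))"
      using ints \<theta>_bounds by (intro mult_left_mono add_mono) auto
    finally show ?thesis by (simp add: mult_ac)
  qed
  have "(\<integral>x. (offdiag I (\<lambda>i j. B i j (x i) (x j)))\<^sup>2 \<partial>S)
      \<le> 2 * offdiag I (\<lambda>i j. \<integral>x. (B i j (x i) (x j))\<^sup>2 \<partial>S)"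
    by (rule canonical_second_moment[OF _ prob_M B_meas B_bound can1 can2]) auto
  also have "\<dots> \<le> 2 * offdiag I (\<lambda>i j. 16 * \<tau> * (a i j)\<^sup>2)"
    by (intro mult_left_mono offdiag_mono var) auto
  also have "\<dots> = 32 * \<tau> * offdiag I (\<lambda>i j. (a i j)\<^sup>2)"
    by (simp only: offdiag_cmult)
  also have "\<dots> \<le> 32 * \<tau> * (6 / (real m)\<^sup>2)"
    using \<tau>_nonneg by (intro mult_left_mono offdiag_a_square_le) auto
  finally show ?thesis by simp
qed

section \<open>Chebyshev and Markov bounds for the type II error of a single test\<close>

lemma U_stat_variance:
  shows "integrable S (\<lambda>x. (U_stat m n \<kappa> x - cell_dist P Q \<kappa>)\<^sup>2)"
    and "(\<integral>x. (U_stat m n \<kappa> x - cell_dist P Q \<kappa>)\<^sup>2 \<partial>S)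
      \<le> 16 * \<tau> * cell_dist P Q \<kappa> / real m + 384 * \<tau> / (real m)\<^sup>2"
proof -
  define l where "l x = (\<Sum>i\<in>I. c i (x i))" for x
  define q where "q x = offdiag I (\<lambda>i j. B i j (x i) (x j))" for x
  have lm: "l \<in> borel_measurable S"
    unfolding l_def[abs_def] c_def
    by (intro borel_measurable_sum borel_measurable_times borel_measurable_diff borel_measurable_const
        measurable_compose[OF component_measurable e_measurable]) auto
  have qm: "q \<in> borel_measurable S"
    unfolding q_def[abs_def] B_def offdiag_def
    by (intro borel_measurable_sum borel_measurable_times borel_measurable_diff borel_measurable_add
        borel_measurable_const same_cube_measurable component_measurable
        measurable_compose[OF component_measurable r_measurable]) auto
  have "\<exists>K. \<forall>x. \<bar>l x\<bar> \<le> K"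
  proof (rule ex_bound_sum[where g = "\<lambda>i x. c i (x i)" and T = I])
    fix i
    have "\<bar>c i (x i)\<bar> \<le> \<bar>2 * w i\<bar> * (1 + \<bar>\<integral>y. e y \<partial>M i\<bar>)" for x :: "nat \<Rightarrow> real ^ 'd"
      unfolding c_def abs_mult[of "2 * w i"] using e_bound[of "x i"] by (intro mult_left_mono) auto
    then show "\<exists>K. \<forall>x. \<bar>c i ((x :: nat \<Rightarrow> real ^ 'd) i)\<bar> \<le> K" by blast
  qed (simp add: l_def[abs_def])
  then obtain K1 where K1: "\<And>x. \<bar>l x\<bar> \<le> K1" by blast
  have "\<exists>K. \<forall>x. \<bar>q x\<bar> \<le> K"
  proof (rule ex_bound_sum[where g = "\<lambda>t x. of_bool (fst t \<noteq> snd t) * B (fst t) (snd t) (x (fst t)) (x (snd t))"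
      and T = "I \<times> I"])
    show "q = (\<lambda>x. \<Sum>t\<in>I \<times> I. of_bool (fst t \<noteq> snd t) * B (fst t) (snd t) (x (fst t)) (x (snd t)))"
      unfolding q_def[abs_def] offdiag_def sum.cartesian_product by (simp add: case_prod_beta')
    fix t :: "nat \<times> nat"
    obtain i j where t: "t = (i, j)" by (cases t)
    have "\<bar>of_bool (i \<noteq> j) * B i j (x i) (x j)\<bar> \<le> \<bar>a i j\<bar> * 4" for x :: "nat \<Rightarrow> real ^ 'd"
    proof -
      have "\<bar>of_bool (i \<noteq> j) * B i j (x i) (x j)\<bar> \<le> \<bar>B i j (x i) (x j)\<bar>" by auto
      also have "\<dots> \<le> \<bar>a i j\<bar> * 4"
        unfolding B_def abs_mult
        using same_cube_bounds[of \<kappa> "x i" "x j"] r_bounds[of j "x i"] r_bounds[of i "x j"] \<theta>_bounds[of i j]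
        by (intro mult_left_mono) auto
      finally show ?thesis .
    qed
    then show "\<exists>K. \<forall>x. \<bar>of_bool (fst t \<noteq> snd t) * B (fst t) (snd t) ((x :: nat \<Rightarrow> real ^ 'd) (fst t)) (x (snd t))\<bar> \<le> K"
      unfolding t fst_conv snd_conv by blast
  qed
  then obtain K2 where K2: "\<And>x. \<bar>q x\<bar> \<le> K2" by blast
  have sq_int: "integrable S (\<lambda>x. (f x)\<^sup>2)" if "f \<in> borel_measurable S" "\<And>x. \<bar>f x\<bar> \<le> K"
    for f :: "(nat \<Rightarrow> real ^ 'd) \<Rightarrow> real" and K
  proof (rule S_integrable_bounded[where K = "K\<^sup>2"])
    show "\<bar>(f x)\<^sup>2\<bar> \<le> K\<^sup>2" for x using power_mono[OF that(2)[of x], of 2] by simp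
  qed (use that(1) in measurable)
  have dec: "U_stat m n \<kappa> x - cell_dist P Q \<kappa> = l x + q x" for x
    unfolding hoeffding_decomposition l_def q_def ..
  have "\<bar>l x + q x\<bar> \<le> K1 + K2" for x using K1[of x] K2[of x] by linarith
  then show int: "integrable S (\<lambda>x. (U_stat m n \<kappa> x - cell_dist P Q \<kappa>)\<^sup>2)"
    unfolding dec using sq_int[OF borel_measurable_add[OF lm qm], of "K1 + K2"] by simp
  have "(\<integral>x. (U_stat m n \<kappa> x - cell_dist P Q \<kappa>)\<^sup>2 \<partial>S) \<le> (\<integral>x. 2 * (l x)\<^sup>2 + 2 * (q x)\<^sup>2 \<partial>S)"
  proof (rule integral_mono[OF int])
    show "integrable S (\<lambda>x. 2 * (l x)\<^sup>2 + 2 * (q x)\<^sup>2)"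
      using sq_int[OF lm K1] sq_int[OF qm K2] by simp
    show "(U_stat m n \<kappa> x - cell_dist P Q \<kappa>)\<^sup>2 \<le> 2 * (l x)\<^sup>2 + 2 * (q x)\<^sup>2" for x
      unfolding dec using zero_le_power2[of "l x - q x"] by (simp add: power2_eq_square algebra_simps)
  qed
  also have "\<dots> = 2 * (\<integral>x. (l x)\<^sup>2 \<partial>S) + 2 * (\<integral>x. (q x)\<^sup>2 \<partial>S)"
    using sq_int[OF lm K1] sq_int[OF qm K2] by simp
  also have "\<dots> \<le> 2 * (8 * \<tau> * cell_dist P Q \<kappa> / real m) + 2 * (192 * \<tau> / (real m)\<^sup>2)"
    using linear_part_second_moment quadratic_part_second_moment
    unfolding l_def q_def by (intro add_mono mult_left_mono) auto
  finally show "(\<integral>x. (U_stat m n \<kappa> x - cell_dist P Q \<kappa>)\<^sup>2 \<partial>S)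
      \<le> 16 * \<tau> * cell_dist P Q \<kappa> / real m + 384 * \<tau> / (real m)\<^sup>2" by simp
qed

text \<open>If the test accepts, then either the statistic falls below half its mean, or
  \<open>G\<close> is so large that the bound on the critical value reaches that half. Chebyshev's
  inequality controls the first event and yields the first two terms; Markov's inequality for
  \<open>G\<close> controls the second and yields the third.\<close>

lemma perm_test_type_II:
  assumes al: "0 < al" "al < 1" and D: "0 < cell_dist P Q \<kappa>"
  shows "measure S {x \<in> space S. perm_test m n \<kappa> al x = 0}
    \<le> 64 * \<tau> / (real m * cell_dist P Q \<kappa>) + 1536 * \<tau> / (real m * cell_dist P Q \<kappa>)\<^sup>2
      + 4096 * \<tau> * (real (m + n) / real m)\<^sup>2 * (ln (2 / al))\<^sup>2 / (real m * cell_dist P Q \<kappa>)\<^sup>2"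
proof -
  define D where "D = cell_dist P Q \<kappa>"
  define G where "G x = offdiag I (\<lambda>i j. same_cube \<kappa> (x i) (x j))" for x :: "nat \<Rightarrow> real ^ 'd"
  define b where "b = real m * (real m - 1)"
  \<comment> \<open>The value of \<open>G\<close> at which \<open>16 * sqrt G * ln (2 / al)\<close>
    equals \<open>D * b / 2\<close>.\<close>
  define t where "t = (D * b / (32 * ln (2 / al)))\<^sup>2"
  have D0: "D > 0" using D by (simp add: D_def)
  have m0: "real m > 0" "real m / 2 \<le> real m - 1" using mn by auto
  have b0: "b > 0" "b \<ge> (real m)\<^sup>2 / 2"
    using m0 mult_left_mono[of "real m / 2" "real m - 1" "real m"] mn
    by (auto simp: b_def power2_eq_square)
  have la: "ln (2 / al) > 0" using al by simp
  have t0: "t > 0" using D0 b0 la by (simp add: t_def)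
  define A1 where "A1 = {x \<in> space S. (U_stat m n \<kappa> x - D)\<^sup>2 \<ge> D\<^sup>2 / 4}"
  define A2 where "A2 = {x \<in> space S. G x \<ge> t}"
  have G_int: "integrable S G"
    unfolding G_def[abs_def] offdiag_altdef[OF finite_lessThan]
    by (intro Bochner_Integration.integrable_sum same_cube_component_integral) auto
  have G_mean: "(\<integral>x. G x \<partial>S) \<le> (real (m + n))\<^sup>2 * \<tau>"
  proof -
    have "(\<integral>x. G x \<partial>S) = offdiag I (\<lambda>i j. \<integral>x. same_cube \<kappa> (x i) (x j) \<partial>S)"
      unfolding G_def offdiag_altdef[OF finite_lessThan]
      by (subst Bochner_Integration.integral_sum; intro Bochner_Integration.integrable_sum sum.cong refl
          Bochner_Integration.integral_sum same_cube_component_integral; auto)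
    also have "\<dots> \<le> offdiag I (\<lambda>_ _. \<tau>)"
      by (intro offdiag_mono same_cube_component_integral)
    also have "\<dots> = real (m + n) * (real (m + n) - 1) * \<tau>"
      by (simp add: offdiag_constant)
    also have "\<dots> \<le> (real (m + n))\<^sup>2 * \<tau>"
      using \<tau>_nonneg unfolding power2_eq_square by (intro mult_right_mono mult_left_mono) auto
    finally show ?thesis .
  qed
  have A_sets: "A1 \<in> sets S" "A2 \<in> sets S"
  proof -
    have [measurable]: "U_stat m n \<kappa> \<in> borel_measurable S"
      using U_stat_measurable[where M = M and m = m and n = n and p = id] sets_M permutes_id by simp
    show "A1 \<in> sets S" unfolding A1_def by measurable
    have [measurable]: "G \<in> borel_measurable S" using G_int by (rule borel_measurable_integrable)
    show "A2 \<in> sets S" unfolding A2_def by measurable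
  qed
  have sub: "{x \<in> space S. perm_test m n \<kappa> al x = 0} \<subseteq> A1 \<union> A2"
  proof
    fix x assume "x \<in> {x \<in> space S. perm_test m n \<kappa> al x = 0}"
    then have x: "x \<in> space S" "perm_test m n \<kappa> al x = 0" by auto
    have G0: "G x \<ge> 0" by (simp add: G_def offdiag_nonneg same_cube_bounds)
    have le: "U_stat m n \<kappa> x * b \<le> 16 * sqrt (G x) * ln (2 / al)"
      unfolding G_def b_def by (rule perm_test_0_imp_U_stat_le[OF mn al x(2)])
    show "x \<in> A1 \<union> A2"
    proof (cases "U_stat m n \<kappa> x \<le> D / 2")
      case True
      then have "(D / 2)\<^sup>2 \<le> (D - U_stat m n \<kappa> x)\<^sup>2" using D0 by (intro power_mono) auto
      then show ?thesis using x by (simp add: A1_def power2_commute power_divide)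
    next
      case False
      then have "D / 2 * b \<le> U_stat m n \<kappa> x * b" using b0 by (intro mult_right_mono) auto
      with le have "D * b \<le> 32 * ln (2 / al) * sqrt (G x)" by (simp add: algebra_simps)
      then have "D * b / (32 * ln (2 / al)) \<le> sqrt (G x)" using la by (simp add: divide_le_eq mult_ac)
      then have "t \<le> (sqrt (G x))\<^sup>2" unfolding t_def using D0 b0 la by (intro power_mono) auto
      then show ?thesis using x G0 by (simp add: A2_def)
    qed
  qed
  have "measure S {x \<in> space S. perm_test m n \<kappa> al x = 0} \<le> measure S (A1 \<union> A2)"
    using A_sets by (intro S.finite_measure_mono sub) auto
  also have "\<dots> \<le> measure S A1 + measure S A2"
    by (rule measure_Un_le[OF A_sets])
  also have "\<dots> \<le> (\<integral>x. (U_stat m n \<kappa> x - D)\<^sup>2 \<partial>S) / (D\<^sup>2 / 4) + (\<integral>x. G x \<partial>S) / t"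
  proof (intro add_mono)
    show "measure S A1 \<le> (\<integral>x. (U_stat m n \<kappa> x - D)\<^sup>2 \<partial>S) / (D\<^sup>2 / 4)"
      unfolding A1_def using U_stat_variance(1) D0
      by (intro integral_Markov_inequality_measure[where A = "{}"]) (auto simp: D_def)
    show "measure S A2 \<le> (\<integral>x. G x \<partial>S) / t"
      unfolding A2_def
    proof (rule integral_Markov_inequality_measure[where A = "{}"])
      show "AE x in S. 0 \<le> G x" by (simp add: G_def offdiag_nonneg same_cube_bounds)
    qed (use G_int t0 in auto)
  qed
  also have "\<dots> \<le> (16 * \<tau> * D / real m + 384 * \<tau> / (real m)\<^sup>2) / (D\<^sup>2 / 4)
      + (real (m + n))\<^sup>2 * \<tau> / (D * ((real m)\<^sup>2 / 2) / (32 * ln (2 / al)))\<^sup>2"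
  proof (intro add_mono)
    show "(\<integral>x. (U_stat m n \<kappa> x - D)\<^sup>2 \<partial>S) / (D\<^sup>2 / 4)
        \<le> (16 * \<tau> * D / real m + 384 * \<tau> / (real m)\<^sup>2) / (D\<^sup>2 / 4)"
      using U_stat_variance(2) unfolding D_def by (intro divide_right_mono) auto
    have "(D * ((real m)\<^sup>2 / 2) / (32 * ln (2 / al)))\<^sup>2 \<le> t"
      unfolding t_def using D0 la b0 by (intro power_mono divide_right_mono mult_left_mono) auto
    then show "(\<integral>x. G x \<partial>S) / t
        \<le> (real (m + n))\<^sup>2 * \<tau> / (D * ((real m)\<^sup>2 / 2) / (32 * ln (2 / al)))\<^sup>2"
      using G_mean \<tau>_nonneg D0 m0 la by (intro frac_le) auto
  qed
  \<comment> \<open>The 4096 is the square of 32 * 2; the extra 2 stems from replacing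
    \<open>real m * (real m - 1)\<close> by half of \<open>(real m)\<^sup>2\<close>.\<close>
  also have "\<dots> = 64 * \<tau> / (real m * D) + 1536 * \<tau> / (real m * D)\<^sup>2
      + 4096 * \<tau> * (real (m + n) / real m)\<^sup>2 * (ln (2 / al))\<^sup>2 / (real m * D)\<^sup>2"
    using D0 m0 la by (simp add: field_simps power2_eq_square)
  finally show ?thesis by (simp add: D_def)
qed

end

section \<open>Reconstruction of polynomials from averages\<close>

lemma poly_antiderivative:
  fixes p :: "real poly"
  shows "\<exists>q. pderiv q = p \<and> degree q \<le> Suc (degree p) \<and> poly q 0 = 0"
proof -
  define q where "q = (\<Sum>i\<le>degree p. monom (coeff p i / real (Suc i)) (Suc i))"
  have "pderiv q = (\<Sum>i\<le>degree p. monom (coeff p i) i)"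
    unfolding q_def by (subst higher_pderiv_sum[of 1, simplified]) (simp add: pderiv_monom)
  then have "pderiv q = p" by (simp add: poly_as_sum_of_monoms)
  moreover have "degree q \<le> Suc (degree p)"
    unfolding q_def by (intro degree_sum_le) (auto intro: order_trans[OF degree_monom_le])
  moreover have "poly q 0 = 0"
    by (simp add: q_def poly_sum poly_monom)
  ultimately show ?thesis by blast
qed

definition lagrange_basis :: "nat \<Rightarrow> nat \<Rightarrow> real poly" where
  "lagrange_basis r i = (\<Prod>j\<in>{..r} - {i}. smult (1 / (real i - real j)) [:- real j, 1:])"

lemma lagrange_interpolation:
  fixes q :: "real poly"
  assumes "degree q \<le> r"
  shows "q = (\<Sum>i\<le>r. smult (poly q (real i)) (lagrange_basis r i))"
proof -
  define p where "p = q - (\<Sum>i\<le>r. smult (poly q (real i)) (lagrange_basis r i))"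
  have deg: "degree (lagrange_basis r i) \<le> r" if "i \<le> r" for i
  proof -
    have "degree (lagrange_basis r i)
        \<le> sum (degree \<circ> (\<lambda>j. smult (1 / (real i - real j)) [:- real j, 1:])) ({..r} - {i})"
      unfolding lagrange_basis_def by (rule degree_prod_sum_le) simp
    also have "\<dots> \<le> (\<Sum>j\<in>{..r} - {i}. 1)"
      by (intro sum_mono) (auto intro: order_trans[OF degree_smult_le])
    finally show ?thesis using that by simp
  qed
  have "degree p \<le> r"
    unfolding p_def using assms
    by (intro degree_diff_le degree_sum_le) (auto intro!: order_trans[OF degree_smult_le] deg)
  have eval: "poly (lagrange_basis r i) y = (\<Prod>j\<in>{..r} - {i}. (y - real j) / (real i - real j))" for i y
    unfolding lagrange_basis_def poly_prod by (intro prod.cong refl) (simp add: diff_divide_distrib)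
  have val: "poly (lagrange_basis r i) (real k) = (if k = i then 1 else 0)" if "i \<le> r" "k \<le> r" for i k
  proof (cases "k = i")
    case True
    then show ?thesis unfolding eval by (auto intro!: prod.neutral)
  next
    case False
    then have "k \<in> {..r} - {i}" using that by simp
    then have "(\<Prod>j\<in>{..r} - {i}. (real k - real j) / (real i - real j)) = 0"
      by (intro prod_zero) auto
    then show ?thesis using False by (simp add: eval)
  qed
  have "poly p (real k) = 0" if "k \<le> r" for k
  proof -
    have "(\<Sum>i\<le>r. poly q (real i) * poly (lagrange_basis r i) (real k))
        = (\<Sum>i\<le>r. if k = i then poly q (real i) else 0)"
      using that by (intro sum.cong) (auto simp: val)
    then show ?thesis using that by (simp add: p_def poly_sum)
  qed
  then have sub: "real ` {..r} \<subseteq> {x. poly p x = 0}" by auto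
  have "p = 0"
  proof (rule ccontr)
    assume "p \<noteq> 0"
    then have "card (real ` {..r}) \<le> card {x. poly p x = 0}"
      by (intro card_mono sub poly_roots_finite)
    also have "\<dots> \<le> degree p" by (rule card_poly_roots_bound) fact
    finally show False using \<open>degree p \<le> r\<close> by (simp add: card_image)
  qed
  then show ?thesis by (simp add: p_def)
qed

text \<open>The interval is open, so that products of this law live on open boxes;
  \<open>distr_unif_prod\<close> identifies their images on such boxes.\<close>

definition unif01 :: "real measure" where
  "unif01 = density lborel (\<lambda>x. ennreal (indicator {0<..<1} x))"

lemma sets_unif01 [measurable_cong, simp]: "sets unif01 = sets borel"
  by (simp add: unif01_def)

lemma space_unif01 [simp]: "space unif01 = UNIV"
  by (simp add: unif01_def)

lemma emeasure_unif01: "A \<in> sets borel \<Longrightarrow> emeasure unif01 A = emeasure lborel ({0<..<1} \<inter> A)"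
  unfolding unif01_def
  by (subst emeasure_density) (auto simp: ennreal_indicator indicator_inter_arith[symmetric])

lemma prob_space_unif01: "prob_space unif01"
  by (rule prob_spaceI) (simp add: emeasure_unif01)

lemma AE_unif01: "AE v in unif01. v \<in> {0<..<1}"
  unfolding unif01_def by (subst AE_density) (auto simp: indicator_def)

lemma integral_unif01_poly:
  fixes p q :: "real poly"
  assumes "pderiv q = p"
  shows "(\<integral>v. poly p (c + v) \<partial>unif01) = poly q (c + 1) - poly q c"
proof -
  have [measurable]: "(\<lambda>v. poly p (c + v)) \<in> borel_measurable borel"
    by (intro borel_measurable_continuous_onI continuous_intros)
  have "(\<integral>v. poly p (c + v) \<partial>unif01) = (\<integral>v. indicator {0<..<1} v *\<^sub>R poly p (c + v) \<partial>lborel)"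
    unfolding unif01_def
    by (rule integral_density) auto
  also have "\<dots> = (\<integral>v. poly p (c + v) * indicator {0..1} v \<partial>lborel)"
  proof (rule integral_cong_AE)
    have "AE v in lborel. v \<noteq> (0 :: real)" "AE v in lborel. v \<noteq> (1 :: real)"
      by (rule AE_lborel_singleton)+
    then show "AE v in lborel. indicator {0<..<1} v *\<^sub>R poly p (c + v) = poly p (c + v) * indicator {0..1} v"
      by eventually_elim (auto simp: indicator_def)
  qed measurable
  also have "\<dots> = poly q (c + 1) - poly q (c + 0)"
    by (rule integral_FTC_Icc_real)
      (auto simp: assms[symmetric] intro!: derivative_eq_intros poly_DERIV continuous_intros)
  finally show ?thesis by simp
qed

text \<open>A polynomial \<open>p\<close> of degree less than \<open>r\<close> is the derivative of some \<open>q\<close> of degree at most \<open>r\<close>,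
  whose values at \<open>0, \<dots>, r\<close> are partial sums of the averages of \<open>p\<close>; differentiate the Lagrange
  interpolation of \<open>q\<close>.\<close>

lemma ex_average_reconstruction:
  "\<exists>(lam :: nat \<Rightarrow> real \<Rightarrow> real) \<Lambda>. 1 \<le> \<Lambda> \<and> (\<forall>l. \<forall>z\<in>{0..real r}. \<bar>lam l z\<bar> \<le> \<Lambda>) \<and>
     (\<forall>p z. degree p < r \<longrightarrow> poly p z = (\<Sum>l<r. lam l z * (\<integral>v. poly p (real l + v) \<partial>unif01)))"
proof -
  \<comment> \<open>Exchange of summation: the l-th average is part of the value of \<open>q\<close>
    at every node \<open>i > l\<close>, so its coefficient collects the derivatives of the basis
    polynomials of exactly those nodes.\<close>
  define lam where "lam l z = (\<Sum>i\<in>{i. l < i \<and> i \<le> r}. poly (pderiv (lagrange_basis r i)) z)" for l z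
  have "\<exists>B. \<forall>z\<in>{0..real r}. \<bar>lam l z\<bar> \<le> B" for l
  proof -
    have "continuous_on {0..real r} (lam l)" unfolding lam_def by (intro continuous_intros)
    then have "bounded (lam l ` {0..real r})"
      by (intro compact_imp_bounded compact_continuous_image) auto
    then show ?thesis unfolding bounded_iff by auto
  qed
  then obtain B where B: "\<And>l z. z \<in> {0..real r} \<Longrightarrow> \<bar>lam l z\<bar> \<le> B l" by metis
  define \<Lambda> where "\<Lambda> = 1 + (\<Sum>l\<le>r. \<bar>B l\<bar>)"
  have bound: "\<bar>lam l z\<bar> \<le> \<Lambda>" if "z \<in> {0..real r}" for l z
  proof (cases "l \<le> r")
    case True
    have "\<bar>lam l z\<bar> \<le> \<bar>B l\<bar>" using B[OF that, of l] by linarith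
    also have "\<dots> \<le> (\<Sum>l\<le>r. \<bar>B l\<bar>)" using True by (intro member_le_sum) auto
    finally show ?thesis by (simp add: \<Lambda>_def)
  next
    case False
    then have no_index: "{i. l < i \<and> i \<le> r} = {}" by auto
    have "lam l z = 0" unfolding lam_def no_index by simp
    then show ?thesis by (simp add: \<Lambda>_def add_nonneg_nonneg sum_nonneg)
  qed
  have reconstruct: "poly p z = (\<Sum>l<r. lam l z * (\<integral>v. poly p (real l + v) \<partial>unif01))" if "degree p < r" for p z
  proof -
    obtain q where q: "pderiv q = p" "degree q \<le> Suc (degree p)" "poly q 0 = 0"
      using poly_antiderivative by blast
    define A where "A l = (\<integral>v. poly p (real l + v) \<partial>unif01)" for l
    have A: "A l = poly q (real (Suc l)) - poly q (real l)" for l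
      unfolding A_def integral_unif01_poly[OF q(1)] by (simp add: add.commute)
    have qA: "poly q (real i) = (\<Sum>l<i. A l)" for i
      using q(3) sum_lessThan_telescope[of "\<lambda>l. poly q (real l)" i] by (simp only: A) simp
    have "q = (\<Sum>i\<le>r. smult (poly q (real i)) (lagrange_basis r i))"
      using q(2) that by (intro lagrange_interpolation) simp
    then have "pderiv q = (\<Sum>i\<le>r. smult (poly q (real i)) (pderiv (lagrange_basis r i)))"
      by (subst (asm) (2) refl, metis (no_types, lifting) higher_pderiv_sum[of 1, simplified] pderiv_smult sum.cong)
    then have "poly p z = (\<Sum>i\<le>r. (\<Sum>l<i. A l) * poly (pderiv (lagrange_basis r i)) z)"
      unfolding q(1) by (simp add: poly_sum qA)
    also have "\<dots> = (\<Sum>i\<le>r. \<Sum>l<r. of_bool (l < i) * (A l * poly (pderiv (lagrange_basis r i)) z))"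
    proof (rule sum.cong[OF refl])
      fix i assume "i \<in> {..r}"
      then have "{..<i} = {..<r} \<inter> {l. l < i}" by auto
      then show "(\<Sum>l<i. A l) * poly (pderiv (lagrange_basis r i)) z
          = (\<Sum>l<r. of_bool (l < i) * (A l * poly (pderiv (lagrange_basis r i)) z))"
        by (simp add: sum_distrib_right)
    qed
    also have "\<dots> = (\<Sum>l<r. \<Sum>i\<le>r. of_bool (l < i) * (A l * poly (pderiv (lagrange_basis r i)) z))"
      by (rule sum.swap)
    also have "\<dots> = (\<Sum>l<r. lam l z * A l)"
    proof (rule sum.cong[OF refl])
      fix l
      have "{i. l < i \<and> i \<le> r} = {..r} \<inter> {i. l < i}" by auto
      then show "(\<Sum>i\<le>r. of_bool (l < i) * (A l * poly (pderiv (lagrange_basis r i)) z)) = lam l z * A l"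
        by (simp add: lam_def sum_distrib_left sum_distrib_right mult.commute)
    qed
    finally show ?thesis by (simp add: A_def)
  qed
  show ?thesis
  proof (intro exI[of _ lam] exI[of _ \<Lambda>] conjI allI ballI impI)
    show "1 \<le> \<Lambda>" by (simp add: \<Lambda>_def sum_nonneg)
  qed (fact bound, fact reconstruct)
qed

text \<open>A Taylor estimate with polynomials built by integration: approximate the derivative,
  take an antiderivative that agrees with the function at \<open>a\<close>, and apply the mean value
  inequality. Each derivative costs a factor \<open>b - a\<close>; factorials are given
  away.\<close>

lemma ex_poly_approximation:
  fixes F :: "nat \<Rightarrow> real \<Rightarrow> real"
  assumes "a \<le> b" "0 \<le> E"
    and "\<And>j t. j < k \<Longrightarrow> t \<in> {a..b} \<Longrightarrow> (F j has_real_derivative F (Suc j) t) (at t within {a..b})"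
    and "\<And>t. t \<in> {a..b} \<Longrightarrow> \<bar>F k t - F k a\<bar> \<le> E"
  shows "\<exists>p. degree p \<le> k \<and> (\<forall>t\<in>{a..b}. \<bar>F 0 t - poly p t\<bar> \<le> E * (b - a) ^ k)"
  using assms(3,4)
proof (induction k arbitrary: F)
  case 0
  then show ?case by (intro exI[of _ "[:F 0 a:]"]) auto
next
  case (Suc k)
  have "\<exists>p. degree p \<le> k \<and> (\<forall>t\<in>{a..b}. \<bar>F (Suc 0) t - poly p t\<bar> \<le> E * (b - a) ^ k)"
    by (rule Suc.IH[of "\<lambda>j. F (Suc j)"]) (use Suc.prems in auto)
  then obtain p where p: "degree p \<le> k" "\<And>t. t \<in> {a..b} \<Longrightarrow> \<bar>F 1 t - poly p t\<bar> \<le> E * (b - a) ^ k"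
    by auto
  obtain q where q: "pderiv q = p" "degree q \<le> Suc (degree p)"
    using poly_antiderivative by blast
  define q' where "q' = q + [:F 0 a - poly q a:]"
  have "degree q' \<le> Suc k"
    unfolding q'_def using q(2) p(1) by (intro degree_add_le) auto
  moreover have "\<bar>F 0 t - poly q' t\<bar> \<le> E * (b - a) ^ Suc k" if t: "t \<in> {a..b}" for t
  proof -
    have "norm ((\<lambda>t. F 0 t - poly q' t) t - (\<lambda>t. F 0 t - poly q' t) a) \<le> E * (b - a) ^ k * norm (t - a)"
    proof (rule field_differentiable_bound[where S = "{a..b}" and f' = "\<lambda>t. F 1 t - poly p t"])
      show "((\<lambda>t. F 0 t - poly q' t) has_real_derivative F 1 z - poly p z) (at z within {a..b})"
        if "z \<in> {a..b}" for z
        using Suc.prems(1)[of 0 z] that q(1)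
        by (auto simp: q'_def pderiv_add intro!: derivative_eq_intros has_field_derivative_at_within[OF poly_DERIV])
    qed (use p t assms in auto)
    also have "\<dots> \<le> E * (b - a) ^ k * (b - a)"
      using t assms(1,2) by (intro mult_left_mono) auto
    finally show ?thesis by (simp add: q'_def mult_ac)
  qed
  ultimately show ?case by blast
qed

section \<open>Reconstruction of a smooth function from cell averages\<close>

definition unif_prod :: "('d \<Rightarrow> real) measure" where
  "unif_prod = PiM UNIV (\<lambda>_. unif01)"

lemma prob_space_unif_prod: "prob_space unif_prod"
  unfolding unif_prod_def by (rule prob_space_PiM) (rule prob_space_unif01)

lemma unif_prod_component [measurable]: "(\<lambda>u. u i) \<in> borel_measurable unif_prod"
  unfolding unif_prod_def
  using measurable_component_singleton[of i UNIV "\<lambda>_. unif01"] by (simp cong: measurable_cong_sets)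

lemma vec_measurable [measurable (raw)]:
  fixes f :: "'a \<Rightarrow> 'd::finite \<Rightarrow> real"
  assumes "\<And>i. (\<lambda>x. f x i) \<in> borel_measurable N"
  shows "(\<lambda>x. \<chi> i. f x i) \<in> borel_measurable N"
  using assms by (subst borel_measurable_euclidean_space) (auto simp: Basis_vec_def inner_axis)

lemma AE_unif_prod: "AE u in (unif_prod :: ('d::finite \<Rightarrow> real) measure). \<forall>i. u i \<in> {0<..<1}"
proof -
  have "AE u in (unif_prod :: ('d \<Rightarrow> real) measure). u i \<in> {0<..<1}" for i
    unfolding unif_prod_def using AE_PiM_component[of UNIV "\<lambda>_. unif01" i, OF prob_space_unif01 _ AE_unif01] by simp
  then have "AE u in (unif_prod :: ('d \<Rightarrow> real) measure). \<forall>i\<in>UNIV. u i \<in> {0<..<1}"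
    by (intro AE_finite_allI) auto
  then show ?thesis by simp
qed

lemma (in prob_space) abs_integral_le:
  fixes f :: "'a \<Rightarrow> real"
  assumes "AE x in M. \<bar>f x\<bar> \<le> H" "0 \<le> H"
  shows "\<bar>\<integral>x. f x \<partial>M\<bar> \<le> H"
proof (cases "integrable M f")
  case True
  have "(\<integral>x. f x \<partial>M) \<le> (\<integral>x. H \<partial>M)" "(\<integral>x. - H \<partial>M) \<le> (\<integral>x. f x \<partial>M)"
    by (rule integral_mono_AE; use True assms(1) in \<open>auto elim!: eventually_mono\<close>)+
  then show ?thesis by (simp add: prob_space)
next
  \<comment> \<open>The integral of a non-integrable function is 0 by default, so the bound
    persists.\<close>
  case False
  then show ?thesis using assms(2) by (simp add: not_integrable_integral_eq)
qed

definition cell_point :: "real ^ 'd \<Rightarrow> real \<Rightarrow> ('d \<Rightarrow> nat) \<Rightarrow> ('d \<Rightarrow> real) \<Rightarrow> real ^ 'd" where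
  "cell_point o' \<delta> j u = (\<chi> i. o' $ i + \<delta> * (real (j i) + u i))"

text \<open>\<open>G I\<close> interpolates between the value at \<open>x\<close> and the cell
  averages: the coordinates in \<open>I\<close> have been replaced by their one-dimensional
  reconstruction, the others still sit at \<open>x\<close>. Thus \<open>G {}\<close> is the value at
  \<open>x\<close> and \<open>G UNIV\<close> a combination of averages over whole cells, and moving
  one coordinate into \<open>I\<close> costs at most \<open>H\<close> times the total weight
  accumulated so far.\<close>

lemma tensor_reconstruction:
  fixes \<phi> :: "real ^ 'd \<Rightarrow> real" and lam :: "nat \<Rightarrow> real \<Rightarrow> real"
  assumes meas: "\<phi> \<in> borel_measurable borel" and bdd: "\<And>x. \<bar>\<phi> x\<bar> \<le> K"
    and lam: "1 \<le> \<Lambda>" "\<And>l z. z \<in> {0..real r} \<Longrightarrow> \<bar>lam l z\<bar> \<le> \<Lambda>" and r: "1 \<le> r" and H: "0 \<le> H"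
    and \<delta>: "0 < \<delta>" and origin: "\<And>i. 0 \<le> o' $ i" "\<And>i. o' $ i + \<delta> * real r \<le> 1"
    and sec: "\<And>y i z. y \<in> unit_cube \<Longrightarrow> z \<in> {0..real r} \<Longrightarrow>
      \<bar>\<phi> (coord_upd y i (o' $ i + \<delta> * z))
        - (\<Sum>l<r. lam l z * (\<integral>v. \<phi> (coord_upd y i (o' $ i + \<delta> * (real l + v))) \<partial>unif01))\<bar> \<le> H"
    and x: "\<And>i. o' $ i \<le> x $ i" "\<And>i. x $ i \<le> o' $ i + \<delta> * real r"
  shows "\<bar>\<phi> x\<bar> \<le> \<Lambda> ^ CARD('d) * (\<Sum>j\<in>PiE UNIV (\<lambda>_. {..<r}). \<bar>\<integral>u. \<phi> (cell_point o' \<delta> j u) \<partial>unif_prod\<bar>)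
    + real CARD('d) * (real r * \<Lambda>) ^ CARD('d) * H"
proof -
  interpret N: prob_space "unif_prod :: ('d \<Rightarrow> real) measure" by (rule prob_space_unif_prod)
  interpret V: prob_space unif01 by (rule prob_space_unif01)
  define z where "z i = (x $ i - o' $ i) / \<delta>" for i
  have z: "z i \<in> {0..real r}" "o' $ i + \<delta> * z i = x $ i" for i
    using x[of i] \<delta> by (auto simp: z_def field_simps)
  define mix where "mix I j u = (\<chi> i. if i \<in> I then o' $ i + \<delta> * (real (j i) + u i) else x $ i)"
    for I :: "'d set" and j u
  define c where "c I j = (\<Prod>i\<in>I. lam (j i) (z i))" for I :: "'d set" and j
  define J where "J I = PiE I (\<lambda>_. {..<r})" for I :: "'d set"
  define G where "G I = (\<Sum>j\<in>J I. c I j * (\<integral>u. \<phi> (mix I j u) \<partial>unif_prod))" for I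
  define W where "W = real r * \<Lambda>"
  have W: "1 \<le> W" unfolding W_def using r lam(1) mult_mono[of 1 "real r" 1 \<Lambda>] by simp
  have mix_meas [measurable]: "(\<lambda>u. mix I j u) \<in> borel_measurable unif_prod" for I j
    unfolding mix_def by (rule vec_measurable) (auto simp: if_distrib)
  have coord_upd_mix: "coord_upd (mix I j u) i t = (\<chi> k. if k = i then t else mix I j u $ k)" for I j u i t
    by (simp add: coord_upd_def)
  have c_bound: "\<bar>c I j\<bar> \<le> \<Lambda> ^ card I" for I j
  proof -
    have "\<bar>c I j\<bar> = (\<Prod>i\<in>I. \<bar>lam (j i) (z i)\<bar>)" by (simp add: c_def abs_prod)
    also have "\<dots> \<le> (\<Prod>i\<in>I. \<Lambda>)" using lam(2) z by (intro prod_mono) auto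
    finally show ?thesis by simp
  qed
  have cardJ: "real (card (J I)) = real r ^ card I" for I
    by (simp add: J_def card_PiE)
  have cube: "mix I j u \<in> unit_cube" if j: "j \<in> J I" and u: "\<forall>i. u i \<in> {0<..<1}" for I j u
  proof -
    have "0 \<le> mix I j u $ i \<and> mix I j u $ i \<le> 1" for i
    proof (cases "i \<in> I")
      case True
      then have "j i < r" using j by (auto simp: J_def)
      then have le: "real (j i) + u i \<le> real r"
        using u[rule_format, of i] by (auto simp: Suc_le_eq[symmetric] simp del: of_nat_Suc dest: of_nat_mono[where 'a = real])
      have "0 \<le> u i" using u[rule_format, of i] by simp
      then have "0 \<le> \<delta> * (real (j i) + u i)" using \<delta> by (intro mult_nonneg_nonneg) auto
      moreover have "\<delta> * (real (j i) + u i) \<le> \<delta> * real r" using \<delta> le by (intro mult_left_mono) auto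
      ultimately show ?thesis using True origin(1)[of i] origin(2)[of i] by (simp add: mix_def)
    next
      case False
      then show ?thesis using x[of i] origin(1)[of i] origin(2)[of i] by (auto simp: mix_def)
    qed
    then show ?thesis by (simp add: mem_box_cart)
  qed
  \<comment> \<open>There are \<open>r ^ card I\<close> weights, each at most
    \<open>\<Lambda> ^ card I\<close> in modulus, hence the power of \<open>W\<close>.\<close>
  have step: "\<bar>G I - G (insert i I)\<bar> \<le> W ^ card I * H" if i: "i \<notin> I" for I i
  proof -
    have "G (insert i I) = (\<Sum>j\<in>J I. \<Sum>l<r. c (insert i I) (j(i := l)) * (\<integral>u. \<phi> (mix (insert i I) (j(i := l)) u) \<partial>unif_prod))"
    proof -
      have J_insert: "J (insert i I) = (\<lambda>(l, j). j(i := l)) ` ({..<r} \<times> J I)"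
        by (simp add: J_def PiE_insert_eq)
      have inj: "inj_on (\<lambda>(l, j). j(i := l)) ({..<r} \<times> J I)"
        unfolding J_def using i by (rule inj_combinator)
      have "G (insert i I) = (\<Sum>(l, j)\<in>{..<r} \<times> J I.
          c (insert i I) (j(i := l)) * (\<integral>u. \<phi> (mix (insert i I) (j(i := l)) u) \<partial>unif_prod))"
        unfolding G_def J_insert sum.reindex[OF inj] by (simp add: case_prod_beta')
      then show ?thesis
        by (simp add: sum.cartesian_product[symmetric] sum.swap[of _ "J I" "{..<r}"])
    qed
    also have "\<dots> = (\<Sum>j\<in>J I. c I j * (\<Sum>l<r. lam l (z i) *
        (\<integral>u. \<phi> (coord_upd (mix I j u) i (o' $ i + \<delta> * (real l + u i))) \<partial>unif_prod)))"
    proof (rule sum.cong[OF refl])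
      fix j
      have "c (insert i I) (j(i := l)) = c I j * lam l (z i)" for l
      proof -
        have "(\<Prod>k\<in>I. lam ((j(i := l)) k) (z k)) = (\<Prod>k\<in>I. lam (j k) (z k))"
          using i by (intro prod.cong) auto
        then show ?thesis using i by (simp add: c_def mult.commute)
      qed
      moreover have "mix (insert i I) (j(i := l)) u = coord_upd (mix I j u) i (o' $ i + \<delta> * (real l + u i))" for l u
        by (auto simp: mix_def coord_upd_def vec_eq_iff)
      ultimately show "(\<Sum>l<r. c (insert i I) (j(i := l)) * (\<integral>u. \<phi> (mix (insert i I) (j(i := l)) u) \<partial>unif_prod))
        = c I j * (\<Sum>l<r. lam l (z i) * (\<integral>u. \<phi> (coord_upd (mix I j u) i (o' $ i + \<delta> * (real l + u i))) \<partial>unif_prod))"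
        by (simp add: sum_distrib_left mult_ac)
    qed
    finally have Gi: "G (insert i I) = (\<Sum>j\<in>J I. c I j * (\<Sum>l<r. lam l (z i) *
        (\<integral>u. \<phi> (coord_upd (mix I j u) i (o' $ i + \<delta> * (real l + u i))) \<partial>unif_prod)))" .
    have inner: "\<bar>(\<integral>u. \<phi> (mix I j u) \<partial>unif_prod) - (\<Sum>l<r. lam l (z i) *
        (\<integral>u. \<phi> (coord_upd (mix I j u) i (o' $ i + \<delta> * (real l + u i))) \<partial>unif_prod))\<bar> \<le> H"
      if j: "j \<in> J I" for j
    proof -
      define \<psi> where "\<psi> l u = \<phi> (coord_upd (mix I j u) i (o' $ i + \<delta> * (real l + u i)))" for l u
      define \<Psi> where "\<Psi> u = \<phi> (mix I j u) - (\<Sum>l<r. lam l (z i) * \<psi> l u)" for u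
      have int: "integrable unif_prod f" if "f \<in> borel_measurable unif_prod" "\<And>u. \<bar>f u\<bar> \<le> K"
        for f :: "('d \<Rightarrow> real) \<Rightarrow> real"
        by (rule N.integrable_const_bound[where B = K]) (use that in auto)
      have int0: "integrable unif_prod (\<lambda>u. \<phi> (mix I j u))"
        by (rule int) (use meas bdd in auto)
      have int1: "integrable unif_prod (\<psi> l)" for l
      proof (rule int)
        have "(\<lambda>u. coord_upd (mix I j u) i (o' $ i + \<delta> * (real l + u i))) \<in> borel_measurable unif_prod"
          unfolding coord_upd_def mix_def
        proof (rule vec_measurable)
          fix k
          show "(\<lambda>u. if k = i then o' $ i + \<delta> * (real l + u i)
              else (\<chi> i. if i \<in> I then o' $ i + \<delta> * (real (j i) + u i) else x $ i) $ k)
            \<in> borel_measurable unif_prod"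
            by (cases "k = i"; cases "k \<in> I") simp_all
        qed
        then show "\<psi> l \<in> borel_measurable unif_prod"
          unfolding \<psi>_def using meas by (rule measurable_compose)
      qed (simp add: \<psi>_def bdd)
      have intP: "integrable unif_prod \<Psi>"
        unfolding \<Psi>_def using int0 int1 by auto
      have upd_mix: "mix I j (u(i := v)) = mix I j u" for u v
        using i by (auto simp: mix_def vec_eq_iff)
      have "(\<integral>u. \<phi> (mix I j u) \<partial>unif_prod) - (\<Sum>l<r. lam l (z i) * (\<integral>u. \<psi> l u \<partial>unif_prod))
          = (\<integral>u. \<Psi> u \<partial>unif_prod)"
        unfolding \<Psi>_def using int0 int1 by simp
      \<comment> \<open>Resampling coordinate \<open>i\<close> makes it a fresh integration
        variable, on which \<open>mix I j u\<close> does not depend. For fixed \<open>u\<close> the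
        inner integral is the one-dimensional error controlled by \<open>sec\<close> at the point
        \<open>mix I j u\<close>.\<close>
      also have "\<dots> = (\<integral>u. (\<integral>v. \<Psi> (u(i := v)) \<partial>unif01) \<partial>unif_prod)"
        unfolding unif_prod_def
        by (rule integral_PiM_resample[OF prob_space_unif01]) (use intP in \<open>auto simp: unif_prod_def\<close>)
      also have "\<bar>\<dots>\<bar> \<le> H"
      proof (rule N.abs_integral_le[OF _ H])
        show "AE u in unif_prod. \<bar>\<integral>v. \<Psi> (u(i := v)) \<partial>unif01\<bar> \<le> H"
          using AE_unif_prod
        proof eventually_elim
          case (elim u)
          have intv: "integrable unif01 (\<lambda>v. \<phi> (coord_upd (mix I j u) i (o' $ i + \<delta> * (real l + v))))" for l
          proof (rule V.integrable_const_bound[where B = K])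
            have "(\<lambda>v. coord_upd (mix I j u) i (o' $ i + \<delta> * (real l + v))) \<in> borel_measurable unif01"
              unfolding coord_upd_def
            proof (rule vec_measurable)
              fix k
              show "(\<lambda>v. if k = i then o' $ i + \<delta> * (real l + v) else mix I j u $ k)
                \<in> borel_measurable unif01"
                by (cases "k = i") (simp_all add: unif01_def)
            qed
            then show "(\<lambda>v. \<phi> (coord_upd (mix I j u) i (o' $ i + \<delta> * (real l + v)))) \<in> borel_measurable unif01"
              using meas by (rule measurable_compose)
          qed (simp add: bdd)
          have self: "coord_upd (mix I j u) i (o' $ i + \<delta> * z i) = mix I j u"
            using i by (auto simp: coord_upd_def mix_def vec_eq_iff z)
          have "(\<integral>v. \<Psi> (u(i := v)) \<partial>unif01) = \<phi> (mix I j u)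
              - (\<Sum>l<r. lam l (z i) * (\<integral>v. \<phi> (coord_upd (mix I j u) i (o' $ i + \<delta> * (real l + v))) \<partial>unif01))"
            unfolding \<Psi>_def \<psi>_def upd_mix fun_upd_same using intv V.prob_space by simp
          then show ?case
            using sec[OF cube[OF j elim] z(1), of i i] unfolding self by simp
        qed
      qed
      finally show ?thesis unfolding \<psi>_def .
    qed
    have "\<bar>G I - G (insert i I)\<bar> = \<bar>\<Sum>j\<in>J I. c I j * ((\<integral>u. \<phi> (mix I j u) \<partial>unif_prod) - (\<Sum>l<r. lam l (z i) *
        (\<integral>u. \<phi> (coord_upd (mix I j u) i (o' $ i + \<delta> * (real l + u i))) \<partial>unif_prod)))\<bar>"
      unfolding Gi by (simp add: G_def sum_subtractf[symmetric] right_diff_distrib)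
    also have "\<dots> \<le> (\<Sum>j\<in>J I. \<Lambda> ^ card I * H)"
      using c_bound inner lam(1)
      by (intro order_trans[OF sum_abs] sum_mono) (auto simp: abs_mult intro!: mult_mono)
    also have "\<dots> = W ^ card I * H"
      using cardJ[of I] by (simp add: W_def power_mult_distrib)
    finally show ?thesis .
  qed
  have "\<bar>\<phi> x - G I\<bar> \<le> real (card I) * (W ^ CARD('d) * H)" for I
    using finite[of I]
  proof (induction I rule: finite_induct)
    case empty
    have "G {} = \<phi> x" by (simp add: G_def J_def c_def mix_def N.prob_space vec_lambda_eta)
    then show ?case by simp
  next
    case (insert i I)
    have "W ^ card I \<le> W ^ CARD('d)" using W by (intro power_increasing card_mono) auto
    then have "W ^ card I * H \<le> W ^ CARD('d) * H" using H by (rule mult_right_mono)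
    then have "\<bar>\<phi> x - G (insert i I)\<bar> \<le> real (card I) * (W ^ CARD('d) * H) + W ^ CARD('d) * H"
      using insert.IH step[OF insert.hyps(2)] by linarith
    then show ?case using insert.hyps by (simp add: algebra_simps)
  qed
  from this[of UNIV] have "\<bar>\<phi> x\<bar> \<le> \<bar>G UNIV\<bar> + real CARD('d) * (W ^ CARD('d) * H)" by linarith
  also have "\<bar>G UNIV\<bar> \<le> (\<Sum>j\<in>J UNIV. \<Lambda> ^ CARD('d) * \<bar>\<integral>u. \<phi> (mix UNIV j u) \<partial>unif_prod\<bar>)"
    unfolding G_def using c_bound[of UNIV]
    by (intro order_trans[OF sum_abs] sum_mono) (auto simp: abs_mult intro!: mult_right_mono)
  also have "mix UNIV = cell_point o' \<delta>"
    by (simp add: mix_def cell_point_def fun_eq_iff)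
  finally show ?thesis
    by (simp add: J_def W_def sum_distrib_left[symmetric])
qed

section \<open>Hoelder functions\<close>

lemma coord_upd_nth [simp]: "coord_upd x i t $ k = (if k = i then t else x $ k)"
  by (simp add: coord_upd_def)

lemma coord_upd_idem [simp]: "coord_upd (coord_upd x i t) i u = coord_upd x i u"
  by (simp add: vec_eq_iff)

lemma coord_upd_in_cube: "x \<in> unit_cube \<Longrightarrow> t \<in> {0..1} \<Longrightarrow> coord_upd x i t \<in> unit_cube"
  by (auto simp: mem_box_cart)

lemma norm_coord_upd_diff: "norm (coord_upd x i t - coord_upd x i t') = \<bar>t - t'\<bar>"
proof -
  have "coord_upd x i t - coord_upd x i t' = (t - t') *\<^sub>R axis i 1"
    by (auto simp: vec_eq_iff axis_def)
  then show ?thesis by simp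
qed

lemma iter_partial_section:
  assumes "has_partials_upto k f" "x \<in> unit_cube" "t \<in> {0..1}" "j < k"
  shows "((\<lambda>u. iter_partial (replicate j i) f (coord_upd x i u)) has_real_derivative
    iter_partial (replicate (Suc j) i) f (coord_upd x i t)) (at t within {0..1})"
proof -
  let ?g = "iter_partial (replicate j i) f"
  have "coord_upd x i t \<in> unit_cube" by (rule coord_upd_in_cube) fact+
  then have "has_partial i ?g (coord_upd x i t)"
    using assms(1,4) unfolding has_partials_upto_def by auto
  then have "(\<lambda>u. ?g (coord_upd x i u)) differentiable (at t within {0..1})"
    by (simp add: has_partial_def)
  then have "((\<lambda>u. ?g (coord_upd x i u)) has_vector_derivative
      vector_derivative (\<lambda>u. ?g (coord_upd x i u)) (at t within {0..1})) (at t within {0..1})"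
    by (simp add: vector_derivative_works)
  then show ?thesis
    by (simp add: has_real_derivative_iff_has_vector_derivative partial_def)
qed

text \<open>On a line in direction \<open>i\<close> the iterated partials are ordinary derivatives.
  The top one oscillates by at most \<open>L * (b - a) powr (s - \<lfloor>s\<rfloor>)\<close> over
  the interval, and the \<lfloor>s\<rfloor> integrations in \<open>ex_poly_approximation\<close>
  supply the remaining power.\<close>

lemma holder_section_poly:
  fixes f :: "real ^ 'd \<Rightarrow> real"
  assumes s: "0 < s" and L: "0 \<le> L" and f: "f \<in> holder_class s L" and x: "x \<in> unit_cube"
    and ab: "0 \<le> a" "a < b" "b \<le> 1"
  shows "\<exists>p. degree p \<le> nat \<lfloor>s\<rfloor> \<and> (\<forall>t\<in>{a..b}. \<bar>f (coord_upd x i t) - poly p t\<bar> \<le> L * (b - a) powr s)"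
proof -
  define k where "k = nat \<lfloor>s\<rfloor>"
  define F where "F j t = iter_partial (replicate j i) f (coord_upd x i t)" for j t
  define E where "E = L * (b - a) powr (s - of_int \<lfloor>s\<rfloor>)"
  have E: "0 \<le> E" using L by (simp add: E_def)
  have k: "real k = of_int \<lfloor>s\<rfloor>" using s by (simp add: k_def)
  have hp: "has_partials_upto k f" using f by (simp add: holder_class_def k_def)
  have der: "(F j has_real_derivative F (Suc j) t) (at t within {a..b})" if "j < k" "t \<in> {a..b}" for j t
    unfolding F_def
    by (rule DERIV_subset[OF iter_partial_section[OF hp x _ that(1)]]) (use that ab in auto)
  have top: "\<bar>F k t - F k a\<bar> \<le> E" if t: "t \<in> {a..b}" for t
  proof -
    have "coord_upd x i t \<in> unit_cube" "coord_upd x i a \<in> unit_cube"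
      using t ab x by (auto intro!: coord_upd_in_cube)
    then have "\<bar>F k t - F k a\<bar> \<le> L * norm (coord_upd x i t - coord_upd x i a) powr (s - of_int \<lfloor>s\<rfloor>)"
      using f unfolding holder_class_def F_def k_def by auto
    also have "\<dots> = L * \<bar>t - a\<bar> powr (s - of_int \<lfloor>s\<rfloor>)"
      by (simp only: norm_coord_upd_diff)
    also have "\<dots> \<le> E"
      unfolding E_def using t L by (intro mult_left_mono powr_mono2) auto
    finally show ?thesis .
  qed
  have "E * (b - a) ^ k = L * ((b - a) powr (s - of_int \<lfloor>s\<rfloor>) * (b - a) powr real k)"
    unfolding E_def using ab by (simp add: powr_realpow)
  also have "\<dots> = L * (b - a) powr s"
    unfolding powr_add[symmetric] k by simp
  finally have E_eq: "E * (b - a) ^ k = L * (b - a) powr s" .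
  have "\<exists>p. degree p \<le> k \<and> (\<forall>t\<in>{a..b}. \<bar>F 0 t - poly p t\<bar> \<le> E * (b - a) ^ k)"
    by (rule ex_poly_approximation) (use ab E der top in auto)
  then show ?thesis unfolding E_eq by (simp add: F_def k_def)
qed

text \<open>For \<open>s < 1\<close> this is the Hoelder condition itself. For
  \<open>s \<ge> 1\<close> the first partials are bounded by \<open>L\<close> and the mean value
  inequality gives a Lipschitz bound; the exponent \<open>min s 1\<close> covers both.\<close>

lemma holder_coord_modulus:
  fixes f :: "real ^ 'd \<Rightarrow> real"
  assumes s: "0 < s" and f: "f \<in> holder_class s L" and x: "x \<in> unit_cube"
    and t: "t \<in> {0..1}" "t' \<in> {0..1}"
  shows "\<bar>f (coord_upd x i t) - f (coord_upd x i t')\<bar> \<le> L * \<bar>t - t'\<bar> powr (min s 1)"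
proof (cases "s < 1")
  case True
  then have "\<lfloor>s\<rfloor> = 0" using s by linarith
  then have "\<forall>x\<in>unit_cube. \<forall>x'\<in>unit_cube. \<bar>f x - f x'\<bar> \<le> L * norm (x - x') powr s"
    using f by (simp add: holder_class_def)
  then have "\<bar>f (coord_upd x i t) - f (coord_upd x i t')\<bar>
      \<le> L * norm (coord_upd x i t - coord_upd x i t') powr s"
    using coord_upd_in_cube[OF x] t by blast
  then show ?thesis using True by (simp only: norm_coord_upd_diff min_def) simp
next
  case False
  then have k: "1 \<le> nat \<lfloor>s\<rfloor>" by (simp add: le_nat_iff le_floor_iff)
  have "norm (f (coord_upd x i t) - f (coord_upd x i t')) \<le> L * norm (t - t')"
  proof (rule field_differentiable_bound[where S = "{0..1}" and f = "\<lambda>u. f (coord_upd x i u)"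
        and f' = "\<lambda>u. iter_partial [i] f (coord_upd x i u)"])
    fix u :: real assume u: "u \<in> {0..1}"
    show "((\<lambda>u. f (coord_upd x i u)) has_real_derivative iter_partial [i] f (coord_upd x i u)) (at u within {0..1})"
    proof -
      have hp: "has_partials_upto (nat \<lfloor>s\<rfloor>) f" using f by (simp add: holder_class_def)
      have "0 < nat \<lfloor>s\<rfloor>" using k by linarith
      from iter_partial_section[OF hp x u this, of i] show ?thesis by simp
    qed
    have "length [i] \<in> {1..nat \<lfloor>s\<rfloor>}" using k by simp
    then show "norm (iter_partial [i] f (coord_upd x i u)) \<le> L"
      using f coord_upd_in_cube[OF x u] unfolding holder_class_def by fastforce
  qed (use t in auto)
  then show ?thesis using False by (cases "t = t'") (auto simp: min_def)
qed

text \<open>The class speaks of coordinate derivatives, which alone do not give joint continuity;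
  the bound uniform in the base point does, by passing from \<open>x\<close> to \<open>y\<close> one
  coordinate at a time inside the cube.\<close>

lemma holder_modulus:
  fixes f :: "real ^ 'd \<Rightarrow> real"
  assumes s: "0 < s" and f: "f \<in> holder_class s L" and xy: "x \<in> unit_cube" "y \<in> unit_cube"
  shows "\<bar>f x - f y\<bar> \<le> L * (\<Sum>i\<in>UNIV. \<bar>x $ i - y $ i\<bar> powr (min s 1))"
proof -
  define mix where "mix I = (\<chi> i. if i \<in> I then y $ i else x $ i)" for I
  have cube: "mix I \<in> unit_cube" for I
    using xy by (auto simp: mix_def mem_box_cart)
  have "\<bar>f x - f (mix I)\<bar> \<le> L * (\<Sum>i\<in>I. \<bar>x $ i - y $ i\<bar> powr (min s 1))" for I
    using finite[of I]
  proof (induction I rule: finite_induct)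
    case empty
    then show ?case by (simp add: mix_def vec_lambda_eta)
  next
    case (insert i I)
    have "coord_upd (mix I) i (x $ i) = mix I" "coord_upd (mix I) i (y $ i) = mix (insert i I)"
      using insert.hyps by (auto simp: vec_eq_iff mix_def)
    moreover have "x $ i \<in> {0..1}" "y $ i \<in> {0..1}" using xy by (auto simp: mem_box_cart)
    ultimately have "\<bar>f (mix I) - f (mix (insert i I))\<bar> \<le> L * \<bar>x $ i - y $ i\<bar> powr (min s 1)"
      using holder_coord_modulus[OF s f cube, of "x $ i" "y $ i" I i] by simp
    then show ?case using insert by (simp add: distrib_left)
  qed
  from this[of UNIV] show ?thesis by (simp add: mix_def vec_lambda_eta)
qed

lemma holder_continuous_on:
  fixes f :: "real ^ 'd \<Rightarrow> real"
  assumes "0 < s" "f \<in> holder_class s L"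
  shows "continuous_on unit_cube f"
  unfolding continuous_on_def
proof
  fix x :: "real ^ 'd" assume x: "x \<in> unit_cube"
  have "((\<lambda>y. L * (\<Sum>i\<in>UNIV. \<bar>y $ i - x $ i\<bar> powr (min s 1))) \<longlongrightarrow> L * (\<Sum>i\<in>(UNIV :: 'd set). 0)) (at x within unit_cube)"
  proof (intro tendsto_mult tendsto_const tendsto_sum tendsto_zero_powrI[where b = "min s 1"])
    fix i
    have "((\<lambda>y. \<bar>y $ i - x $ i\<bar>) \<longlongrightarrow> \<bar>x $ i - x $ i\<bar>) (at x within unit_cube)"
      by (intro tendsto_intros)
    then show "((\<lambda>y. \<bar>y $ i - x $ i\<bar>) \<longlongrightarrow> 0) (at x within unit_cube)" by simp
  qed (use assms(1) in auto)
  then have "((\<lambda>y. L * (\<Sum>i\<in>UNIV. \<bar>y $ i - x $ i\<bar> powr (min s 1))) \<longlongrightarrow> 0) (at x within unit_cube)"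
    by simp
  then have "((\<lambda>y. f y - f x) \<longlongrightarrow> 0) (at x within unit_cube)"
    by (rule Lim_null_comparison[rotated])
      (use holder_modulus[OF assms _ x] in \<open>auto simp: eventually_at_filter\<close>)
  then show "(f \<longlongrightarrow> f x) (at x within unit_cube)"
    by (rule LIM_zero_cancel)
qed

text \<open>Members of \<open>holder_class\<close> are constrained on the cube only. Extension by
  zero turns them into Borel functions bounded on the whole space.\<close>

definition on_cube :: "(real ^ 'd \<Rightarrow> real) \<Rightarrow> real ^ 'd \<Rightarrow> real" where
  "on_cube f x = indicator unit_cube x * f x"

lemma on_cube_eq [simp]: "x \<in> unit_cube \<Longrightarrow> on_cube f x = f x"
  by (simp add: on_cube_def)

lemma on_cube_measurable:
  assumes "continuous_on unit_cube f"
  shows "on_cube f \<in> borel_measurable borel"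
  using borel_measurable_continuous_on_indicator[OF _ assms] by (simp add: on_cube_def[abs_def])

lemma on_cube_bounded:
  assumes "continuous_on unit_cube f"
  shows "\<exists>K. \<forall>x. \<bar>on_cube f x\<bar> \<le> K"
proof -
  have "bounded (f ` unit_cube)"
    by (intro compact_imp_bounded compact_continuous_image assms compact_cbox)
  then obtain K where K: "\<And>x. x \<in> unit_cube \<Longrightarrow> \<bar>f x\<bar> \<le> K"
    unfolding bounded_iff by auto
  have "\<bar>on_cube f x\<bar> \<le> \<bar>K\<bar>" for x
    using K[of x] by (cases "x \<in> unit_cube") (auto simp: on_cube_def)
  then show ?thesis by blast
qed

lemma on_cube_integrable:
  assumes "continuous_on unit_cube f" "A \<in> sets borel"
  shows "integrable lborel (\<lambda>x. indicator A x * on_cube f x)"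
proof -
  obtain K where K: "\<And>x. \<bar>on_cube f x\<bar> \<le> K" using on_cube_bounded[OF assms(1)] by blast
  have "integrable lborel (\<lambda>x. indicator unit_cube x * K :: real)"
    by (intro integrable_mult_left integrable_real_indicator) (auto simp: emeasure_lborel_cbox_eq)
  then show ?thesis
  proof (rule Bochner_Integration.integrable_bound)
    show "(\<lambda>x. indicator A x * on_cube f x) \<in> borel_measurable lborel"
      using on_cube_measurable[OF assms(1)] assms(2) by measurable
    have "\<bar>indicator A x * on_cube f x\<bar> \<le> \<bar>indicator unit_cube x * K\<bar>" for x
      using K[of x] by (cases "x \<in> unit_cube") (auto simp: on_cube_def indicator_def)
    then show "AE x in lborel. norm (indicator A x * on_cube f x) \<le> norm (indicator unit_cube x * K)"
      by simp
  qed
qed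

section \<open>Cells\<close>

lemma prod_Basis_vec: "(\<Prod>b\<in>(Basis :: (real ^ 'd) set). F b) = (\<Prod>i\<in>UNIV. F (axis i 1))"
proof -
  have B: "(Basis :: (real ^ 'd) set) = range (\<lambda>i. axis i 1)" by (auto simp: Basis_vec_def)
  have inj: "inj (\<lambda>i :: 'd. axis i (1 :: real))" by (auto simp: inj_def axis_eq_axis)
  show ?thesis unfolding B prod.reindex[OF inj] by (simp only: o_def)
qed

lemma emeasure_lborel_box_vec:
  fixes l u :: "real ^ 'd"
  shows "emeasure lborel (box l u) = ennreal (\<Prod>i\<in>UNIV. max 0 (u $ i - l $ i))"
proof (cases "\<forall>i. l $ i \<le> u $ i")
  case True
  then have "\<forall>b\<in>Basis. l \<bullet> b \<le> u \<bullet> b" by (auto simp: Basis_vec_def inner_axis)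
  then have "emeasure lborel (box l u) = ennreal (\<Prod>b\<in>Basis. (u - l) \<bullet> b)"
    by (simp add: emeasure_lborel_box_eq)
  also have "(\<Prod>b\<in>Basis. (u - l) \<bullet> b) = (\<Prod>i\<in>UNIV. max 0 (u $ i - l $ i))"
    using True by (simp add: prod_Basis_vec inner_axis)
  finally show ?thesis .
next
  case False
  then obtain i where i: "u $ i < l $ i" by (auto simp: not_le)
  then have "\<not> (\<forall>b\<in>Basis. l \<bullet> b \<le> u \<bullet> b)"
    by (intro notI) (drule bspec[of _ _ "axis i 1"], auto simp: inner_axis)
  moreover have "(\<Prod>i\<in>UNIV. max 0 (u $ i - l $ i)) = 0"
    using i by (intro prod_zero bexI[of _ i]) auto
  ultimately show ?thesis unfolding emeasure_lborel_box_eq by (simp only: if_False ennreal_0)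
qed

lemma measure_unit_cube: "measure lborel (unit_cube :: (real ^ 'd) set) = 1"
proof -
  have "emeasure lborel (unit_cube :: (real ^ 'd) set) = ennreal (\<Prod>b\<in>Basis. (1 - 0 :: real ^ 'd) \<bullet> b)"
    by (rule emeasure_lborel_cbox) (auto simp: Basis_vec_def inner_axis)
  then show ?thesis by (simp add: measure_def prod_Basis_vec inner_axis)
qed

text \<open>Open cubes, because boxes form an intersection stable generator of the Borel sets.\<close>

lemma distr_unif_prod:
  fixes a :: "real ^ 'd"
  assumes \<delta>: "0 < \<delta>"
  shows "distr unif_prod borel (\<lambda>u. \<chi> i. a $ i + \<delta> * u i)
    = density lborel (\<lambda>x. ennreal ((1 / \<delta>) ^ CARD('d) * indicator (box a (a + (\<chi> i. \<delta>))) x))"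
    (is "?L = ?R")
proof (rule measure_eqI_generator_eq)
  interpret N: prob_space "unif_prod :: ('d \<Rightarrow> real) measure" by (rule prob_space_unif_prod)
  let ?E = "range (\<lambda>(a, b). box a b :: (real ^ 'd) set)"
  let ?T = "\<lambda>u. \<chi> i. a $ i + \<delta> * u i"
  have T [measurable]: "?T \<in> borel_measurable unif_prod"
    by (rule vec_measurable) auto
  interpret L: prob_space ?L by (rule N.prob_space_distr) (rule T)
  show "Int_stable ?E" by (auto simp: Int_stable_def box_Int_box)
  show "?E \<subseteq> Pow UNIV" "sets ?L = sigma_sets UNIV ?E" "sets ?R = sigma_sets UNIV ?E"
    by (simp_all add: borel_eq_box)
  let ?A = "\<lambda>n::nat. box (- (real n *\<^sub>R One)) (real n *\<^sub>R One) :: (real ^ 'd) set"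
  show "range ?A \<subseteq> ?E" "(\<Union>i. ?A i) = UNIV" unfolding UN_box_eq_UNIV by auto
  show "emeasure ?L (?A i) \<noteq> \<infinity>" for i using L.emeasure_finite by simp
  fix X assume "X \<in> ?E"
  then obtain l u where X: "X = box l u" by auto
  \<comment> \<open>Length of the overlap of the two boxes in direction \<open>i\<close>, cut off at
    0 when they do not meet.\<close>
  define len where "len i = max 0 (min (u $ i) (a $ i + \<delta>) - max (l $ i) (a $ i))" for i
  have len: "len i \<ge> 0" for i by (simp add: len_def)
  have "emeasure ?L X = emeasure unif_prod (?T -` X \<inter> space unif_prod)"
    by (rule emeasure_distr) (auto simp: X)
  also have "?T -` X \<inter> space unif_prod
      = PiE UNIV (\<lambda>i. {(l $ i - a $ i) / \<delta> <..< (u $ i - a $ i) / \<delta>})"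
    using \<delta> by (auto simp: X unif_prod_def space_PiM mem_box_cart PiE_iff field_simps)
  also have "emeasure unif_prod \<dots>
      = (\<Prod>i\<in>UNIV. emeasure unif01 {(l $ i - a $ i) / \<delta> <..< (u $ i - a $ i) / \<delta>})"
    unfolding unif_prod_def
    by (rule product_sigma_finite.emeasure_PiM)
      (auto simp: product_sigma_finite_def intro!: prob_space_imp_sigma_finite prob_space_unif01)
  also have "\<dots> = (\<Prod>i\<in>UNIV. ennreal (1 / \<delta> * len i))"
  proof (rule prod.cong[OF refl])
    fix i
    have 1: "{0<..<1} \<inter> {(l $ i - a $ i) / \<delta> <..< (u $ i - a $ i) / \<delta>}
        = {max 0 ((l $ i - a $ i) / \<delta>) <..< min 1 ((u $ i - a $ i) / \<delta>)}" by auto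
    have 2: "max 0 (min 1 ((u $ i - a $ i) / \<delta>) - max 0 ((l $ i - a $ i) / \<delta>)) = 1 / \<delta> * len i"
      unfolding len_def using \<delta> by (auto simp: max_def min_def field_simps)
    have 3: "emeasure lborel {p<..<q} = ennreal (max 0 (q - p))" for p q :: real
      by (cases "p \<le> q") auto
    show "emeasure unif01 {(l $ i - a $ i) / \<delta> <..< (u $ i - a $ i) / \<delta>} = ennreal (1 / \<delta> * len i)"
      unfolding emeasure_unif01[OF borel_open[OF open_greaterThanLessThan]] 1 3 2 ..
  qed
  also have "\<dots> = ennreal ((1 / \<delta>) ^ CARD('d) * (\<Prod>i\<in>UNIV. len i))"
    using len \<delta> by (subst prod_ennreal) (simp_all only: prod.distrib prod_constant, auto)
  finally have 1: "emeasure ?L X = ennreal ((1 / \<delta>) ^ CARD('d) * (\<Prod>i\<in>UNIV. len i))" .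
  have inter: "box a (a + (\<chi> i. \<delta>)) \<inter> X
      = box (\<chi> i. max (l $ i) (a $ i)) (\<chi> i. min (u $ i) (a $ i + \<delta>))"
    by (auto simp: X mem_box_cart)
  have "emeasure ?R X = (\<integral>\<^sup>+ x. ennreal ((1 / \<delta>) ^ CARD('d)) * indicator (box a (a + (\<chi> i. \<delta>)) \<inter> X) x \<partial>lborel)"
    using \<delta> by (subst emeasure_density)
      (auto simp: X intro!: nn_integral_cong split: split_indicator)
  also have "\<dots> = ennreal ((1 / \<delta>) ^ CARD('d)) * emeasure lborel (box a (a + (\<chi> i. \<delta>)) \<inter> X)"
    by (rule nn_integral_cmult_indicator) (auto simp: X)
  also have "\<dots> = ennreal ((1 / \<delta>) ^ CARD('d) * (\<Prod>i\<in>UNIV. len i))"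
    unfolding inter emeasure_lborel_box_vec using \<delta> len
    by (subst ennreal_mult[symmetric]) (auto simp: len_def intro!: prod_nonneg)
  finally show "emeasure ?L X = emeasure ?R X" unfolding 1 by simp
qed

text \<open>The interior of the cell with index \<open>k\<close>. Inside the cube it agrees with the
  fibre of \<open>cube_index\<close> up to a null set, and being a box it matches the image law in
  \<open>distr_unif_prod\<close>.\<close>

definition open_cell :: "nat \<Rightarrow> int ^ 'd \<Rightarrow> (real ^ 'd) set" where
  "open_cell \<kappa> k = box (\<chi> i. of_int (k $ i) / real \<kappa>) (\<chi> i. (of_int (k $ i) + 1) / real \<kappa>)"

lemma open_cell_sets [measurable, simp]: "open_cell \<kappa> k \<in> sets borel"
  by (simp add: open_cell_def)

lemma integral_cell_point:
  fixes \<phi> :: "real ^ 'd \<Rightarrow> real"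
  assumes meas: "\<phi> \<in> borel_measurable borel" and \<kappa>: "1 \<le> \<kappa>"
  shows "(\<integral>u. \<phi> (cell_point (\<chi> i. of_int (b $ i) / real \<kappa>) (1 / real \<kappa>) j u) \<partial>unif_prod)
    = real \<kappa> ^ CARD('d) * (\<integral>x. indicator (open_cell \<kappa> (\<chi> i. b $ i + int (j i))) x * \<phi> x \<partial>lborel)"
proof -
  define a where "a = (\<chi> i. (of_int (b $ i) + real (j i)) / real \<kappa>)"
  have \<delta>: "0 < 1 / real \<kappa>" using \<kappa> by simp
  have pt: "cell_point (\<chi> i. of_int (b $ i) / real \<kappa>) (1 / real \<kappa>) j = (\<lambda>u. \<chi> i. a $ i + 1 / real \<kappa> * u i)"
    by (auto simp: cell_point_def a_def vec_eq_iff fun_eq_iff add_divide_distrib)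
  have cell: "box a (a + (\<chi> i. 1 / real \<kappa>)) = open_cell \<kappa> (\<chi> i. b $ i + int (j i))"
    unfolding open_cell_def a_def
    by (intro arg_cong2[of _ _ _ _ box]) (auto simp: vec_eq_iff add_divide_distrib)
  have "(\<integral>u. \<phi> (cell_point (\<chi> i. of_int (b $ i) / real \<kappa>) (1 / real \<kappa>) j u) \<partial>unif_prod)
      = (\<integral>x. \<phi> x \<partial>distr unif_prod borel (\<lambda>u. \<chi> i. a $ i + 1 / real \<kappa> * u i))"
    unfolding pt by (rule integral_distr[symmetric]) (auto intro!: vec_measurable meas)
  also have "\<dots> = (\<integral>x. (real \<kappa> ^ CARD('d) * indicator (open_cell \<kappa> (\<chi> i. b $ i + int (j i))) x) *\<^sub>R \<phi> x \<partial>lborel)"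
    unfolding distr_unif_prod[OF \<delta>] cell using meas
    by (subst integral_density) auto
  finally show ?thesis by (simp add: mult.assoc)
qed

text \<open>The two descriptions of a cell can differ only on the finitely many hyperplanes that
  bound it, and those are null sets.\<close>

lemma AE_cube_index_open_cell:
  assumes \<kappa>: "1 \<le> \<kappa>" and k: "k \<in> cells \<kappa>"
  shows "AE x in lborel. x \<in> unit_cube \<longrightarrow> (cube_index \<kappa> x = k \<longleftrightarrow> x \<in> open_cell \<kappa> k)"
proof -
  have "AE x in lborel. x $ i \<noteq> of_int (k $ i) / real \<kappa> \<and> x $ i \<noteq> (of_int (k $ i) + 1) / real \<kappa>"
    for i
  proof -
    have "axis i 1 \<in> (Basis :: (real ^ 'a) set)" by (auto simp: Basis_vec_def)
    from AE_lborel_inner_neq[OF this, of "of_int (k $ i) / real \<kappa>"]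
      AE_lborel_inner_neq[OF this, of "(of_int (k $ i) + 1) / real \<kappa>"]
    show ?thesis by (simp add: inner_axis)
  qed
  then have "AE x in lborel. \<forall>i\<in>UNIV. x $ i \<noteq> of_int (k $ i) / real \<kappa> \<and> x $ i \<noteq> (of_int (k $ i) + 1) / real \<kappa>"
    by (intro AE_finite_allI) auto
  then show ?thesis
  proof eventually_elim
    case (elim x)
    show ?case
    proof
      assume x: "x \<in> unit_cube"
      have "min \<lfloor>real \<kappa> * x $ i\<rfloor> (int \<kappa> - 1) = k $ i
          \<longleftrightarrow> of_int (k $ i) / real \<kappa> < x $ i \<and> x $ i < (of_int (k $ i) + 1) / real \<kappa>" for i
      proof -
        define y where "y = real \<kappa> * x $ i"
        have pos: "real \<kappa> > 0" using \<kappa> by simp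
        have xi: "0 \<le> x $ i" "x $ i \<le> 1" using x by (auto simp: mem_box_cart)
        then have y: "0 \<le> y" "y \<le> real \<kappa>"
          using pos mult_left_mono[of "x $ i" 1 "real \<kappa>"] by (auto simp: y_def)
        have ne: "y \<noteq> of_int (k $ i)" "y \<noteq> of_int (k $ i) + 1"
          using elim pos by (auto simp: y_def field_simps)
        have ki: "0 \<le> k $ i" "k $ i < int \<kappa>" using k by (auto simp: cells_def)
        have "min \<lfloor>y\<rfloor> (int \<kappa> - 1) = k $ i \<longleftrightarrow> of_int (k $ i) < y \<and> y < of_int (k $ i) + 1"
        proof
          assume *: "min \<lfloor>y\<rfloor> (int \<kappa> - 1) = k $ i"
          show "of_int (k $ i) < y \<and> y < of_int (k $ i) + 1"
          proof (cases "\<lfloor>y\<rfloor> = k $ i")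
            case True
            then show ?thesis using ne by linarith
          next
            \<comment> \<open>The truncation at \<open>int \<kappa> - 1\<close> changes the index
              only for \<open>y = \<kappa>\<close>, that is, on the far face of the cube, which is
              one of the excluded hyperplanes.\<close>
            case False
            then have "k $ i = int \<kappa> - 1" "int \<kappa> - 1 < \<lfloor>y\<rfloor>" using * by auto
            then have "real \<kappa> \<le> y" by linarith
            then have "y = of_int (k $ i) + 1" using y \<open>k $ i = int \<kappa> - 1\<close> by simp
            then show ?thesis using ne by simp
          qed
        next
          assume "of_int (k $ i) < y \<and> y < of_int (k $ i) + 1"
          then have "\<lfloor>y\<rfloor> = k $ i" by linarith
          then show "min \<lfloor>y\<rfloor> (int \<kappa> - 1) = k $ i" using ki by simp
        qed
        then show ?thesis
          using pos by (simp add: y_def pos_divide_less_eq pos_less_divide_eq mult.commute)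
      qed
      then show "cube_index \<kappa> x = k \<longleftrightarrow> x \<in> open_cell \<kappa> k"
        by (simp add: cube_index_def open_cell_def vec_eq_iff mem_box_cart)
    qed
  qed
qed

section \<open>The discretisation bias\<close>

text \<open>Blocks are aligned to multiples of \<open>r\<close> instead of being centred at
  \<open>x\<close>. If \<open>r\<close> divides \<kappa> they tile the cube, so no block sticks out
  of it, and the points whose block contains a given cell form a set lying in one box.\<close>

definition block :: "nat \<Rightarrow> nat \<Rightarrow> real ^ 'd \<Rightarrow> (int ^ 'd) set" where
  "block r \<kappa> x = {k \<in> cells \<kappa>. \<forall>i. k $ i div int r = cube_index \<kappa> x $ i div int r}"

lemma finite_block: "finite (block r \<kappa> x)"
  unfolding block_def using finite_cells by (rule rev_finite_subset) auto

definition cell_integral :: "nat \<Rightarrow> (real ^ 'd \<Rightarrow> real) \<Rightarrow> int ^ 'd \<Rightarrow> real" where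
  "cell_integral \<kappa> f k = (\<integral>x. indicator (open_cell \<kappa> k) x * on_cube f x \<partial>lborel)"

text \<open>Reconstruction is linear and exact for polynomials of degree less than \<open>r\<close>,
  so only the distance from \<open>p\<close> contributes: once through the value at the point and
  \<open>r\<close> times, with weight at most \<open>\<Lambda>\<close>, through the averages. The
  polynomial \<open>q\<close> is \<open>p\<close> in the variable that gives cells unit
  length.\<close>

lemma section_reconstruction:
  fixes \<phi> :: "real ^ 'd \<Rightarrow> real" and lam :: "nat \<Rightarrow> real \<Rightarrow> real"
  assumes meas: "\<phi> \<in> borel_measurable borel" and bdd: "\<And>x. \<bar>\<phi> x\<bar> \<le> K"
    and lam: "\<And>l z. z \<in> {0..real r} \<Longrightarrow> \<bar>lam l z\<bar> \<le> \<Lambda>"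
      "\<And>p z. degree p < r \<Longrightarrow> poly p z = (\<Sum>l<r. lam l z * (\<integral>v. poly p (real l + v) \<partial>unif01))"
    and \<delta>: "0 < \<delta>" and E: "0 \<le> E"
    and p: "degree p < r" "\<And>t. t \<in> {a..a + \<delta> * real r} \<Longrightarrow> \<bar>\<phi> (coord_upd y i t) - poly p t\<bar> \<le> E"
    and z: "z \<in> {0..real r}"
  shows "\<bar>\<phi> (coord_upd y i (a + \<delta> * z))
    - (\<Sum>l<r. lam l z * (\<integral>v. \<phi> (coord_upd y i (a + \<delta> * (real l + v))) \<partial>unif01))\<bar> \<le> (1 + real r * \<Lambda>) * E"
proof -
  interpret V: prob_space unif01 by (rule prob_space_unif01)
  define q where "q = p \<circ>\<^sub>p [:a, \<delta>:]"
  have q: "poly q t = poly p (a + \<delta> * t)" for t by (simp add: q_def poly_pcompose mult.commute)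
  have "degree q \<le> degree p * 1"
    unfolding q_def degree_pcompose by (intro mult_left_mono) auto
  then have dq: "degree q < r" using p(1) by simp
  define f where "f l v = \<phi> (coord_upd y i (a + \<delta> * (real l + v)))" for l v
  have f_meas: "f l \<in> borel_measurable unif01" for l
  proof -
    have "(\<lambda>v. coord_upd y i (a + \<delta> * (real l + v))) \<in> borel_measurable unif01"
      unfolding coord_upd_def
    proof (rule vec_measurable)
      fix k
      show "(\<lambda>v. if k = i then a + \<delta> * (real l + v) else y $ k) \<in> borel_measurable unif01"
        by (cases "k = i") (simp_all add: unif01_def)
    qed
    then show ?thesis unfolding f_def using meas by (rule measurable_compose)
  qed
  have f_int: "integrable unif01 (f l)" for l
    by (rule V.integrable_const_bound[where B = K]) (use f_meas bdd in \<open>auto simp: f_def\<close>)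
  have close: "AE v in unif01. \<bar>f l v - poly q (real l + v)\<bar> \<le> E" if "l < r" for l
    using AE_unif01
  proof eventually_elim
    case (elim v)
    have "real l + 1 \<le> real r" using that by linarith
    then have "real l + v \<le> real r" using elim by simp
    then have "\<delta> * (real l + v) \<le> \<delta> * real r" using \<delta> by (intro mult_left_mono) auto
    moreover have "0 \<le> \<delta> * (real l + v)" using \<delta> elim by (intro mult_nonneg_nonneg) auto
    ultimately show ?case unfolding f_def q by (intro p(2)) auto
  qed
  have q_int: "integrable unif01 (\<lambda>v. poly q (real l + v))" if "l < r" for l
  proof (rule V.integrable_const_bound[where B = "K + E"])
    show "AE v in unif01. norm (poly q (real l + v)) \<le> K + E"
      using close[OF that]
    proof eventually_elim
      case (elim v)
      then show ?case using bdd[of "coord_upd y i (a + \<delta> * (real l + v))"] by (simp add: f_def)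
    qed
    have "(\<lambda>v. poly q (real l + v)) \<in> borel_measurable borel"
      by (intro borel_measurable_continuous_onI continuous_intros)
    then show "(\<lambda>v. poly q (real l + v)) \<in> borel_measurable unif01" by (simp add: unif01_def)
  qed
  have diff: "\<bar>(\<integral>v. f l v \<partial>unif01) - (\<integral>v. poly q (real l + v) \<partial>unif01)\<bar> \<le> E" if "l < r" for l
    using V.abs_integral_le[OF close[OF that] E] f_int q_int[OF that] by simp
  have "\<delta> * z \<le> \<delta> * real r" "0 \<le> \<delta> * z" using z \<delta> by (auto intro: mult_left_mono)
  then have 1: "\<bar>\<phi> (coord_upd y i (a + \<delta> * z)) - poly q z\<bar> \<le> E"
    unfolding q by (intro p(2)) auto
  have "poly q z - (\<Sum>l<r. lam l z * (\<integral>v. f l v \<partial>unif01))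
      = (\<Sum>l<r. lam l z * ((\<integral>v. poly q (real l + v) \<partial>unif01) - (\<integral>v. f l v \<partial>unif01)))"
    by (simp only: lam(2)[OF dq, of z] sum_subtractf[symmetric] right_diff_distrib)
  also have "\<bar>\<dots>\<bar> \<le> (\<Sum>l<r. \<Lambda> * E)"
  proof (intro order_trans[OF sum_abs] sum_mono)
    fix l assume "l \<in> {..<r}"
    then show "\<bar>lam l z * ((\<integral>v. poly q (real l + v) \<partial>unif01) - (\<integral>v. f l v \<partial>unif01))\<bar> \<le> \<Lambda> * E"
      unfolding abs_mult using diff[of l] lam(1)[OF z, of l] E
      by (intro mult_mono) (auto simp: abs_minus_commute)
  qed
  finally have "\<bar>poly q z - (\<Sum>l<r. lam l z * (\<integral>v. f l v \<partial>unif01))\<bar> \<le> real r * \<Lambda> * E" by simp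
  with 1 have "\<bar>\<phi> (coord_upd y i (a + \<delta> * z)) - (\<Sum>l<r. lam l z * (\<integral>v. f l v \<partial>unif01))\<bar> \<le> E + real r * \<Lambda> * E"
    by linarith
  then show ?thesis by (simp add: f_def algebra_simps)
qed

text \<open>The factor \<open>c\<close> allows to use the bound both for a density (\<open>c = 0\<close>) and for a difference of
  densities (\<open>c = 1\<close>).\<close>

lemma holder_reconstruction:
  fixes s L :: real
  assumes s: "0 < s" and L: "0 < L" and r: "nat \<lfloor>s\<rfloor> < r"
  shows "\<exists>A E. 0 < A \<and> 0 < E \<and> (\<forall>f \<in> holder_class s L. \<forall>g \<in> holder_class s L. \<forall>c \<in> {0, 1}. \<forall>\<kappa> x.
    1 \<le> \<kappa> \<longrightarrow> r dvd \<kappa> \<longrightarrow> x \<in> (unit_cube :: (real ^ 'd) set) \<longrightarrow>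
    \<bar>f x - c * g x\<bar> \<le> A * real \<kappa> ^ CARD('d) * (\<Sum>k\<in>block r \<kappa> x. \<bar>cell_integral \<kappa> (\<lambda>x. f x - c * g x) k\<bar>)
      + E * real \<kappa> powr (- s))"
proof -
  obtain lam :: "nat \<Rightarrow> real \<Rightarrow> real" and \<Lambda> where lam: "1 \<le> \<Lambda>"
    "\<And>l z. z \<in> {0..real r} \<Longrightarrow> \<bar>lam l z\<bar> \<le> \<Lambda>"
    "\<And>p z. degree p < r \<Longrightarrow> poly p z = (\<Sum>l<r. lam l z * (\<integral>v. poly p (real l + v) \<partial>unif01))"
    using ex_average_reconstruction[of r] by metis
  \<comment> \<open>The first factors come from \<open>tensor_reconstruction\<close>, the factor
    \<open>1 + real r * \<Lambda>\<close> from \<open>section_reconstruction\<close>, and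
    \<open>2 * L * real r powr s\<close> from approximating two functions on an interval of length
    \<open>r / \<kappa>\<close>, with \<open>real \<kappa> powr (- s)\<close> split off.\<close>
  define E where "E = real CARD('d) * (real r * \<Lambda>) ^ CARD('d) * ((1 + real r * \<Lambda>) * (2 * L * real r powr s))"
  have r1: "1 \<le> r" using r by simp
  have "0 < real r * \<Lambda>" using r1 lam(1) by simp
  then have "0 < (real r * \<Lambda>) ^ CARD('d)" "0 < 1 + real r * \<Lambda>" by auto
  then have E0: "0 < E" unfolding E_def using r1 L by (intro mult_pos_pos) auto
  show ?thesis
  proof (rule exI[of _ "\<Lambda> ^ CARD('d)"], rule exI[of _ E], intro conjI ballI allI impI)
    show "0 < \<Lambda> ^ CARD('d)" using lam(1) by simp
    show "0 < E" by fact
    fix f g :: "real ^ 'd \<Rightarrow> real" and c :: real and \<kappa> and x :: "real ^ 'd"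
    assume f: "f \<in> holder_class s L" and g: "g \<in> holder_class s L" and c: "c \<in> {0, 1}"
      and \<kappa>: "1 \<le> \<kappa>" and dvd: "r dvd \<kappa>" and x: "x \<in> unit_cube"
    define h where "h x = f x - c * g x" for x
    have h_cont: "continuous_on unit_cube h"
      unfolding h_def by (intro continuous_intros holder_continuous_on[OF s f] holder_continuous_on[OF s g])
    obtain K where K: "\<And>x. \<bar>on_cube h x\<bar> \<le> K" using on_cube_bounded[OF h_cont] by blast
    have h_meas: "on_cube h \<in> borel_measurable borel" by (rule on_cube_measurable[OF h_cont])
    define \<delta> where "\<delta> = 1 / real \<kappa>"
    have \<delta>: "0 < \<delta>" using \<kappa> by (simp add: \<delta>_def)
    define E1 where "E1 = 2 * L * (\<delta> * real r) powr s"
    have E1: "0 \<le> E1" using L by (simp add: E1_def)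
    have approx: "\<exists>p. degree p < r \<and> (\<forall>t\<in>{a..a + \<delta> * real r}. \<bar>on_cube h (coord_upd y i t) - poly p t\<bar> \<le> E1)"
      if y: "y \<in> unit_cube" and a: "0 \<le> a" "a + \<delta> * real r \<le> 1" for y i a
    proof -
      have lt: "a < a + \<delta> * real r" using \<delta> r1 by simp
      obtain p where p: "degree p \<le> nat \<lfloor>s\<rfloor>"
        "\<And>t. t \<in> {a..a + \<delta> * real r} \<Longrightarrow> \<bar>f (coord_upd y i t) - poly p t\<bar> \<le> L * (\<delta> * real r) powr s"
        using holder_section_poly[OF s _ f y a(1) lt a(2), of i] L by auto
      obtain q where q: "degree q \<le> nat \<lfloor>s\<rfloor>"
        "\<And>t. t \<in> {a..a + \<delta> * real r} \<Longrightarrow> \<bar>g (coord_upd y i t) - poly q t\<bar> \<le> L * (\<delta> * real r) powr s"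
        using holder_section_poly[OF s _ g y a(1) lt a(2), of i] L by auto
      have "degree (p - smult c q) \<le> nat \<lfloor>s\<rfloor>"
        using p(1) q(1) by (intro degree_diff_le order_trans[OF degree_smult_le])
      moreover have "\<bar>on_cube h (coord_upd y i t) - poly (p - smult c q) t\<bar> \<le> E1"
        if t: "t \<in> {a..a + \<delta> * real r}" for t
      proof -
        have "coord_upd y i t \<in> unit_cube" by (rule coord_upd_in_cube[OF y]) (use t a in auto)
        moreover have "c = 0 \<or> c = 1" using c by simp
        ultimately show ?thesis
          using p(2)[OF t] q(2)[OF t] unfolding E1_def h_def by (auto simp: abs_le_iff)
      qed
      ultimately show ?thesis using r by (intro exI[of _ "p - smult c q"]) auto
    qed
    \<comment> \<open>The lower corner of the block of \<open>x\<close>, measured in cells.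
      Divisibility of \<kappa> by \<open>r\<close> is what keeps the upper corner
      \<open>b + r\<close> inside the grid.\<close>
    define b where "b = (\<chi> i. int r * (cube_index \<kappa> x $ i div int r))"
    define o' where "o' = (\<chi> i. real_of_int (b $ i) / real \<kappa>)"
    have ci: "0 \<le> cube_index \<kappa> x $ i" "cube_index \<kappa> x $ i < int \<kappa>" for i
      using cube_index_in_cells[OF \<kappa> x] by (auto simp: cells_def)
    have b: "0 \<le> b $ i" "b $ i \<le> cube_index \<kappa> x $ i" "cube_index \<kappa> x $ i + 1 \<le> b $ i + int r" "b $ i + int r \<le> int \<kappa>" for i
    proof -
      have eq: "cube_index \<kappa> x $ i = b $ i + cube_index \<kappa> x $ i mod int r"
        by (simp add: b_def)
      have mod: "0 \<le> cube_index \<kappa> x $ i mod int r" "cube_index \<kappa> x $ i mod int r < int r"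
        using r1 by auto
      show "0 \<le> b $ i" using ci[of i] r1 by (simp add: b_def pos_imp_zdiv_nonneg_iff)
      show "b $ i \<le> cube_index \<kappa> x $ i" "cube_index \<kappa> x $ i + 1 \<le> b $ i + int r"
        using eq mod by linarith+
      obtain m where "\<kappa> = r * m" using dvd by (elim dvdE)
      then have \<kappa>_eq: "int \<kappa> = int r * int m" by simp
      have "b $ i < int \<kappa>"
        using ci(2)[of i] \<open>b $ i \<le> cube_index \<kappa> x $ i\<close> by linarith
      then have "int r * (cube_index \<kappa> x $ i div int r) < int r * int m"
        unfolding \<kappa>_eq b_def by simp
      then have "cube_index \<kappa> x $ i div int r + 1 \<le> int m" using r1 by simp
      then have "int r * (cube_index \<kappa> x $ i div int r + 1) \<le> int r * int m"
        by (intro mult_left_mono) auto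
      then show "b $ i + int r \<le> int \<kappa>" unfolding \<kappa>_eq by (simp add: b_def algebra_simps)
    qed
    have pos: "real \<kappa> > 0" using \<kappa> by simp
    have o0: "0 \<le> o' $ i" for i using b(1)[of i] by (simp add: o'_def)
    have o1: "o' $ i + \<delta> * real r \<le> 1" for i
    proof -
      have "real_of_int (b $ i) + real r \<le> real \<kappa>" using b(4)[of i] by linarith
      then show ?thesis using pos by (simp add: o'_def \<delta>_def add_divide_distrib[symmetric])
    qed
    have xi: "0 \<le> x $ i" "x $ i \<le> 1" for i using x by (auto simp: mem_box_cart)
    have ox: "o' $ i \<le> x $ i" "x $ i \<le> o' $ i + \<delta> * real r" for i
    proof -
      have "b $ i \<le> \<lfloor>real \<kappa> * x $ i\<rfloor>" using b(2)[of i] by (simp add: cube_index_def)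
      then have "real_of_int (b $ i) \<le> real \<kappa> * x $ i" by linarith
      then show "o' $ i \<le> x $ i" using pos by (simp add: o'_def pos_divide_le_eq mult.commute)
      \<comment> \<open>The last cell in each direction is closed, so for \<open>x $ i = 1\<close>
        the index is one less than the floor and needs its own case.\<close>
      have "real \<kappa> * x $ i \<le> real_of_int (b $ i) + real r"
      proof (cases "\<lfloor>real \<kappa> * x $ i\<rfloor> \<le> int \<kappa> - 1")
        case True
        then have "\<lfloor>real \<kappa> * x $ i\<rfloor> + 1 \<le> b $ i + int r" using b(3)[of i] by (simp add: cube_index_def)
        then show ?thesis by linarith
      next
        case False
        then have "int \<kappa> \<le> b $ i + int r" using b(3)[of i] by (simp add: cube_index_def)
        then have "real \<kappa> \<le> real_of_int (b $ i) + real r" by linarith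
        moreover have "real \<kappa> * x $ i \<le> real \<kappa>" using xi(2)[of i] pos by simp
        ultimately show ?thesis by linarith
      qed
      then show "x $ i \<le> o' $ i + \<delta> * real r"
        using pos by (simp add: o'_def \<delta>_def add_divide_distrib[symmetric] pos_le_divide_eq mult.commute)
    qed
    have "\<bar>on_cube h x\<bar> \<le> \<Lambda> ^ CARD('d) * (\<Sum>j\<in>PiE UNIV (\<lambda>_. {..<r}). \<bar>\<integral>u. on_cube h (cell_point o' \<delta> j u) \<partial>unif_prod\<bar>)
        + real CARD('d) * (real r * \<Lambda>) ^ CARD('d) * ((1 + real r * \<Lambda>) * E1)"
    proof (rule tensor_reconstruction[OF h_meas K lam(1,2) r1 _ \<delta> o0 o1 _ ox])
      show "0 \<le> (1 + real r * \<Lambda>) * E1" using lam(1) E1 by (intro mult_nonneg_nonneg) auto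
      fix y :: "real ^ 'd" and i :: 'd and z :: real assume y: "y \<in> unit_cube" and z: "z \<in> {0..real r}"
      obtain p where "degree p < r" "\<And>t. t \<in> {o' $ i..o' $ i + \<delta> * real r} \<Longrightarrow> \<bar>on_cube h (coord_upd y i t) - poly p t\<bar> \<le> E1"
        using approx[OF y o0[of i] o1[of i], of i] by blast
      then show "\<bar>on_cube h (coord_upd y i (o' $ i + \<delta> * z))
        - (\<Sum>l<r. lam l z * (\<integral>v. on_cube h (coord_upd y i (o' $ i + \<delta> * (real l + v))) \<partial>unif01))\<bar> \<le> (1 + real r * \<Lambda>) * E1"
        by (intro section_reconstruction[OF h_meas K lam(2,3) \<delta> E1 _ _ z]) auto
    qed
    also have "(\<Sum>j\<in>PiE UNIV (\<lambda>_. {..<r}). \<bar>\<integral>u. on_cube h (cell_point o' \<delta> j u) \<partial>unif_prod\<bar>)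
        = real \<kappa> ^ CARD('d) * (\<Sum>j\<in>PiE UNIV (\<lambda>_. {..<r}). \<bar>cell_integral \<kappa> h (\<chi> i. b $ i + int (j i))\<bar>)"
      unfolding o'_def \<delta>_def integral_cell_point[OF h_meas \<kappa>] cell_integral_def
      using pos by (simp add: abs_mult sum_distrib_left)
    also have "(\<Sum>j\<in>PiE UNIV (\<lambda>_. {..<r}). \<bar>cell_integral \<kappa> h (\<chi> i. b $ i + int (j i))\<bar>)
        = (\<Sum>k\<in>(\<lambda>j. \<chi> i. b $ i + int (j i)) ` PiE UNIV (\<lambda>_. {..<r}). \<bar>cell_integral \<kappa> h k\<bar>)"
      by (subst sum.reindex) (auto simp: inj_on_def vec_eq_iff fun_eq_iff)
    also have "\<dots> \<le> (\<Sum>k\<in>block r \<kappa> x. \<bar>cell_integral \<kappa> h k\<bar>)"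
    proof (intro sum_mono2 finite_block)
      show "(\<lambda>j. \<chi> i. b $ i + int (j i)) ` PiE UNIV (\<lambda>_. {..<r}) \<subseteq> block r \<kappa> x"
      proof
        fix k assume "k \<in> (\<lambda>j. \<chi> i. b $ i + int (j i)) ` PiE UNIV (\<lambda>_. {..<r})"
        then obtain j where "j \<in> PiE UNIV (\<lambda>_. {..<r})" "k = (\<chi> i. b $ i + int (j i))" by blast
        then have j: "\<And>i. j i < r" "k = (\<chi> i. b $ i + int (j i))" by (auto simp: PiE_iff)
        have "k $ i div int r = cube_index \<kappa> x $ i div int r" for i
          using j(1)[of i] r1 by (simp add: j(2) b_def)
        moreover have "0 \<le> k $ i \<and> k $ i < int \<kappa>" for i
          using b(1,4)[of i] j(1)[of i] by (simp add: j(2))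
        ultimately show "k \<in> block r \<kappa> x" by (simp add: block_def cells_def)
      qed
    qed auto
    finally have "\<bar>on_cube h x\<bar> \<le> \<Lambda> ^ CARD('d) * (real \<kappa> ^ CARD('d) * (\<Sum>k\<in>block r \<kappa> x. \<bar>cell_integral \<kappa> h k\<bar>))
        + real CARD('d) * (real r * \<Lambda>) ^ CARD('d) * ((1 + real r * \<Lambda>) * E1)"
      using lam(1) by (simp add: mult_left_mono)
    moreover have "real CARD('d) * (real r * \<Lambda>) ^ CARD('d) * ((1 + real r * \<Lambda>) * E1) = E * real \<kappa> powr (- s)"
      unfolding E_def E1_def \<delta>_def using pos
      by (simp add: powr_mult powr_divide powr_minus divide_simps)
    ultimately show "\<bar>f x - c * g x\<bar> \<le> \<Lambda> ^ CARD('d) * real \<kappa> ^ CARD('d)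
        * (\<Sum>k\<in>block r \<kappa> x. \<bar>cell_integral \<kappa> (\<lambda>x. f x - c * g x) k\<bar>) + E * real \<kappa> powr (- s)"
      using x by (simp add: h_def[abs_def] mult.assoc)
  qed
qed

section \<open>From densities to cell probabilities and the bias bound\<close>

lemma has_cube_densityD:
  fixes P :: "(real ^ 'd) measure"
  assumes dens: "has_cube_density P f" and cont: "continuous_on unit_cube f"
  shows "cube_prob P" and "A \<in> sets borel \<Longrightarrow> measure P A = (\<integral>x. indicator A x * on_cube f x \<partial>lborel)"
proof -
  have P: "P = density lborel (\<lambda>x. ennreal (on_cube f x))" and nonneg: "\<And>x. 0 \<le> on_cube f x"
    and prob: "prob_space P"
    using dens by (auto simp: has_cube_density_def on_cube_def indicator_def)
  have [measurable]: "on_cube f \<in> borel_measurable borel" by (rule on_cube_measurable[OF cont])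
  have sets: "sets P = sets borel" by (simp add: P)
  interpret prob_space P by fact
  have "AE x in P. x \<in> unit_cube"
  proof -
    have "(\<lambda>x. ennreal (on_cube f x)) \<in> borel_measurable lborel" by measurable
    then show ?thesis
      unfolding P by (simp only: AE_density) (auto simp: on_cube_def split: split_indicator)
  qed
  then show "cube_prob P"
    by (intro cube_prob.intro cube_prob_axioms.intro prob sets)
  assume A [measurable]: "A \<in> sets borel"
  have "measure P A = (\<integral>x. indicator A x \<partial>P)"
    using A sets by simp
  also have "\<dots> = (\<integral>x. on_cube f x *\<^sub>R indicator A x \<partial>lborel)"
    unfolding P by (rule integral_density) (use nonneg in auto)
  finally show "measure P A = (\<integral>x. indicator A x * on_cube f x \<partial>lborel)"
    by (simp add: mult.commute)
qed

lemma cell_prob_density: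
  assumes dens: "has_cube_density P f" and cont: "continuous_on unit_cube f"
    and \<kappa>: "1 \<le> \<kappa>" and k: "k \<in> cells \<kappa>"
  shows "cell_prob P \<kappa> k = cell_integral \<kappa> f k"
proof -
  have [measurable]: "on_cube f \<in> borel_measurable borel" by (rule on_cube_measurable[OF cont])
  have "cell_prob P \<kappa> k = (\<integral>x. indicator {y. cube_index \<kappa> y = k} x * on_cube f x \<partial>lborel)"
    unfolding cell_prob_def by (rule has_cube_densityD(2)[OF dens cont]) simp
  also have "\<dots> = cell_integral \<kappa> f k"
    unfolding cell_integral_def
  proof (rule integral_cong_AE)
    show "AE x in lborel. indicator {y. cube_index \<kappa> y = k} x * on_cube f x
        = indicator (open_cell \<kappa> k) x * on_cube f x"
      using AE_cube_index_open_cell[OF \<kappa> k]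
      by eventually_elim (auto simp: indicator_def on_cube_def)
  qed auto
  finally show ?thesis .
qed

lemma cell_prob_outside:
  assumes "cube_prob P" "1 \<le> \<kappa>" "k \<notin> cells \<kappa>"
  shows "cell_prob P \<kappa> k = 0"
proof -
  interpret cube_prob P by fact
  have "AE x in P. x \<notin> {y. cube_index \<kappa> y = k}"
    using AE_cube by eventually_elim (use cube_index_in_cells[OF assms(2)] assms(3) in auto)
  then show ?thesis
    unfolding cell_prob_def using sets_R by (intro measure_eq_0_null_sets) (auto simp: AE_iff_null_sets)
qed

lemma measure_lborel_open_cell:
  assumes "1 \<le> \<kappa>"
  shows "measure lborel (open_cell \<kappa> k :: (real ^ 'd) set) = (1 / real \<kappa>) ^ CARD('d)"
proof -
  have "emeasure lborel (open_cell \<kappa> k :: (real ^ 'd) set)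
      = ennreal (\<Prod>i\<in>(UNIV :: 'd set). max 0 ((of_int (k $ i) + 1) / real \<kappa> - of_int (k $ i) / real \<kappa>))"
    by (simp add: open_cell_def emeasure_lborel_box_vec)
  also have "(\<Prod>i\<in>(UNIV :: 'd set). max 0 ((of_int (k $ i) + 1) / real \<kappa> - of_int (k $ i) / real \<kappa>))
      = (\<Prod>i\<in>(UNIV :: 'd set). 1 / real \<kappa>)"
    by (intro prod.cong refl) (simp add: diff_divide_distrib[symmetric])
  finally show ?thesis by (simp add: measure_def)
qed

text \<open>The class controls oscillation and derivatives but not the size of a function; the size
  is controlled because a density has total mass one. Apply the reconstruction with
  \<open>c = 0\<close> at the fixed scale \<open>\<kappa> = r\<close>, where every cell integral is
  a probability.\<close>

lemma ex_density_bound: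
  fixes s L :: real
  assumes s: "0 < s" and L: "0 < L"
  shows "\<exists>M>0. \<forall>f \<in> holder_class s L. \<forall>P :: (real ^ 'd) measure. has_cube_density P f \<longrightarrow>
    (\<forall>x\<in>unit_cube. f x \<le> M)"
proof -
  define r where "r = Suc (nat \<lfloor>s\<rfloor>)"
  have r: "nat \<lfloor>s\<rfloor> < r" by (simp add: r_def)
  obtain A E where AE: "0 < A" "0 < E" and all: "\<forall>f \<in> holder_class s L. \<forall>g \<in> holder_class s L. \<forall>c \<in> {0, 1}. \<forall>\<kappa> x.
    1 \<le> \<kappa> \<longrightarrow> r dvd \<kappa> \<longrightarrow> x \<in> (unit_cube :: (real ^ 'd) set) \<longrightarrow>
    \<bar>f x - c * g x\<bar> \<le> A * real \<kappa> ^ CARD('d) * (\<Sum>k\<in>block r \<kappa> x. \<bar>cell_integral \<kappa> (\<lambda>x. f x - c * g x) k\<bar>)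
      + E * real \<kappa> powr (- s)"
    using holder_reconstruction[OF s L r, where 'd = 'd] by (elim exE conjE) (rule that)
  note bound = all[rule_format]
  define M where "M = A * real r ^ CARD('d) * real (card (cells r :: (int ^ 'd) set)) + E * real r powr (- s)"
  have "M > 0" unfolding M_def r_def using AE by (intro add_nonneg_pos mult_pos_pos) auto
  moreover have "f x \<le> M" if f: "f \<in> holder_class s L" and dens: "has_cube_density P f" and x: "x \<in> unit_cube"
    for f and P :: "(real ^ 'd) measure" and x
  proof -
    have cont: "continuous_on unit_cube f" by (rule holder_continuous_on[OF s f])
    interpret P: cube_prob P by (rule has_cube_densityD(1)[OF dens cont])
    have r1: "1 \<le> r" by (simp add: r_def)
    have "\<bar>f x - 0 * f x\<bar> \<le> A * real r ^ CARD('d) * (\<Sum>k\<in>block r r x. \<bar>cell_integral r (\<lambda>x. f x - 0 * f x) k\<bar>)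
        + E * real r powr (- s)"
      by (rule bound[OF f f _ r1 _ x]) auto
    also have "(\<Sum>k\<in>block r r x. \<bar>cell_integral r (\<lambda>x. f x - 0 * f x) k\<bar>) \<le> (\<Sum>k\<in>(cells r :: (int ^ 'd) set). 1)"
    proof (rule order_trans[OF sum_mono])
      fix k :: "int ^ 'd" assume "k \<in> block r r x"
      then have "k \<in> cells r" by (simp add: block_def)
      then have "cell_integral r f k = cell_prob P r k"
        using cell_prob_density[OF dens cont r1] by simp
      then show "\<bar>cell_integral r (\<lambda>x. f x - 0 * f x) k\<bar> \<le> 1"
        using P.cell_prob_bounds[of r k] by simp
    next
      show "(\<Sum>k\<in>block r r x. 1) \<le> (\<Sum>k\<in>(cells r :: (int ^ 'd) set). 1 :: real)"
        by (intro sum_mono2 finite_cells) (auto simp: block_def)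
    qed
    finally show "f x \<le> M" using AE by (simp add: M_def mult_left_mono)
  qed
  ultimately show ?thesis by blast
qed

lemma cell_prob_le_bound:
  fixes P :: "(real ^ 'd) measure"
  assumes dens: "has_cube_density P f" and cont: "continuous_on unit_cube f"
    and M: "0 < M" "\<And>x. x \<in> unit_cube \<Longrightarrow> f x \<le> M" and \<kappa>: "1 \<le> \<kappa>"
  shows "cell_prob P \<kappa> k \<le> M * (1 / real \<kappa>) ^ CARD('d)"
proof (cases "k \<in> cells \<kappa>")
  case True
  have fin: "emeasure lborel (open_cell \<kappa> k :: (real ^ 'd) set) < \<infinity>"
    by (simp add: open_cell_def emeasure_lborel_box_vec)
  have "cell_prob P \<kappa> k = (\<integral>x. indicator (open_cell \<kappa> k) x * on_cube f x \<partial>lborel)"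
    using cell_prob_density[OF dens cont \<kappa> True] by (simp add: cell_integral_def)
  also have "\<dots> \<le> (\<integral>x. indicator (open_cell \<kappa> k) x * M \<partial>lborel)"
  proof (rule integral_mono)
    show "integrable lborel (\<lambda>x. indicator (open_cell \<kappa> k) x * on_cube f x)"
      by (rule on_cube_integrable[OF cont]) simp
    show "integrable lborel (\<lambda>x. indicator (open_cell \<kappa> k) x * M :: real)"
      using fin by (intro integrable_mult_left integrable_real_indicator) auto
    show "indicator (open_cell \<kappa> k) x * on_cube f x \<le> indicator (open_cell \<kappa> k) x * M" for x
      using M by (auto simp: indicator_def on_cube_def)
  qed
  also have "\<dots> = M * (1 / real \<kappa>) ^ CARD('d)"
    using measure_lborel_open_cell[OF \<kappa>, of k] by simp
  finally show ?thesis .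
next
  case False
  then have "cell_prob P \<kappa> k = 0"
    by (rule cell_prob_outside[OF has_cube_densityD(1)[OF dens cont] \<kappa>])
  then show ?thesis using M(1) by simp
qed

text \<open>The cells of a block share their quotients by \<open>r\<close>, so the remainders
  determine them.\<close>

lemma card_block_le:
  assumes "1 \<le> r"
  shows "card (block r \<kappa> (x :: real ^ 'd)) \<le> r ^ CARD('d)"
proof -
  have "card (block r \<kappa> x) \<le> card (PiE (UNIV :: 'd set) (\<lambda>_. {0..<int r}))"
  proof (rule card_inj_on_le)
    show "inj_on (\<lambda>k i. k $ i mod int r) (block r \<kappa> x)"
    proof (rule inj_onI)
      fix k k' assume k: "k \<in> block r \<kappa> x" "k' \<in> block r \<kappa> x"
        and eq: "(\<lambda>i. k $ i mod int r) = (\<lambda>i. k' $ i mod int r)"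
      have "k $ i = k' $ i" for i
      proof -
        have "k $ i div int r = k' $ i div int r" using k by (simp add: block_def)
        moreover have "k $ i mod int r = k' $ i mod int r" using eq by meson
        ultimately show ?thesis by (metis mult_div_mod_eq)
      qed
      then show "k = k'" by (simp add: vec_eq_iff)
    qed
    show "(\<lambda>k i. k $ i mod int r) ` block r \<kappa> x \<subseteq> PiE UNIV (\<lambda>_. {0..<int r})"
      using assms by auto
    show "finite (PiE (UNIV :: 'd set) (\<lambda>_. {0..<int r}))" by (intro finite_PiE) auto
  qed
  then show ?thesis by (simp add: card_PiE)
qed

text \<open>Needed to integrate the pointwise reconstruction over \<open>x\<close>: a fixed cell
  enters the bound only for points of its own block, which lies in a box of side
  \<open>r / \<kappa>\<close>.\<close>

lemma block_region_measure_le: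
  assumes r: "1 \<le> r" and \<kappa>: "1 \<le> \<kappa>"
  shows "{x \<in> unit_cube. k \<in> block r \<kappa> x} \<in> sets (borel :: (real ^ 'd) measure)"
    and "emeasure lborel {x \<in> unit_cube. k \<in> block r \<kappa> (x :: real ^ 'd)} \<le> ennreal ((real r / real \<kappa>) ^ CARD('d))"
proof -
  define a :: "real ^ 'd" where "a = (\<chi> i. of_int (int r * (k $ i div int r)) / real \<kappa>)"
  have pos: "real \<kappa> > 0" using \<kappa> by simp
  have "(cube_index \<kappa> :: real ^ 'd \<Rightarrow> _) -` {c. k \<in> cells \<kappa> \<and> (\<forall>i. k $ i div int r = c $ i div int r)} \<inter> space borel \<in> sets borel"
    by (rule measurable_sets[OF cube_index_measurable]) simp
  then have "{x. k \<in> block r \<kappa> x} \<in> sets (borel :: (real ^ 'd) measure)"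
    by (simp add: block_def vimage_def)
  then have "unit_cube \<inter> {x. k \<in> block r \<kappa> x} \<in> sets (borel :: (real ^ 'd) measure)"
    by auto
  then show "{x \<in> unit_cube. k \<in> block r \<kappa> x} \<in> sets (borel :: (real ^ 'd) measure)"
    by (simp add: Int_def)
  have sub: "{x \<in> unit_cube. k \<in> block r \<kappa> x} \<subseteq> cbox a (a + (\<chi> i. real r / real \<kappa>))"
  proof
    fix x :: "real ^ 'd" assume "x \<in> {x \<in> unit_cube. k \<in> block r \<kappa> x}"
    then have x: "x \<in> unit_cube" and blk: "\<And>i. k $ i div int r = cube_index \<kappa> x $ i div int r"
      and cell: "k \<in> cells \<kappa>"
      by (auto simp: block_def)
    have "a $ i \<le> x $ i \<and> x $ i \<le> a $ i + real r / real \<kappa>" for i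
    proof -
      let ?c = "cube_index \<kappa> x $ i" and ?b = "int r * (k $ i div int r)"
      have eq: "?c = ?b + ?c mod int r" unfolding blk by simp
      have mod: "0 \<le> ?c mod int r" "?c mod int r < int r" using r by auto
      have "?b \<le> \<lfloor>real \<kappa> * x $ i\<rfloor>" using eq mod(1) by (simp add: cube_index_def)
      then have lo: "of_int ?b \<le> real \<kappa> * x $ i" by linarith
      have "\<lfloor>real \<kappa> * x $ i\<rfloor> \<le> ?c \<or> ?c = int \<kappa> - 1" by (auto simp: cube_index_def)
      then have "real \<kappa> * x $ i \<le> of_int ?c + 1"
      proof
        assume "?c = int \<kappa> - 1"
        moreover have "real \<kappa> * x $ i \<le> real \<kappa>" using x pos by (simp add: mem_box_cart)
        ultimately show ?thesis by simp
      qed linarith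
      moreover have "?c + 1 \<le> ?b + int r" using eq mod(2) by linarith
      then have "real_of_int ?c + 1 \<le> of_int ?b + real r" by linarith
      ultimately have hi: "real \<kappa> * x $ i \<le> of_int ?b + real r" by linarith
      have "a $ i = of_int ?b / real \<kappa>" by (simp add: a_def)
      then show ?thesis
        using lo hi pos by (simp add: add_divide_distrib[symmetric] pos_divide_le_eq pos_le_divide_eq mult.commute)
    qed
    then show "x \<in> cbox a (a + (\<chi> i. real r / real \<kappa>))" by (simp add: mem_box_cart)
  qed
  have "emeasure lborel {x \<in> unit_cube. k \<in> block r \<kappa> x}
      \<le> emeasure lborel (cbox a (a + (\<chi> i. real r / real \<kappa>)))"
    by (rule emeasure_mono[OF sub]) simp
  also have "\<dots> = ennreal (\<Prod>b\<in>Basis. ((a + (\<chi> i. real r / real \<kappa>)) - a) \<bullet> b)"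
    by (rule emeasure_lborel_cbox) (auto simp: Basis_vec_def inner_axis)
  also have "(\<Prod>b\<in>Basis. ((a + (\<chi> i. real r / real \<kappa>)) - a) \<bullet> b) = (real r / real \<kappa>) ^ CARD('d)"
    by (simp add: prod_Basis_vec inner_axis)
  finally show "emeasure lborel {x \<in> unit_cube. k \<in> block r \<kappa> x} \<le> ennreal ((real r / real \<kappa>) ^ CARD('d))" .
qed

text \<open>Square the pointwise reconstruction, use Cauchy-Schwarz over the at most r^d cells of a
  block, and integrate over \<open>x\<close>. Each cell is then weighted by the volume (r /
  \<kappa>)^d of its region, which reduces the factor \<kappa>^(2 d) to \<kappa>^d and leaves r^(2
  d) in \<open>C1\<close>.\<close>

lemma discretisation_bias:
  fixes s L :: real
  assumes s: "0 < s" and L: "0 < L" and r: "nat \<lfloor>s\<rfloor> < r"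
  shows "\<exists>C1 C2. 0 < C1 \<and> 0 < C2 \<and> (\<forall>f \<in> holder_class s L. \<forall>g \<in> holder_class s L.
    \<forall>P Q :: (real ^ 'd) measure. \<forall>\<kappa>. has_cube_density P f \<longrightarrow> has_cube_density Q g \<longrightarrow> 1 \<le> \<kappa> \<longrightarrow> r dvd \<kappa> \<longrightarrow>
    (L2_norm_cube (\<lambda>x. f x - g x))\<^sup>2
      \<le> C1 * real \<kappa> ^ CARD('d) * cell_dist P Q \<kappa> + C2 * (real \<kappa> powr (- s))\<^sup>2)"
proof -
  obtain A E where AE: "0 < A" "0 < E" and all: "\<forall>f \<in> holder_class s L. \<forall>g \<in> holder_class s L. \<forall>c \<in> {0, 1}. \<forall>\<kappa> x.
    1 \<le> \<kappa> \<longrightarrow> r dvd \<kappa> \<longrightarrow> x \<in> (unit_cube :: (real ^ 'd) set) \<longrightarrow>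
    \<bar>f x - c * g x\<bar> \<le> A * real \<kappa> ^ CARD('d) * (\<Sum>k\<in>block r \<kappa> x. \<bar>cell_integral \<kappa> (\<lambda>x. f x - c * g x) k\<bar>)
      + E * real \<kappa> powr (- s)"
    using holder_reconstruction[OF s L r, where 'd = 'd] by (elim exE conjE) (rule that)
  note bound = all[rule_format]
  have r1: "1 \<le> r" using r by simp
  define C1 where "C1 = 2 * A\<^sup>2 * (real r ^ CARD('d))\<^sup>2"
  define C2 where "C2 = 2 * E\<^sup>2"
  have "0 < C1" "0 < C2" using AE r1 by (auto simp: C1_def C2_def)
  moreover have "(L2_norm_cube (\<lambda>x. f x - g x))\<^sup>2
      \<le> C1 * real \<kappa> ^ CARD('d) * cell_dist P Q \<kappa> + C2 * (real \<kappa> powr (- s))\<^sup>2"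
    if f: "f \<in> holder_class s L" and g: "g \<in> holder_class s L"
      and P: "has_cube_density P f" and Q: "has_cube_density Q g" and \<kappa>: "1 \<le> \<kappa>" and dvd: "r dvd \<kappa>"
    for f g and P Q :: "(real ^ 'd) measure" and \<kappa>
  proof -
    define h where "h x = f x - g x" for x
    define \<Delta> where "\<Delta> k = cell_integral \<kappa> h k" for k
    define K where "K = real \<kappa> ^ CARD('d)"
    define B :: "int ^ 'd \<Rightarrow> (real ^ 'd) set" where "B k = {x \<in> unit_cube. k \<in> block r \<kappa> x}" for k
    define E' where "E' = E * real \<kappa> powr (- s)"
    have K: "K > 0" using \<kappa> by (simp add: K_def)
    have fc: "continuous_on unit_cube f" and gc: "continuous_on unit_cube g"
      by (rule holder_continuous_on[OF s f], rule holder_continuous_on[OF s g])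
    have hc: "continuous_on unit_cube h" unfolding h_def by (intro continuous_intros fc gc)
    have dist: "cell_dist P Q \<kappa> = (\<Sum>k\<in>cells \<kappa>. (\<Delta> k)\<^sup>2)"
      unfolding cell_dist_def
    proof (rule sum.cong[OF refl])
      fix k :: "int ^ 'd" assume k: "k \<in> cells \<kappa>"
      have "\<Delta> k = (\<integral>x. indicator (open_cell \<kappa> k) x * on_cube f x - indicator (open_cell \<kappa> k) x * on_cube g x \<partial>lborel)"
        by (simp add: \<Delta>_def cell_integral_def h_def on_cube_def algebra_simps)
      also have "\<dots> = cell_prob P \<kappa> k - cell_prob Q \<kappa> k"
        unfolding cell_prob_density[OF P fc \<kappa> k] cell_prob_density[OF Q gc \<kappa> k] cell_integral_def
        by (intro Bochner_Integration.integral_diff on_cube_integrable fc gc) auto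
      finally show "(cell_prob P \<kappa> k - cell_prob Q \<kappa> k)\<^sup>2 = (\<Delta> k)\<^sup>2" by simp
    qed
    have B_sets [measurable]: "B k \<in> sets borel" for k
      unfolding B_def by (rule block_region_measure_le(1)[OF r1 \<kappa>])
    have B_em: "emeasure lborel (B k) \<le> ennreal ((real r / real \<kappa>) ^ CARD('d))" for k
      unfolding B_def by (rule block_region_measure_le(2)[OF r1 \<kappa>])
    then have B_fin: "emeasure lborel (B k) < \<infinity>" for k
      using ennreal_less_top le_less_trans infinity_ennreal_def by metis
    have B_measure: "measure lborel (B k) \<le> (real r / real \<kappa>) ^ CARD('d)" for k
      unfolding measure_def using B_em[of k] by (simp add: enn2real_leI)
    have pt: "(h x)\<^sup>2 \<le> 2 * A\<^sup>2 * K\<^sup>2 * real r ^ CARD('d) *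
        (\<Sum>k\<in>cells \<kappa>. indicator (B k) x * (\<Delta> k)\<^sup>2) + 2 * E'\<^sup>2"
      if x: "x \<in> unit_cube" for x :: "real ^ 'd"
    proof -
      define T where "T = (\<Sum>k\<in>block r \<kappa> x. \<bar>\<Delta> k\<bar>)"
      have "\<bar>h x\<bar> \<le> A * K * T + E'"
        using bound[OF f g _ \<kappa> dvd x, of 1] by (simp add: h_def[abs_def] \<Delta>_def T_def K_def E'_def)
      then have "(h x)\<^sup>2 \<le> (A * K * T + E')\<^sup>2" using power_mono[of "\<bar>h x\<bar>" _ 2] by simp
      also have "\<dots> \<le> 2 * (A * K * T)\<^sup>2 + 2 * E'\<^sup>2"
        using zero_le_power2[of "A * K * T - E'"] by (simp add: power2_eq_square algebra_simps)
      also have "(A * K * T)\<^sup>2 = A\<^sup>2 * K\<^sup>2 * T\<^sup>2" by (simp add: power_mult_distrib)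
      finally have 1: "(h x)\<^sup>2 \<le> 2 * (A\<^sup>2 * K\<^sup>2 * T\<^sup>2) + 2 * E'\<^sup>2" .
      have "T\<^sup>2 \<le> (\<Sum>k\<in>block r \<kappa> x. \<bar>\<Delta> k\<bar>\<^sup>2) * real (card (block r \<kappa> x))"
        unfolding T_def by (rule sum_squared_le_sum_of_squares)
      also have "\<dots> \<le> (\<Sum>k\<in>block r \<kappa> x. \<bar>\<Delta> k\<bar>\<^sup>2) * real r ^ CARD('d)"
      proof (rule mult_left_mono)
        have "real (card (block r \<kappa> x)) \<le> real (r ^ CARD('d))"
          by (rule of_nat_mono[OF card_block_le[OF r1]])
        then show "real (card (block r \<kappa> x)) \<le> real r ^ CARD('d)" by simp
      qed (auto intro: sum_nonneg)
      also have "(\<Sum>k\<in>block r \<kappa> x. \<bar>\<Delta> k\<bar>\<^sup>2) = (\<Sum>k\<in>cells \<kappa>. indicator (B k) x * (\<Delta> k)\<^sup>2)"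
      proof (rule sum.mono_neutral_cong_left[OF finite_cells])
        show "block r \<kappa> x \<subseteq> cells \<kappa>" by (auto simp: block_def)
        show "\<forall>k\<in>cells \<kappa> - block r \<kappa> x. indicator (B k) x * (\<Delta> k)\<^sup>2 = 0" by (auto simp: B_def)
        show "\<bar>\<Delta> k\<bar>\<^sup>2 = indicator (B k) x * (\<Delta> k)\<^sup>2" if "k \<in> block r \<kappa> x" for k
          using that x by (simp add: B_def)
      qed
      finally have "2 * (A\<^sup>2 * K\<^sup>2 * T\<^sup>2) \<le> 2 * (A\<^sup>2 * K\<^sup>2 *
          ((\<Sum>k\<in>cells \<kappa>. indicator (B k) x * (\<Delta> k)\<^sup>2) * real r ^ CARD('d)))"
        by (intro mult_left_mono) auto
      with 1 show ?thesis by (simp add: mult_ac)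
    qed
    have int_B: "integrable lborel (indicator (B k) :: _ \<Rightarrow> real)" for k
      using B_fin by (intro integrable_real_indicator) auto
    have int_cube: "integrable lborel (indicator unit_cube :: real ^ 'd \<Rightarrow> real)"
      by (intro integrable_real_indicator) (auto simp: emeasure_lborel_cbox_eq)
    have "(L2_norm_cube h)\<^sup>2 = (\<integral>x. indicator unit_cube x *\<^sub>R (h x)\<^sup>2 \<partial>lborel)"
      unfolding L2_norm_cube_def set_lebesgue_integral_def
      by (rule real_sqrt_pow2) (rule integral_nonneg_AE, simp)
    also have "\<dots> \<le> (\<integral>x. 2 * A\<^sup>2 * K\<^sup>2 * real r ^ CARD('d) * (\<Sum>k\<in>cells \<kappa>. indicator (B k) x * (\<Delta> k)\<^sup>2)
        + indicator unit_cube x * (2 * E'\<^sup>2) \<partial>lborel)"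
    proof (rule integral_mono)
      have "continuous_on unit_cube (\<lambda>x. (h x)\<^sup>2)" by (intro continuous_intros hc)
      from on_cube_integrable[OF this, of UNIV]
      show "integrable lborel (\<lambda>x. indicator unit_cube x *\<^sub>R (h x)\<^sup>2)"
        by (simp add: on_cube_def)
      show "integrable lborel (\<lambda>x. 2 * A\<^sup>2 * K\<^sup>2 * real r ^ CARD('d) * (\<Sum>k\<in>cells \<kappa>. indicator (B k) x * (\<Delta> k)\<^sup>2)
        + indicator unit_cube x * (2 * E'\<^sup>2))"
        using int_B int_cube by (intro Bochner_Integration.integrable_add integrable_mult_right integrable_mult_left
            Bochner_Integration.integrable_sum) auto
      fix x :: "real ^ 'd"
      show "indicator unit_cube x *\<^sub>R (h x)\<^sup>2 \<le> 2 * A\<^sup>2 * K\<^sup>2 * real r ^ CARD('d) *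
          (\<Sum>k\<in>cells \<kappa>. indicator (B k) x * (\<Delta> k)\<^sup>2) + indicator unit_cube x * (2 * E'\<^sup>2)"
      proof (cases "x \<in> unit_cube")
        case True
        then show ?thesis using pt[OF True] by simp
      next
        case False
        have "0 \<le> (\<Sum>k\<in>cells \<kappa>. indicator (B k) x * (\<Delta> k)\<^sup>2)" by (intro sum_nonneg) auto
        then show ?thesis using False by simp
      qed
    qed
    also have "\<dots> = 2 * A\<^sup>2 * K\<^sup>2 * real r ^ CARD('d) * (\<Sum>k\<in>cells \<kappa>. measure lborel (B k) * (\<Delta> k)\<^sup>2)
        + measure lborel (unit_cube :: (real ^ 'd) set) * (2 * E'\<^sup>2)"
      using int_B int_cube by simp
    also have "measure lborel (unit_cube :: (real ^ 'd) set) = 1"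
      by (rule measure_unit_cube)
    also have "2 * A\<^sup>2 * K\<^sup>2 * real r ^ CARD('d) * (\<Sum>k\<in>cells \<kappa>. measure lborel (B k) * (\<Delta> k)\<^sup>2)
        \<le> 2 * A\<^sup>2 * K\<^sup>2 * real r ^ CARD('d) * (\<Sum>k\<in>cells \<kappa>. (real r / real \<kappa>) ^ CARD('d) * (\<Delta> k)\<^sup>2)"
      using B_measure by (intro mult_left_mono sum_mono mult_right_mono) auto
    also have "\<dots> = C1 * K * cell_dist P Q \<kappa>"
      using K \<kappa> unfolding C1_def dist sum_distrib_left[symmetric] K_def
      by (simp add: power_divide power2_eq_square)
    finally show ?thesis
      by (simp add: h_def[abs_def] K_def C2_def E'_def power_mult_distrib)
  qed
  ultimately show ?thesis by blast
qed

section \<open>The adaptive test\<close>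

lemma ln_ln_bounds:
  assumes "3 \<le> n"
  shows "0 < ln (ln (real n))" "ln (ln (real n)) < real n" "1 < ln (real n)"
proof -
  have "exp 1 < (3 :: real)" using e_less_272 by simp
  also have "\<dots> \<le> real n" using assms by simp
  finally have "ln (exp 1) < ln (real n)" using assms by (subst ln_less_cancel_iff) auto
  then show 1: "1 < ln (real n)" by simp
  then show "0 < ln (ln (real n))" by simp
  have "ln (ln (real n)) < ln (real n)" using 1 by (intro ln_less_self) auto
  also have "\<dots> < real n" using assms by (intro ln_less_self) auto
  finally show "ln (ln (real n)) < real n" .
qed

lemma gamma_max_pos:
  assumes "3 \<le> n" "0 < d"
  shows "1 \<le> gamma_max d n"
proof -
  have "1 < real n / ln (ln (real n))" using ln_ln_bounds[OF assms(1)] by simp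
  then have "0 < 2 / real d * log 2 (real n / ln (ln (real n)))" using assms(2) by simp
  then show ?thesis unfolding gamma_max_def by linarith
qed

text \<open>Only the logarithm of the number of scales matters, so a crude bound suffices. From
  \<open>1 \<le> ln (ln (real n))\<close> the quotient inside \<open>gamma_max\<close> is at most
  \<open>n\<close>, and \<open>log 2\<close> is at most 3/2 times \<open>ln\<close>; the rounding
  adds 1, which is at most \<open>ln (real n)\<close>.\<close>

lemma gamma_max_le:
  assumes n: "3 \<le> n" and d: "0 < d" and l: "1 \<le> ln (ln (real n))"
  shows "real (gamma_max d n) \<le> 4 * ln (real n)"
proof -
  note b = ln_ln_bounds[OF n]
  define x where "x = log 2 (real n / ln (ln (real n)))"
  have "1 < real n / ln (ln (real n))" using b by simp
  then have x0: "0 < x" by (simp add: x_def)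
  have "real n / ln (ln (real n)) \<le> real n / 1"
    using b l by (intro divide_left_mono) auto
  then have "x \<le> log 2 (real n)"
    unfolding x_def using b n by simp
  also have "\<dots> = ln (real n) / ln 2" by (simp add: log_def)
  also have "\<dots> \<le> ln (real n) / (2 / 3)"
    using b ln2_ge_two_thirds by (intro divide_left_mono) auto
  finally have x: "x \<le> 3 / 2 * ln (real n)" by simp
  have "2 / real d * x \<le> 2 * x"
    using x0 d by (intro mult_right_mono) (auto simp: divide_le_eq)
  then have "2 / real d * x \<le> 3 * ln (real n)" using x by simp
  moreover have "0 \<le> \<lceil>2 / real d * x\<rceil>" using x0 d by (simp add: less_imp_le order_less_le_trans[of "-1" 0])
  then have "real (gamma_max d n) = of_int \<lceil>2 / real d * x\<rceil>"
    by (simp add: gamma_max_def x_def)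
  then have "real (gamma_max d n) \<le> 2 / real d * x + 1" by linarith
  ultimately show ?thesis using b(3) by linarith
qed

text \<open>The exponent \<open>j\<close> is that of the largest power of two below the ideal scale.
  The hypothesis \<open>big\<close> makes it exceed \<open>e\<close>, so that blocks of length
  \<open>2 ^ e\<close> fit. The last bound, where \<open>q\<close> has been replaced by the smaller
  \<open>real d\<close>, is free of \<open>s\<close> and shows that the scale belongs to the grid of
  the test.\<close>

lemma ex_scale:
  fixes s \<rho> :: real and d :: nat
  defines "q \<equiv> 4 * s + real d"
  assumes s: "0 < s" and d: "0 < d" and \<rho>: "0 < \<rho>" "\<rho> \<le> 1" and big: "2 * 2 ^ e \<le> \<rho> powr (- 2 / q)"
  shows "\<exists>j. e \<le> j \<and> 1 \<le> j \<and> 2 ^ j \<le> \<rho> powr (- 2 / q) \<and> \<rho> powr (- 2 / q) < 2 * 2 ^ j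
    \<and> real j \<le> 2 / real d * log 2 (1 / \<rho>)"
proof -
  define k where "k = \<rho> powr (- 2 / q)"
  define j where "j = nat \<lfloor>log 2 k\<rfloor>"
  have q: "0 < q" "real d \<le> q" using s d by (auto simp: q_def)
  have k0: "0 < k" using \<rho> by (simp add: k_def)
  have "2 ^ (e + 1) \<le> k" using big by (simp add: k_def)
  then have "2 powr real (e + 1) \<le> k" by (subst powr_realpow) auto
  then have e: "real (e + 1) \<le> log 2 k" using k0 by (subst le_log_iff) auto
  then have j: "real j \<le> log 2 k" "log 2 k < real j + 1" unfolding j_def by linarith+
  have "e + 1 \<le> j" using e unfolding j_def by (simp add: le_nat_floor)
  moreover have "2 ^ j \<le> k" using j(1) k0 by (simp add: le_log_iff powr_realpow)
  moreover have "k < 2 * 2 ^ j"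
  proof -
    have "k < 2 powr (real j + 1)" using j(2) k0 by (simp add: log_less_iff)
    then show ?thesis by (simp add: powr_add powr_realpow)
  qed
  moreover have "real j \<le> 2 / real d * log 2 (1 / \<rho>)"
  proof -
    have "log 2 k = 2 / q * log 2 (1 / \<rho>)"
      using \<rho> by (simp add: k_def log_powr log_divide)
    also have "\<dots> \<le> 2 / real d * log 2 (1 / \<rho>)"
      using \<rho> q d by (intro mult_right_mono divide_left_mono) auto
    finally show ?thesis using j(1) by simp
  qed
  ultimately show ?thesis unfolding k_def by (intro exI[of _ j]) auto
qed

definition test_scales :: "nat \<Rightarrow> nat set" where
  "test_scales \<gamma> = {2 ^ j | j. j \<in> {1..\<gamma>}}"

lemma test_scales_image: "test_scales \<gamma> = (\<lambda>j. 2 ^ j) ` {1..\<gamma>}"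
  by (auto simp: test_scales_def)

lemma adaptive_test_cases:
  fixes x :: "nat \<Rightarrow> real ^ 'd"
  assumes "3 \<le> m"
  defines "\<gamma> \<equiv> gamma_max CARD('d) m"
  shows "adaptive_test m n \<alpha> x = 1 \<Longrightarrow> \<exists>\<kappa>\<in>test_scales \<gamma>. perm_test m n \<kappa> (\<alpha> / real \<gamma>) x = 1"
    and "adaptive_test m n \<alpha> x = 0 \<Longrightarrow> \<kappa> \<in> test_scales \<gamma> \<Longrightarrow> perm_test m n \<kappa> (\<alpha> / real \<gamma>) x = 0"
proof -
  let ?V = "(\<lambda>\<kappa>. perm_test m n \<kappa> (\<alpha> / real \<gamma>) x) ` test_scales \<gamma>"
  have "1 \<le> \<gamma>" unfolding \<gamma>_def by (rule gamma_max_pos[OF assms(1)]) simp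
  then have V: "finite ?V" "?V \<noteq> {}" by (auto simp: test_scales_image)
  have eq: "adaptive_test m n \<alpha> x = Max ?V"
    by (simp add: adaptive_test_def \<gamma>_def test_scales_def Let_def)
  show "\<exists>\<kappa>\<in>test_scales \<gamma>. perm_test m n \<kappa> (\<alpha> / real \<gamma>) x = 1" if "adaptive_test m n \<alpha> x = 1"
    using Max_in[OF V] that unfolding eq by auto
  show "perm_test m n \<kappa> (\<alpha> / real \<gamma>) x = 0" if "adaptive_test m n \<alpha> x = 0" "\<kappa> \<in> test_scales \<gamma>"
    using Max_ge[OF V(1), of "perm_test m n \<kappa> (\<alpha> / real \<gamma>) x"] that unfolding eq by auto
qed

lemma adaptive_test_level:
  fixes P :: "(real ^ 'd) measure"
  assumes P: "prob_space P" "sets P = sets borel" and m: "3 \<le> m" and \<alpha>: "0 < \<alpha>" "\<alpha> < 1"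
  shows "emeasure (pooled_sample m n P P) {x \<in> space (pooled_sample m n P P). adaptive_test m n \<alpha> x = 1} \<le> ennreal \<alpha>"
proof -
  define \<gamma> where "\<gamma> = gamma_max CARD('d) m"
  define a where "a = \<alpha> / real \<gamma>"
  have \<gamma>: "1 \<le> \<gamma>" unfolding \<gamma>_def by (rule gamma_max_pos[OF m]) simp
  have a: "0 < a" "a < 1" using \<alpha> \<gamma> by (auto simp: a_def divide_less_eq)
  let ?S = "PiM {..<m + n} (\<lambda>_. P)"
  have S: "pooled_sample m n P P = ?S" by (simp add: pooled_sample_def)
  interpret S: prob_space ?S by (rule prob_space_PiM) (rule P)
  define R where "R \<kappa> = {x \<in> space ?S. perm_test m n \<kappa> a x = 1}" for \<kappa>
  have R: "R \<kappa> \<in> sets ?S" for \<kappa>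
    unfolding R_def by (rule perm_test_sets) (use P a in auto)
  have fin: "finite (test_scales \<gamma>)" by (simp add: test_scales_image)
  have "emeasure ?S {x \<in> space ?S. adaptive_test m n \<alpha> x = 1} \<le> emeasure ?S (\<Union>\<kappa>\<in>test_scales \<gamma>. R \<kappa>)"
  proof (rule emeasure_mono)
    show "{x \<in> space ?S. adaptive_test m n \<alpha> x = 1} \<subseteq> (\<Union>\<kappa>\<in>test_scales \<gamma>. R \<kappa>)"
      using adaptive_test_cases(1)[OF m, where 'd = 'd] unfolding R_def a_def \<gamma>_def by blast
  qed (use R fin in auto)
  also have "\<dots> = ennreal (measure ?S (\<Union>\<kappa>\<in>test_scales \<gamma>. R \<kappa>))"
    by (rule S.emeasure_eq_measure)
  also have "measure ?S (\<Union>\<kappa>\<in>test_scales \<gamma>. R \<kappa>) \<le> (\<Sum>\<kappa>\<in>test_scales \<gamma>. measure ?S (R \<kappa>))"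
    by (rule measure_UNION_le[OF fin R])
  also have "\<dots> \<le> (\<Sum>\<kappa>\<in>test_scales \<gamma>. a)"
    unfolding R_def by (intro sum_mono perm_test_level P a)
  also have "\<dots> \<le> real \<gamma> * a"
  proof -
    have "card (test_scales \<gamma>) \<le> \<gamma>"
      unfolding test_scales_image by (rule order_trans[OF card_image_le]) auto
    then show ?thesis using a by simp
  qed
  also have "real \<gamma> * a = \<alpha>" using \<gamma> by (simp add: a_def)
  finally show ?thesis unfolding S by (simp add: ennreal_leI)
qed

text \<open>In terms of the normalised signal \<open>Z = m * D * X\<close> the three terms of
  \<open>perm_test_type_II\<close> are of order 1 / (X Z), 1 / Z^2 and u^2 / Z^2. Since
  \<open>T * l \<le> Z\<close> and \<open>u \<le> K * l\<close>, the factor \<open>l\<close> cancels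
  in the last one; 1600 is 64 + 1536.\<close>

lemma type_II_arithmetic:
  fixes M X m D R K l T \<tau> u v :: real
  assumes M: "0 < M" and X: "1 \<le> X" and pos: "0 < m" "0 < D" and l: "1 \<le> l" and T: "1 \<le> T"
    and key: "T * l \<le> m * D * X" and v: "0 \<le> v" "v \<le> R" and u: "0 \<le> u" "u \<le> K * l" and \<tau>: "\<tau> = M / X\<^sup>2"
  shows "64 * \<tau> / (m * D) + 1536 * \<tau> / (m * D)\<^sup>2 + 4096 * \<tau> * v\<^sup>2 * u\<^sup>2 / (m * D)\<^sup>2
    \<le> M * (1600 + 4096 * R\<^sup>2 * K\<^sup>2) / T"
proof -
  define Z where "Z = m * D * X"
  have Tl: "1 \<le> T * l" "T \<le> T * l" using T l mult_mono[of 1 T 1 l] mult_left_mono[of 1 l T] by auto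
  have Z: "T * l \<le> Z" "T \<le> Z" "0 < Z" using key Tl T unfolding Z_def by linarith+
  have "64 * \<tau> / (m * D) = 64 * M / (X * Z)"
    using X pos by (simp add: \<tau> Z_def power2_eq_square field_simps)
  also have "\<dots> \<le> 64 * M / (1 * T)"
    using M X Z T by (intro divide_left_mono mult_mono mult_pos_pos) auto
  finally have 1: "64 * \<tau> / (m * D) \<le> 64 * M / T" by simp
  have "1536 * \<tau> / (m * D)\<^sup>2 = 1536 * M / Z\<^sup>2"
    using X pos by (simp add: \<tau> Z_def power2_eq_square field_simps)
  also have "\<dots> \<le> 1536 * M / T"
  proof (intro divide_left_mono)
    have "T * 1 \<le> Z * Z" using Z T by (intro mult_mono) auto
    then show "T \<le> Z\<^sup>2" by (simp add: power2_eq_square)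
  qed (use M Z T in auto)
  finally have 2: "1536 * \<tau> / (m * D)\<^sup>2 \<le> 1536 * M / T" .
  have "4096 * \<tau> * v\<^sup>2 * u\<^sup>2 / (m * D)\<^sup>2 = 4096 * M * v\<^sup>2 * (u\<^sup>2 / Z\<^sup>2)"
    using X pos by (simp add: \<tau> Z_def power2_eq_square field_simps)
  also have "\<dots> \<le> 4096 * M * R\<^sup>2 * (K\<^sup>2 / T)"
  proof (intro mult_mono)
    show "v\<^sup>2 \<le> R\<^sup>2" using v by (intro power_mono) auto
    have "u\<^sup>2 / Z\<^sup>2 \<le> (K * l)\<^sup>2 / (T * l)\<^sup>2"
      using u Z Tl by (intro frac_le power_mono) auto
    also have "\<dots> = K\<^sup>2 / T\<^sup>2" using l by (simp add: power_mult_distrib)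
    also have "\<dots> \<le> K\<^sup>2 / T"
      using T by (intro divide_left_mono) (auto simp: power2_eq_square)
    finally show "u\<^sup>2 / Z\<^sup>2 \<le> K\<^sup>2 / T" .
  qed (use M T in auto)
  finally have 3: "4096 * \<tau> * v\<^sup>2 * u\<^sup>2 / (m * D)\<^sup>2 \<le> 4096 * M * R\<^sup>2 * (K\<^sup>2 / T)" .
  have "64 * M / T + 1536 * M / T + 4096 * M * R\<^sup>2 * (K\<^sup>2 / T) = M * (1600 + 4096 * R\<^sup>2 * K\<^sup>2) / T"
    using T by (simp add: field_simps)
  then show ?thesis using 1 2 3 by linarith
qed

section \<open>Power of the adaptive test at the optimal scale\<close>

lemma L2_norm_cube_le:
  assumes cont: "continuous_on unit_cube (h :: real ^ 'd \<Rightarrow> real)" and M: "0 \<le> M" "\<And>x. x \<in> unit_cube \<Longrightarrow> \<bar>h x\<bar> \<le> M"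
  shows "L2_norm_cube h \<le> M"
proof -
  have "(\<integral>x. indicator unit_cube x *\<^sub>R (h x)\<^sup>2 \<partial>lborel) \<le> (\<integral>x. indicator (unit_cube :: (real ^ 'd) set) x * M\<^sup>2 \<partial>lborel)"
  proof (rule integral_mono)
    have "continuous_on unit_cube (\<lambda>x. (h x)\<^sup>2)" by (intro continuous_intros cont)
    from on_cube_integrable[OF this, of UNIV]
    show "integrable lborel (\<lambda>x. indicator unit_cube x *\<^sub>R (h x)\<^sup>2)"
      by (simp add: on_cube_def)
    show "integrable lborel (\<lambda>x. indicator (unit_cube :: (real ^ 'd) set) x * M\<^sup>2)"
      by (intro integrable_mult_left integrable_real_indicator) (auto simp: emeasure_lborel_cbox_eq)
    show "indicator unit_cube x *\<^sub>R (h x)\<^sup>2 \<le> indicator unit_cube x * M\<^sup>2" for x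
      using M(2)[of x] power_mono[of "\<bar>h x\<bar>" M 2] by (auto simp: indicator_def)
  qed
  also have "\<dots> = M\<^sup>2"
    using measure_unit_cube[where 'd = 'd] by simp
  finally show ?thesis
    unfolding L2_norm_cube_def set_lebesgue_integral_def using M(1)
    by (metis real_sqrt_le_mono real_sqrt_unique)
qed

text \<open>The adaptive test accepts only if every single test accepts, so one good scale decides
  the power. The unknown \<open>s\<close> selects that scale in the analysis only; the price is that
  the single test runs at level \<open>\<alpha> / \<gamma>\<close>.\<close>

lemma adaptive_test_type_II:
  fixes s L \<alpha> \<beta> c\<^sub>0 :: real
  assumes s: "0 < s" and L: "0 < L" and \<alpha>: "0 < \<alpha>" "\<alpha> < 1" and \<beta>: "0 < \<beta>"
  shows "\<exists>C>0. \<forall>m n :: nat. \<forall>\<epsilon>. 3 \<le> m \<longrightarrow> m \<le> n \<longrightarrow> real n \<le> c\<^sub>0 * real m \<longrightarrow>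
    C * (ln (ln (real m)) / real m) powr (2 * s / (4 * s + real CARD('d))) \<le> \<epsilon> \<longrightarrow>
    (\<forall>(P, Q) \<in> (holder_alt s L \<epsilon> :: ((real ^ 'd) measure \<times> (real ^ 'd) measure) set).
      emeasure (pooled_sample m n P Q) {x \<in> space (pooled_sample m n P Q). adaptive_test m n \<alpha> x = 0} \<le> ennreal \<beta>)"
proof -
  define d where "d = CARD('d)"
  define q where "q = 4 * s + real d"
  define e where "e = nat \<lfloor>s\<rfloor>"
  \<comment> \<open>A power of two divides every dyadic scale that is not smaller, and
    \<open>2 ^ e\<close> exceeds \<open>e\<close>, as the reconstruction requires.\<close>
  define r where "r = (2 :: nat) ^ e"
  have d: "0 < d" by (simp add: d_def)
  have q: "0 < q" using s d by (simp add: q_def)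
  have r: "nat \<lfloor>s\<rfloor> < r" unfolding r_def e_def by (rule less_exp)
  obtain M where M: "0 < M" and M_all: "\<forall>f \<in> holder_class s L. \<forall>P :: (real ^ 'd) measure. has_cube_density P f \<longrightarrow>
    (\<forall>x\<in>unit_cube. f x \<le> M)"
    using ex_density_bound[OF s L, where 'd = 'd] by (elim exE conjE) (rule that)
  obtain C1 C2 where C12: "0 < C1" "0 < C2" and bias_all: "\<forall>f \<in> holder_class s L. \<forall>g \<in> holder_class s L.
    \<forall>P Q :: (real ^ 'd) measure. \<forall>\<kappa>. has_cube_density P f \<longrightarrow> has_cube_density Q g \<longrightarrow> 1 \<le> \<kappa> \<longrightarrow> r dvd \<kappa> \<longrightarrow>
    (L2_norm_cube (\<lambda>x. f x - g x))\<^sup>2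
      \<le> C1 * real \<kappa> ^ CARD('d) * cell_dist P Q \<kappa> + C2 * (real \<kappa> powr (- s))\<^sup>2"
    using discretisation_bias[OF s L r, where 'd = 'd] by (elim exE conjE) (rule that)
  note bias = bias_all[rule_format]
  \<comment> \<open>The first entry forces log log m to be at least 1, the second makes the ideal
    scale at least twice the block length.\<close>
  define \<rho>0 where "\<rho>0 = min (ln (ln 3) / 27) ((2 * real r) powr (- q / 2))"
  define K where "K = ln (2 / \<alpha>) + ln 4 + 1"
  define S where "S = M * (1600 + 4096 * (1 + c\<^sub>0)\<^sup>2 * K\<^sup>2)"
  \<comment> \<open>The second summand makes the alternative empty for \<rho> above
    \<open>\<rho>0\<close>, the third keeps the discretisation error below half of the squared
    separation (with \<open>2 powr s\<close> for rounding the scale down to a power of two), and the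
    fourth gives \<open>1 + S / \<beta> \<le> T\<close>, hence error at most \<beta>.\<close>
  define C where "C = 1 + (M + 1) / \<rho>0 powr (2 * s / q) + sqrt (2 * C2) * 2 powr s + sqrt (2 * C1 * (1 + S / \<beta>))"
  have r0: "0 < real r" by (simp add: r_def)
  have \<rho>0: "0 < \<rho>0" unfolding \<rho>0_def using ln_ln_bounds(1)[of 3] r0 by simp
  have S0: "0 < S" unfolding S_def using M by (intro mult_pos_pos add_pos_nonneg) auto
  have C_parts: "0 \<le> (M + 1) / \<rho>0 powr (2 * s / q)" "0 \<le> sqrt (2 * C2) * 2 powr s" "0 \<le> sqrt (2 * C1 * (1 + S / \<beta>))"
    using M C12 S0 \<beta> by auto
  have C: "1 \<le> C" "(M + 1) / \<rho>0 powr (2 * s / q) \<le> C" "sqrt (2 * C2) * 2 powr s \<le> C" "sqrt (2 * C1 * (1 + S / \<beta>)) \<le> C"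
    unfolding C_def using C_parts by linarith+
  have "emeasure (pooled_sample m n P Q) {x \<in> space (pooled_sample m n P Q). adaptive_test m n \<alpha> x = 0} \<le> ennreal \<beta>"
    if m: "3 \<le> m" and mn: "m \<le> n" and c0: "real n \<le> c\<^sub>0 * real m"
      and eps: "C * (ln (ln (real m)) / real m) powr (2 * s / q) \<le> \<epsilon>" and alt: "(P, Q) \<in> holder_alt s L \<epsilon>"
    for m n \<epsilon> and P Q :: "(real ^ 'd) measure"
  proof -
    define l where "l = ln (ln (real m))"
    define \<rho> where "\<rho> = l / real m"
    have l0: "0 < l" "l < real m" using ln_ln_bounds[OF m] by (auto simp: l_def)
    have \<rho>: "0 < \<rho>" "\<rho> < 1" using l0 by (auto simp: \<rho>_def)
    have m0: "0 < real m" using m by simp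
    obtain f g where f: "f \<in> holder_class s L" and g: "g \<in> holder_class s L"
      and P: "has_cube_density P f" and Q: "has_cube_density Q g"
      and sep: "\<epsilon> \<le> L2_norm_cube (\<lambda>x. f x - g x)"
      using alt unfolding holder_alt_def by blast
    have fM: "\<And>x. x \<in> unit_cube \<Longrightarrow> f x \<le> M" and gM: "\<And>x. x \<in> unit_cube \<Longrightarrow> g x \<le> M"
      using M_all f g P Q by blast+
    have f0: "\<And>x. x \<in> unit_cube \<Longrightarrow> 0 \<le> f x" and g0: "\<And>x. x \<in> unit_cube \<Longrightarrow> 0 \<le> g x"
      using P Q by (auto simp: has_cube_density_def)
    have fc: "continuous_on unit_cube f" and gc: "continuous_on unit_cube g"
      by (rule holder_continuous_on[OF s f], rule holder_continuous_on[OF s g])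
    define y where "y = \<rho> powr (2 * s / q)"
    have y0: "0 < y" using \<rho> by (simp add: y_def)
    have eps': "C * y \<le> \<epsilon>" using eps by (simp add: y_def \<rho>_def l_def)
    \<comment> \<open>Otherwise the required separation would exceed \<open>M\<close>, although two
      densities with values in [0, M] on a cube of volume 1 have L2 distance at most
      \<open>M\<close>.\<close>
    have small: "\<rho> \<le> \<rho>0"
    proof (rule ccontr)
      assume "\<not> \<rho> \<le> \<rho>0"
      then have "\<rho>0 powr (2 * s / q) \<le> y"
        unfolding y_def using \<rho>0 s q by (intro powr_mono2) auto
      then have "(M + 1) / \<rho>0 powr (2 * s / q) * \<rho>0 powr (2 * s / q) \<le> C * y"
        using C C_parts by (intro mult_mono) auto
      then have "M + 1 \<le> C * y" using \<rho>0 by simp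
      also have "\<dots> \<le> L2_norm_cube (\<lambda>x. f x - g x)" using eps' sep by linarith
      also have "\<dots> \<le> M"
      proof (rule L2_norm_cube_le)
        show "\<bar>f x - g x\<bar> \<le> M" if "x \<in> unit_cube" for x
          using fM[OF that] gM[OF that] f0[OF that] g0[OF that] by linarith
      qed (use M in \<open>auto intro!: continuous_intros fc gc\<close>)
      finally show False by simp
    qed
    \<comment> \<open>If \<open>l < 1\<close>, then \<open>ln m\<close> is below e, so
      \<open>m\<close> is below 27, and \<rho> would exceed \<open>ln (ln 3) / 27\<close>. With
      \<open>l \<ge> 1\<close> constants such as \<open>ln (2 / \<alpha>)\<close> can be absorbed
      into a multiple of \<open>l\<close>.\<close>
    have l1: "1 \<le> l"
    proof (rule ccontr)
      assume "\<not> 1 \<le> l"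
      then have "ln (real m) < exp 1"
        unfolding l_def using ln_ln_bounds[OF m] by (metis exp_less_cancel_iff exp_ln less_trans not_le zero_less_one)
      also have "\<dots> \<le> 3" by (rule exp_le)
      finally have "real m < exp 3" using m0 by (metis exp_less_cancel_iff exp_ln)
      also have "\<dots> = exp 1 ^ 3" by (simp add: exp_of_nat_mult[symmetric])
      also have "\<dots> \<le> 3 ^ 3" by (intro power_mono exp_le) auto
      finally have "real m < 27" by simp
      moreover have "ln (ln 3) \<le> l"
        unfolding l_def using m ln_ln_bounds(3)[of 3] by (intro ln_mono) auto
      ultimately have "ln (ln 3) / 27 < \<rho>"
        unfolding \<rho>_def using m0 l0 ln_ln_bounds(3)[of 3] by (intro frac_less2) auto
      then show False using small by (simp add: \<rho>0_def)
    qed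
    have big: "2 * 2 ^ e \<le> \<rho> powr (- 2 / q)"
    proof -
      have "\<rho> \<le> (2 * real r) powr (- q / 2)" using small by (simp add: \<rho>0_def)
      then have "((2 * real r) powr (- q / 2)) powr (- 2 / q) \<le> \<rho> powr (- 2 / q)"
        using \<rho> q by (intro powr_mono2') auto
      then show ?thesis using q r0 by (simp add: powr_powr r_def)
    qed
    obtain j where j: "e \<le> j" "1 \<le> j" "2 ^ j \<le> \<rho> powr (- 2 / q)" "\<rho> powr (- 2 / q) < 2 * 2 ^ j"
      "real j \<le> 2 / real d * log 2 (1 / \<rho>)"
      using ex_scale[OF s d \<rho>(1) less_imp_le[OF \<rho>(2)] big[unfolded q_def]] unfolding q_def by blast
    define \<kappa> where "\<kappa> = (2 :: nat) ^ j"
    define \<gamma> where "\<gamma> = gamma_max d m"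
    define a where "a = \<alpha> / real \<gamma>"
    have \<gamma>: "1 \<le> \<gamma>" unfolding \<gamma>_def by (rule gamma_max_pos[OF m d])
    have a: "0 < a" "a < 1" using \<alpha> \<gamma> by (auto simp: a_def divide_less_eq)
    have "j \<le> \<gamma>"
    proof -
      have "real j \<le> 2 / real d * log 2 (real m / l)" using j(5) by (simp add: \<rho>_def)
      then show ?thesis unfolding \<gamma>_def gamma_max_def l_def[symmetric] by linarith
    qed
    then have \<kappa>_scale: "\<kappa> \<in> test_scales \<gamma>" using j(2) by (auto simp: test_scales_def \<kappa>_def)
    have \<kappa>1: "1 \<le> \<kappa>" by (simp add: \<kappa>_def)
    have dvd: "r dvd \<kappa>" unfolding r_def \<kappa>_def by (rule le_imp_power_dvd[OF j(1)])
    have \<kappa>r: "real \<kappa> = 2 ^ j" by (simp add: \<kappa>_def)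
    define X where "X = real \<kappa> powr (real d / 2)"
    define D where "D = cell_dist P Q \<kappa>"
    have X1: "1 \<le> X" unfolding X_def using \<kappa>1 by (intro ge_one_powr_ge_zero) auto
    have X_sq: "X\<^sup>2 = real \<kappa> ^ d"
      unfolding X_def using \<kappa>1 by (simp add: powr_realpow[symmetric] powr_powr power2_eq_square powr_add[symmetric])
    have "(L2_norm_cube (\<lambda>x. f x - g x))\<^sup>2 \<le> C1 * X\<^sup>2 * D + C2 * (real \<kappa> powr (- s))\<^sup>2"
      using bias[OF f g P Q \<kappa>1 dvd] by (simp add: X_sq D_def d_def)
    moreover have "(C * y)\<^sup>2 \<le> (L2_norm_cube (\<lambda>x. f x - g x))\<^sup>2"
      using eps' sep C(1) y0 by (intro power_mono) auto
    moreover have "C2 * (real \<kappa> powr (- s))\<^sup>2 \<le> (C * y)\<^sup>2 / 2"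
    proof -
      have "\<rho> powr (- 2 / q) / 2 \<le> real \<kappa>" using j(4) by (simp add: \<kappa>r)
      then have "real \<kappa> powr (- s) \<le> (\<rho> powr (- 2 / q) / 2) powr (- s)"
        using \<rho> s by (intro powr_mono2') auto
      also have "\<dots> = 2 powr s * y"
        using \<rho> by (simp add: powr_divide powr_powr y_def powr_minus divide_simps mult.commute powr_mult)
      finally have "real \<kappa> powr (- s) \<le> 2 powr s * y" .
      then have "C2 * (real \<kappa> powr (- s))\<^sup>2 \<le> C2 * (2 powr s * y)\<^sup>2"
        using C12 by (intro mult_left_mono power_mono) auto
      also have "\<dots> = (sqrt (2 * C2) * 2 powr s * y)\<^sup>2 / 2"
        using C12 by (simp add: power_mult_distrib)
      also have "\<dots> \<le> (C * y)\<^sup>2 / 2"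
        using C(3) C_parts C12 y0 by (intro divide_right_mono power_mono mult_right_mono mult_nonneg_nonneg) auto
      finally show ?thesis .
    qed
    ultimately have D_low: "(C * y)\<^sup>2 / 2 \<le> C1 * X\<^sup>2 * D" by linarith
    \<comment> \<open>The signal-to-noise ratio that remains after half of the squared separation
      has been spent on the bias.\<close>
    define T where "T = C\<^sup>2 / (2 * C1)"
    have T: "1 + S / \<beta> \<le> T"
    proof -
      have "(sqrt (2 * C1 * (1 + S / \<beta>)))\<^sup>2 \<le> C\<^sup>2" using C(4) C_parts by (intro power_mono) auto
      then have "2 * C1 * (1 + S / \<beta>) \<le> C\<^sup>2" using C12 S0 \<beta> by simp
      then show ?thesis unfolding T_def using C12 by (simp add: pos_le_divide_eq mult.commute)
    qed
    \<comment> \<open>The balance behind the rate: \<open>X\<close> is at most \<rho> to the power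
      -d / q, and 1 - d / q = 4 s / q is twice the exponent of \<open>y\<close>.\<close>
    have "\<rho> * X \<le> y\<^sup>2"
    proof -
      have "X \<le> (\<rho> powr (- 2 / q)) powr (real d / 2)"
        unfolding X_def using j(3) by (intro powr_mono2) (auto simp: \<kappa>r)
      also have "\<dots> = \<rho> powr (- real d / q)" by (simp add: powr_powr)
      finally have "\<rho> * X \<le> \<rho> powr 1 * \<rho> powr (- real d / q)"
        using \<rho> by (simp add: mult_left_mono)
      also have "\<dots> = \<rho> powr (4 * s / q)"
        unfolding powr_add[symmetric] using q by (simp add: q_def field_simps)
      also have "\<dots> = y\<^sup>2"
        unfolding y_def power2_eq_square powr_add[symmetric] by simp
      finally show ?thesis .
    qed
    then have "C\<^sup>2 * (\<rho> * X) / 2 \<le> C\<^sup>2 * y\<^sup>2 / 2"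
      by (intro divide_right_mono mult_left_mono) auto
    also have "\<dots> \<le> C1 * X\<^sup>2 * D" using D_low by (simp add: power_mult_distrib)
    finally have "T * \<rho> * X \<le> X\<^sup>2 * D"
      unfolding T_def using C12 by (simp add: field_simps)
    then have "X * (T * \<rho>) \<le> X * (X * D)" by (simp add: power2_eq_square mult_ac)
    then have "T * \<rho> \<le> X * D" using X1 by simp
    then have "real m * (T * \<rho>) \<le> real m * (X * D)" by (intro mult_left_mono) auto
    then have key: "T * l \<le> real m * D * X" using m0 by (simp add: \<rho>_def mult_ac)
    have T1: "1 \<le> T" using T S0 \<beta> divide_pos_pos[of S \<beta>] by linarith
    have "0 < T * l" using T1 l1 by (intro mult_pos_pos) auto
    then have "0 < (real m * X) * D" using key by (simp add: mult_ac)
    moreover have "0 < real m * X" using m0 X1 by (intro mult_pos_pos) auto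
    ultimately have D0: "0 < D" by (rule zero_less_mult_pos)
    define \<tau> where "\<tau> = M / X\<^sup>2"
    have \<tau>_eq: "\<tau> = M * (1 / real \<kappa>) ^ CARD('d)"
      using X_sq by (simp add: \<tau>_def d_def power_divide)
    interpret ts: two_sample P Q m n \<kappa> \<tau>
    proof (intro two_sample.intro two_sample_axioms.intro)
      show "cube_prob P" "cube_prob Q"
        by (rule has_cube_densityD(1)[OF P fc], rule has_cube_densityD(1)[OF Q gc])
      show "cell_prob P \<kappa> k \<le> \<tau>" "cell_prob Q \<kappa> k \<le> \<tau>" for k
        unfolding \<tau>_eq
        by (rule cell_prob_le_bound[OF P fc M fM \<kappa>1], assumption, rule cell_prob_le_bound[OF Q gc M gM \<kappa>1])
    qed (use m mn \<kappa>1 in auto)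
    have pooled: "pooled_sample m n P Q = PiM {..<m + n} (\<lambda>i. if i < m then P else Q)"
      by (simp add: pooled_sample_def)
    have "measure (pooled_sample m n P Q) {x \<in> space (pooled_sample m n P Q). perm_test m n \<kappa> a x = 0}
        \<le> 64 * \<tau> / (real m * D) + 1536 * \<tau> / (real m * D)\<^sup>2
          + 4096 * \<tau> * (real (m + n) / real m)\<^sup>2 * (ln (2 / a))\<^sup>2 / (real m * D)\<^sup>2"
      using ts.perm_test_type_II[OF a] D0 unfolding pooled D_def by simp
    also have "\<dots> \<le> M * (1600 + 4096 * (1 + c\<^sub>0)\<^sup>2 * K\<^sup>2) / T"
    proof (rule type_II_arithmetic[OF M X1 m0 D0 l1 T1 key _ _ _ _ \<tau>_def])
      show "real (m + n) / real m \<le> 1 + c\<^sub>0" using c0 m0 by (simp add: add_divide_distrib divide_le_eq)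
      have a2: "2 / a = 2 / \<alpha> * real \<gamma>" using \<alpha> \<gamma> by (simp add: a_def)
      show "0 \<le> ln (2 / a)" using a by simp
      have "ln (2 / a) = ln (2 / \<alpha>) + ln (real \<gamma>)"
        unfolding a2 using \<alpha> \<gamma> by (intro ln_mult_pos) auto
      also have "ln (real \<gamma>) \<le> ln (4 * ln (real m))"
        using gamma_max_le[OF m d] l1 \<gamma> unfolding \<gamma>_def l_def by (intro ln_mono) auto
      also have "ln (4 * ln (real m)) = ln 4 + l"
        unfolding l_def using ln_ln_bounds[OF m] by (intro ln_mult_pos) auto
      also have "ln (2 / \<alpha>) + (ln 4 + l) \<le> K * l"
      proof -
        have "0 \<le> ln (2 / \<alpha>)" "0 \<le> ln (4 :: real)" using \<alpha> by auto
        then have "(ln (2 / \<alpha>) + ln 4) * 1 \<le> (ln (2 / \<alpha>) + ln 4) * l"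
          using l1 by (intro mult_left_mono) auto
        then show ?thesis by (simp add: K_def algebra_simps)
      qed
      finally show "ln (2 / a) \<le> K * l" by simp
    qed auto
    also have "\<dots> = S / T" by (simp add: S_def)
    also have "\<dots> \<le> \<beta>"
    proof -
      have "S / \<beta> \<le> T" using T by linarith
      then show ?thesis using \<beta> T1 by (simp add: divide_le_eq mult.commute)
    qed
    finally have "measure (pooled_sample m n P Q) {x \<in> space (pooled_sample m n P Q). perm_test m n \<kappa> a x = 0} \<le> \<beta>" .
    then have le: "emeasure (pooled_sample m n P Q) {x \<in> space (pooled_sample m n P Q). perm_test m n \<kappa> a x = 0} \<le> ennreal \<beta>"
      unfolding pooled ts.S.emeasure_eq_measure by (rule ennreal_leI)
    have "emeasure (pooled_sample m n P Q) {x \<in> space (pooled_sample m n P Q). adaptive_test m n \<alpha> x = 0}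
        \<le> emeasure (pooled_sample m n P Q) {x \<in> space (pooled_sample m n P Q). perm_test m n \<kappa> a x = 0}"
    proof (rule emeasure_mono)
      show "{x \<in> space (pooled_sample m n P Q). adaptive_test m n \<alpha> x = 0}
          \<subseteq> {x \<in> space (pooled_sample m n P Q). perm_test m n \<kappa> a x = 0}"
        using adaptive_test_cases(2)[OF m, where 'd = 'd] \<kappa>_scale unfolding \<gamma>_def d_def a_def by blast
      show "{x \<in> space (pooled_sample m n P Q). perm_test m n \<kappa> a x = 0} \<in> sets (pooled_sample m n P Q)"
        unfolding pooled by (rule perm_test_sets(2)[OF _ a]) (rule ts.sets_M)
    qed
    with le show ?thesis by (rule order_trans[rotated])
  qed
  then show ?thesis
    using C(1) unfolding q_def d_def by (intro exI[of _ C]) auto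
qed

theorem proposition7p1:
  fixes s L \<alpha> \<beta> c\<^sub>0 :: real
  assumes "s > 0" and "L > 0"
    and "\<alpha> \<in> {0<..<exp (-1)}" and "\<beta> \<in> {0<..<1 - \<alpha>}"
  shows "\<exists>C>0. \<forall>n\<^sub>1 n\<^sub>2 :: nat. \<forall>\<epsilon> :: real.
    3 \<le> n\<^sub>1 \<longrightarrow> n\<^sub>1 \<le> n\<^sub>2 \<longrightarrow> real n\<^sub>2 \<le> c\<^sub>0 * real n\<^sub>1 \<longrightarrow>
    \<epsilon> \<ge> C * (ln (ln (real n\<^sub>1)) / real n\<^sub>1) powr (2 * s / (4 * s + real CARD('d::finite))) \<longrightarrow>
    (SUP (P\<^sub>Y, P\<^sub>Z) \<in> (holder_null s L :: ((real ^ 'd) measure \<times> (real ^ 'd) measure) set).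
       emeasure (pooled_sample n\<^sub>1 n\<^sub>2 P\<^sub>Y P\<^sub>Z)
         {x \<in> space (pooled_sample n\<^sub>1 n\<^sub>2 P\<^sub>Y P\<^sub>Z). adaptive_test n\<^sub>1 n\<^sub>2 \<alpha> x = 1}) \<le> ennreal \<alpha> \<and>
    (SUP (P\<^sub>Y, P\<^sub>Z) \<in> (holder_alt s L \<epsilon> :: ((real ^ 'd) measure \<times> (real ^ 'd) measure) set).
       emeasure (pooled_sample n\<^sub>1 n\<^sub>2 P\<^sub>Y P\<^sub>Z)
         {x \<in> space (pooled_sample n\<^sub>1 n\<^sub>2 P\<^sub>Y P\<^sub>Z). adaptive_test n\<^sub>1 n\<^sub>2 \<alpha> x = 0}) \<le> ennreal \<beta>"
proof -
  have "exp (-1) < (1 :: real)" by simp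
  then have \<alpha>: "0 < \<alpha>" "\<alpha> < 1" and \<beta>: "0 < \<beta>" using assms(3,4) by auto
  have null: "emeasure (pooled_sample m n P Q) {x \<in> space (pooled_sample m n P Q). adaptive_test m n \<alpha> x = 1} \<le> ennreal \<alpha>"
    if m: "3 \<le> m" and PQ: "(P, Q) \<in> holder_null s L" for m n and P Q :: "(real ^ 'd) measure"
  proof -
    obtain f g where fg: "has_cube_density P f" "has_cube_density Q g" "\<And>x. x \<in> unit_cube \<Longrightarrow> f x = g x"
      using PQ unfolding holder_null_def by blast
    have "(\<lambda>x. ennreal (indicator unit_cube x * f x)) = (\<lambda>x. ennreal (indicator unit_cube x * g x))"
      using fg(3) by (auto simp: fun_eq_iff indicator_def)
    \<comment> \<open>Only values on the cube enter the density, so under the null hypothesis the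
      pooled sample is i.i.d. from a single law.\<close>
    then have "Q = P" using fg(1,2) by (simp add: has_cube_density_def)
    moreover have "prob_space P" "sets P = sets borel" using fg(1) by (auto simp: has_cube_density_def)
    ultimately show ?thesis using adaptive_test_level[OF _ _ m \<alpha>, of P n] by simp
  qed
  obtain C where "0 < C" and alt: "\<forall>m n :: nat. \<forall>\<epsilon>. 3 \<le> m \<longrightarrow> m \<le> n \<longrightarrow> real n \<le> c\<^sub>0 * real m \<longrightarrow>
    C * (ln (ln (real m)) / real m) powr (2 * s / (4 * s + real CARD('d))) \<le> \<epsilon> \<longrightarrow>
    (\<forall>(P, Q) \<in> (holder_alt s L \<epsilon> :: ((real ^ 'd) measure \<times> (real ^ 'd) measure) set).
      emeasure (pooled_sample m n P Q) {x \<in> space (pooled_sample m n P Q). adaptive_test m n \<alpha> x = 0} \<le> ennreal \<beta>)"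
    using adaptive_test_type_II[OF assms(1,2) \<alpha> \<beta>, where 'd = 'd and c\<^sub>0 = c\<^sub>0] by (elim exE conjE) (rule that)
  show ?thesis
  proof (rule exI[of _ C], intro conjI allI impI \<open>0 < C\<close> SUP_least)
    fix m n :: nat and \<epsilon> :: real and PQ :: "(real ^ 'd) measure \<times> (real ^ 'd) measure"
    assume m: "3 \<le> m" and *: "m \<le> n" "real n \<le> c\<^sub>0 * real m"
      "C * (ln (ln (real m)) / real m) powr (2 * s / (4 * s + real CARD('d))) \<le> \<epsilon>"
    obtain P Q where PQ: "PQ = (P, Q)" by fastforce
    show "(case PQ of (P, Q) \<Rightarrow> emeasure (pooled_sample m n P Q)
        {x \<in> space (pooled_sample m n P Q). adaptive_test m n \<alpha> x = 1}) \<le> ennreal \<alpha>"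
      if "PQ \<in> holder_null s L"
      using null[OF m] that unfolding PQ by simp
    show "(case PQ of (P, Q) \<Rightarrow> emeasure (pooled_sample m n P Q)
        {x \<in> space (pooled_sample m n P Q). adaptive_test m n \<alpha> x = 0}) \<le> ennreal \<beta>"
      if "PQ \<in> holder_alt s L \<epsilon>"
      using bspec[OF alt[THEN spec, THEN spec, THEN spec, THEN mp, THEN mp, THEN mp, THEN mp, OF m *] that]
      unfolding PQ by (simp only: prod.case)
  qed
qed

end
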